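(* The linear function $g^{-1}\rightharpoonup\lambda=\mu\leftharpoonup g$ on $\overline{U}_q(sl_2)$ decomposes as $$g^{-1}\rightharpoonup\lambda=\alpha_0T_0+\alpha_pT_p+\sum_{s=1}^{p-1}\big(\alpha_s^+T_s^++\alpha_s^-T_s^-+\beta_sG_s\big),$$ where $$\alpha_0=\frac{1}{2p\prod_{i=1}^{p-1}(-[i][p-i])}=\frac{(-1)^{p-1}}{2p^3}\Big(2\sin\frac{\pi}{p}\Big)^{2(p-1)},\qquad \alpha_p=\frac{1}{2p\prod_{i=1}^{p-1}([i][p-i])}=\frac{1}{2p^3}\Big(2\sin\frac{\pi}{p}\Big)^{2(p-1)},$$ $$\beta_s=\frac{1}{\gamma_s}=\frac{(-1)^{p-s-1}}{2p^3}[s]^2\Big(2\sin\frac{\pi}{p}\Big)^{2(p-1)},$$ $$\alpha_s^{+}=\alpha_s^-=-\frac{\delta_s}{(\gamma_s)^2}=-\beta_s\left(\sum_{\ell=1}^{s-1}\frac{1}{[\ell][s-\ell]}-\sum_{\ell=1}^{p-s-1}\frac{1}{[\ell][p-s-\ell]}\right).$$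
   Context: Let $p\ge 2$ be an integer and $q=\exp(\pi\sqrt{-1}/p)$. $\overline{U}_q(sl_2)$ is the Hopf algebra over $\mathbb{C}$ generated by $E,F,K,K^{-1}$ with relations $KK^{-1}=K^{-1}K=1$, $KEK^{-1}=q^2E$, $KFK^{-1}=q^{-2}F$, $EF-FE=\frac{K-K^{-1}}{q-q^{-1}}$, $E^p=F^p=0$, $K^{2p}=1$, and coproduct $\Delta(E)=1\otimes E+E\otimes K$, $\Delta(F)=K^{-1}\otimes F+F\otimes1$, $\Delta(K)=K\otimes K$. The elements $E^mF^nK^\ell$ ($0\le m,n\le p-1$, $0\le\ell\le2p-1$) form a basis. Write $[n]=\frac{q^n-q^{-n}}{q-q^{-1}}$. Empty products are $1$ and empty sums are $0$. A sign $\alpha\in\{+,-\}$ is identified with $\pm1$. Let $g=K^{p+1}$ (balancing element). $\lambda,\mu$ are the linear functions with $\lambda(E^mF^nK^\ell)=\delta_{m,p-1}\delta_{n,p-1}\delta_{\ell,p-1}$ and $\mu(E^mF^nK^\ell)=\delta_{m,p-1}\delta_{n,p-1}\delta_{\ell,p+1}$ on the basis $E^mF^nK^\ell$ ($0\le m,n\le p-1$, $0\le\ell\le2p-1$) of $\overline{U}_q(sl_2)$ (they span the left, respectively right, integrals of the dual Hopf algebra). For a linear function $f$ and elements $a,b$: $(a\rightharpoonup f)(b)=f(ba)$, $(f\leftharpoonup a)(b)=f(ab)$. The Casimir element $C=EF+\frac{q^{-1}K+qK^{-1}}{(q-q^{-1})^2}$ is central, and $\overline{U}_q(sl_2)=\bigoplus_{s=0}^pQ_s$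 as algebras, where $Q_s$ is the generalized eigenspace of (multiplication by) $C$ with eigenvalue $\frac{q^s+q^{-s}}{(q-q^{-1})^2}$. For $1\le s,t\le p$ put $v^\alpha(s,t)=\sum_{\ell=0}^{2p-1}(\alpha q^{-(s-2t+1)})^\ell K^\ell$ and $a_n^\alpha(s,t)=F^nE^{p-1}F^{p-t}v^\alpha(s,t)$. For $1\le s\le p-1$, $1\le t\le s$, $0\le n\le s-1$, $0\le k\le p-s-1$ put $\mu_m^\alpha(s)=\prod_{j=p-s-(m-1)}^{p-s-1}(-\alpha[j][p-s-j])$, $b_n^\alpha(s,t)=F^n\sum_{m=1}^{p-s}\mu_m^\alpha(s)E^{p-m-1}F^{p-t-m}v^\alpha(s,t)$, $y_k^\alpha(s,t)=F^{s+k}b_0^\alpha(s,t)$, $x_k^\alpha(s,t)=\frac{E^{p-s-k-1}}{\prod_{i=k+1}^{p-s-1}(-\alpha[i][p-s-i])}\sum_{m=1}^{p-s}\mu_m^\alpha(s)E^{p-m}F^{p-t-m}v^\alpha(s,t)$. For $1\le s\le p-1$ put $\gamma_s=2p\prod_{m=1}^{p-s-1}(-[m][p-s-m])\prod_{i=1}^{s-1}([i][s-i])$ and $\delta_s=2p\prod_{m=1}^{p-s-1}(-[m][p-s-m])\sum_{j=1}^{s-1}\prod_{1\le k\le s-1,\,k\ne j}([k][s-k])+2p\prod_{i=1}^{s-1}([i][s-i])\sum_{n=1}^{p-s-1}\prod_{1\le k\le p-s-1,\,k\ne n}(-[k][p-s-k])$. Bases. $Q_p$ (sign $+$) and $Q_0$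 (sign $-$) have bases $A_n^{\pm}(p,t)=\frac{1}{2p\prod_{i=1}^{p-1}(\pm[i][p-i])}a_n^{\pm}(p,t)$, $0\le n\le p-1$, $1\le t\le p$. For $1\le s\le p-1$, $Q_s$ has the basis consisting of the following elements ($1\le t\le s$, $1\le u\le p-s$, $0\le n\le s-1$, $0\le k\le p-s-1$): $B_n^+(s,t)=\frac1{\gamma_s}\big(b_n^+(s,t)-\frac{\delta_s}{\gamma_s}a_n^+(s,t)\big)$, $X_k^+(s,t)=\frac1{\gamma_s}x_k^+(s,t)$, $Y_k^+(s,t)=\frac1{\gamma_s}y_k^+(s,t)$, $A_n^+(s,t)=\frac1{\gamma_s}a_n^+(s,t)$, $B_k^-(p-s,u)=\frac1{\gamma_s}\big(b_k^-(p-s,u)-\frac{\delta_s}{\gamma_s}a_k^-(p-s,u)\big)$, $X_n^-(p-s,u)=\frac1{\gamma_s}x_n^-(p-s,u)$, $Y_n^-(p-s,u)=\frac1{\gamma_s}y_n^-(p-s,u)$, $A_k^-(p-s,u)=\frac1{\gamma_s}a_k^-(p-s,u)$. Linear functions (each defined on the indicated $Q_s$ and extended by $0$ to the other summands): for $x\in Q_p$ (resp. $Q_0$), $T_p(x)$ (resp. $T_0(x)$) is $\sum_{t=1}^p$ of the coefficient of $A_{t-1}^+(p,t)$ (resp. $A_{t-1}^-(p,t)$) in $x$. For $1\le s\le p-1$ and $x\in Q_s$, let $\varphi^+_{n,t}(x),\psi^+_{n,t}(x),\varphi^-_{k,u}(x),\psi^-_{k,u}(x)$ be the coefficients of $B_n^+(s,t)$,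 $A_n^+(s,t)$, $B_k^-(p-s,u)$, $A_k^-(p-s,u)$ in the expansion of $x$ in the basis of $Q_s$ formed by the elements $B_n^+(s,t)$, $X_k^+(s,t)$, $Y_k^+(s,t)$, $A_n^+(s,t)$, $B_k^-(p-s,u)$, $X_n^-(p-s,u)$, $Y_n^-(p-s,u)$, $A_k^-(p-s,u)$ ($1\le t\le s$, $1\le u\le p-s$, $0\le n\le s-1$, $0\le k\le p-s-1$); then $T_s^+(x)=\sum_{t=1}^s\varphi^+_{t-1,t}(x)$, $T_s^-(x)=\sum_{u=1}^{p-s}\varphi^-_{u-1,u}(x)$, $G_s(x)=\sum_{t=1}^s\psi^+_{t-1,t}(x)+\sum_{u=1}^{p-s}\psi^-_{u-1,u}(x)$. *)

theory Defs
  imports Complex_Main "HOL-Library.Poly_Mapping" "HOL-Library.Cardinality"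
begin

section \<open>Scalars\<close>

definition qroot :: "nat \<Rightarrow> complex" where
  "qroot p = exp (of_real pi * \<i> / of_nat p)"

definition qint :: "nat \<Rightarrow> nat \<Rightarrow> complex" where
  "qint p n = (qroot p ^ n - inverse (qroot p) ^ n) / (qroot p - inverse (qroot p))"

definition gam :: "nat \<Rightarrow> nat \<Rightarrow> complex" where
  "gam p s = 2 * of_nat p * (\<Prod>m = 1..p - s - 1. - qint p m * qint p (p - s - m))
                          * (\<Prod>i = 1..s - 1. qint p i * qint p (s - i))"

definition del :: "nat \<Rightarrow> nat \<Rightarrow> complex" where
  "del p s =
     2 * of_nat p * (\<Prod>m = 1..p - s - 1. - qint p m * qint p (p - s - m))
       * (\<Sum>j = 1..s - 1. \<Prod>k \<in> {1..s - 1} - {j}. qint p k * qint p (s - k))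
   + 2 * of_nat p * (\<Prod>i = 1..s - 1. qint p i * qint p (s - i))
       * (\<Sum>n = 1..p - s - 1. \<Prod>k \<in> {1..p - s - 1} - {n}. - qint p k * qint p (p - s - k))"


section \<open>The restricted quantum group, by generators and relations\<close>

datatype letter = LE | LF | LK | LKinv

datatype word = Word "letter list"

instantiation word :: monoid_add
begin

definition zero_word :: word where "0 = Word []"

fun plus_word :: "word \<Rightarrow> word \<Rightarrow> word" where
  "plus_word (Word u) (Word v) = Word (u @ v)"

instance
proof
  fix a b c :: word
  show "a + b + c = a + (b + c)" by (cases a; cases b; cases c) simp
  show "0 + a = a" by (cases a) (simp add: zero_word_def)
  show "a + 0 = a" by (cases a) (simp add: zero_word_def)
qed

end

text \<open>The monoid algebra of the (additively written) free monoid \<^typ>\<open>word\<close> is the free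
  associative unital algebra on the four letters.\<close>

type_synonym falg = "word \<Rightarrow>\<^sub>0 complex"

definition fconst :: "complex \<Rightarrow> falg" where "fconst c = Poly_Mapping.single 0 c"

definition fgen :: "letter \<Rightarrow> falg" where "fgen l = Poly_Mapping.single (Word [l]) 1"

definition relators :: "nat \<Rightarrow> falg set" where
  "relators p =
    {fgen LK * fgen LKinv - 1,
     fgen LKinv * fgen LK - 1,
     fgen LK * fgen LE * fgen LKinv - fconst ((qroot p)\<^sup>2) * fgen LE,
     fgen LK * fgen LF * fgen LKinv - fconst (inverse ((qroot p)\<^sup>2)) * fgen LF,
     fgen LE * fgen LF - fgen LF * fgen LE
       - fconst (1 / (qroot p - inverse (qroot p))) * (fgen LK - fgen LKinv),
     fgen LE ^ p,
     fgen LF ^ p,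
     fgen LK ^ (2 * p) - 1}"

inductive_set rel_ideal :: "nat \<Rightarrow> falg set" for p :: nat where
  relator: "x \<in> relators p \<Longrightarrow> x \<in> rel_ideal p"
| zero: "0 \<in> rel_ideal p"
| add: "x \<in> rel_ideal p \<Longrightarrow> y \<in> rel_ideal p \<Longrightarrow> x + y \<in> rel_ideal p"
| mult_left: "x \<in> rel_ideal p \<Longrightarrow> a * x \<in> rel_ideal p"
| mult_right: "x \<in> rel_ideal p \<Longrightarrow> x * a \<in> rel_ideal p"

lemma rel_ideal_uminus: "x \<in> rel_ideal p \<Longrightarrow> - x \<in> rel_ideal p"
  using rel_ideal.mult_left[of x p "-1"] by simp

text \<open>The counit shows that the quotient is not the zero ring, as the class \<^class>\<open>ring_1\<close>
  requires.\<close>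

fun word_counit :: "word \<Rightarrow> complex" where
  "word_counit (Word u) = (if set u \<subseteq> {LK, LKinv} then 1 else 0)"

definition fcounit :: "falg \<Rightarrow> complex" where
  "fcounit f = (\<Sum>w. Poly_Mapping.lookup f w * word_counit w)"

lemma word_counit_zero [simp]: "word_counit 0 = 1"
  by (simp add: zero_word_def)

lemma word_counit_plus: "word_counit (u + v) = word_counit u * word_counit v"
  by (cases u; cases v) auto

lemma fcounit_single [simp]: "fcounit (Poly_Mapping.single w c) = c * word_counit w"
proof -
  have "fcounit (Poly_Mapping.single w c) = (\<Sum>v. (if v = w then c * word_counit w else 0))"
    unfolding fcounit_def by (rule arg_cong[where f = Sum_any]) (auto simp: lookup_single when_def)
  then show ?thesis by simp
qed

lemma finite_fcounit: "finite {w. Poly_Mapping.lookup f w * word_counit w \<noteq> 0}" for f :: falg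
  by (rule finite_subset[OF _ finite_lookup[of f]]) auto

lemma fcounit_add [simp]: "fcounit (f + g) = fcounit f + fcounit g"
  unfolding fcounit_def lookup_add distrib_right
  by (rule Sum_any.distrib) (rule finite_fcounit)+

lemma fcounit_zero [simp]: "fcounit 0 = 0"
  by (simp add: fcounit_def)

lemma fcounit_uminus [simp]: "fcounit (- f) = - fcounit f"
  using fcounit_add[of f "- f"] by (simp add: eq_neg_iff_add_eq_0 add.commute)

lemma fcounit_diff [simp]: "fcounit (f - g) = fcounit f - fcounit g"
  using fcounit_add[of f "- g"] by simp

lemma falg_induct [case_names zero single add]:
  fixes f :: falg
  assumes "P 0" "\<And>w c. P (Poly_Mapping.single w c)" "\<And>f g. P f \<Longrightarrow> P g \<Longrightarrow> P (f + g)"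
  shows "P f"
proof (induction f rule: update_induct)
  case const
  show ?case by (rule assms(1))
next
  case (update f a b)
  have "Poly_Mapping.update a b f = f + Poly_Mapping.single a b"
    using update.hyps(1)
    by (intro poly_mapping_eqI) (auto simp: lookup_update lookup_add lookup_single when_def in_keys_iff)
  then show ?case using assms(2,3) update.IH by simp
qed

lemma fcounit_mult [simp]: "fcounit (f * g) = fcounit f * fcounit g"
proof -
  have single_mult: "fcounit (Poly_Mapping.single w c * g) = c * word_counit w * fcounit g" for w c
  proof (induction g rule: falg_induct)
    case zero
    then show ?case by simp
  next
    case (single v d)
    then show ?case by (simp add: mult_single word_counit_plus)
  next
    case (add g1 g2)
    then show ?case by (simp add: distrib_left)
  qed
  show ?thesis
  proof (induction f rule: falg_induct)
    case zero
    then show ?case by simp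
  next
    case (single w c)
    then show ?case by (simp add: single_mult)
  next
    case (add f1 f2)
    then show ?case by (simp add: distrib_right)
  qed
qed

lemma fcounit_one [simp]: "fcounit 1 = 1"
  by (simp flip: single_one)

lemma fcounit_power [simp]: "fcounit (f ^ n) = fcounit f ^ n"
  by (induction n) simp_all

lemma fcounit_rel_ideal:
  assumes "p > 0" "x \<in> rel_ideal p"
  shows "fcounit x = 0"
  using assms(2)
proof induction
  case (relator x)
  then show ?case using assms(1) by (auto simp: relators_def fgen_def fconst_def)
qed simp_all

text \<open>The integer \<^term>\<open>p\<close> is the cardinality of the index type.\<close>

quotient_type (overloaded) 'p uqsl2 = falg / "\<lambda>x y. x - y \<in> rel_ideal CARD('p::finite)"
proof (rule equivpI)
  show "reflp (\<lambda>x y. x - y \<in> rel_ideal CARD('p))"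
    by (simp add: reflp_def rel_ideal.zero)
  show "symp (\<lambda>x y. x - y \<in> rel_ideal CARD('p))"
    unfolding symp_def using rel_ideal_uminus by fastforce
  show "transp (\<lambda>x y. x - y \<in> rel_ideal CARD('p))"
  proof (rule transpI)
    fix x y z :: falg
    assume "x - y \<in> rel_ideal CARD('p)" "y - z \<in> rel_ideal CARD('p)"
    from rel_ideal.add[OF this] show "x - z \<in> rel_ideal CARD('p)" by simp
  qed
qed

instantiation uqsl2 :: (finite) ring_1
begin

lift_definition zero_uqsl2 :: "'a uqsl2" is 0 .

lift_definition one_uqsl2 :: "'a uqsl2" is 1 .

lift_definition plus_uqsl2 :: "'a uqsl2 \<Rightarrow> 'a uqsl2 \<Rightarrow> 'a uqsl2" is "(+)"
  by (metis add_diff_add rel_ideal.add)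

lift_definition uminus_uqsl2 :: "'a uqsl2 \<Rightarrow> 'a uqsl2" is uminus
  by (metis minus_diff_minus rel_ideal_uminus)

lift_definition minus_uqsl2 :: "'a uqsl2 \<Rightarrow> 'a uqsl2 \<Rightarrow> 'a uqsl2" is "(-)"
proof -
  fix x x' y y' :: falg
  assume "x - x' \<in> rel_ideal CARD('a)" "y - y' \<in> rel_ideal CARD('a)"
  then have "(x - x') + - (y - y') \<in> rel_ideal CARD('a)"
    by (intro rel_ideal.add rel_ideal_uminus)
  then show "x - y - (x' - y') \<in> rel_ideal CARD('a)" by (simp add: algebra_simps)
qed

lift_definition times_uqsl2 :: "'a uqsl2 \<Rightarrow> 'a uqsl2 \<Rightarrow> 'a uqsl2" is "(*)"
proof -
  fix x x' y y' :: falg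
  assume "x - x' \<in> rel_ideal CARD('a)" "y - y' \<in> rel_ideal CARD('a)"
  then have "(x - x') * y + x' * (y - y') \<in> rel_ideal CARD('a)"
    by (intro rel_ideal.add rel_ideal.mult_left rel_ideal.mult_right)
  then show "x * y - x' * y' \<in> rel_ideal CARD('a)" by (simp add: algebra_simps)
qed

instance
proof
  fix a b c :: "'a uqsl2"
  show "a + b + c = a + (b + c)" by transfer (simp add: rel_ideal.zero add.assoc)
  show "a + b = b + a" by transfer (simp add: rel_ideal.zero add.commute)
  show "0 + a = a" by transfer (simp add: rel_ideal.zero)
  show "- a + a = 0" by transfer (simp add: rel_ideal.zero)
  show "a - b = a + - b" by transfer (simp add: rel_ideal.zero)
  show "a * b * c = a * (b * c)" by transfer (simp add: rel_ideal.zero mult.assoc)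
  show "(a + b) * c = a * c + b * c" by transfer (simp add: rel_ideal.zero distrib_right)
  show "a * (b + c) = a * b + a * c" by transfer (simp add: rel_ideal.zero distrib_left)
  show "1 * a = a" by transfer (simp add: rel_ideal.zero)
  show "a * 1 = a" by transfer (simp add: rel_ideal.zero)
  show "(0 :: 'a uqsl2) \<noteq> 1"
  proof transfer
    show "(0 :: falg) - 1 \<notin> rel_ideal CARD('a)"
      using fcounit_rel_ideal[of "CARD('a)" "0 - 1"] by auto
  qed
qed

end

lift_definition scaleU :: "complex \<Rightarrow> 'p::finite uqsl2 \<Rightarrow> 'p uqsl2"  (infixr \<open>*\<^sub>U\<close> 75)
  is "\<lambda>c x. fconst c * x"
  by (metis right_diff_distrib rel_ideal.mult_left)

lemma fconst_simps:
  "fconst (a + b) = fconst a + fconst b" "fconst (a * b) = fconst a * fconst b" "fconst 1 = 1"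
  by (simp_all add: fconst_def single_add mult_single)

global_interpretation U: vector_space "scaleU :: complex \<Rightarrow> 'p::finite uqsl2 \<Rightarrow> 'p uqsl2"
  defines spanU = U.span
    and independentU = U.independent
    and coeffU = U.representation
proof
  fix a b :: complex and x y :: "'p uqsl2"
  show "a *\<^sub>U (x + y) = a *\<^sub>U x + a *\<^sub>U y"
    by transfer (simp add: rel_ideal.zero distrib_left)
  show "(a + b) *\<^sub>U x = a *\<^sub>U x + b *\<^sub>U x"
    by transfer (simp add: rel_ideal.zero fconst_simps distrib_right)
  show "a *\<^sub>U b *\<^sub>U x = (a * b) *\<^sub>U x"
    by transfer (simp add: rel_ideal.zero fconst_simps mult.assoc)
  show "1 *\<^sub>U x = x"
    by transfer (simp add: rel_ideal.zero fconst_simps)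
qed

lift_definition genE :: "'p::finite uqsl2" is "fgen LE" .
lift_definition genF :: "'p::finite uqsl2" is "fgen LF" .
lift_definition genK :: "'p::finite uqsl2" is "fgen LK" .
lift_definition genKinv :: "'p::finite uqsl2" is "fgen LKinv" .

lemma uqsl2_relations:
  fixes E F K Kinv :: "'p::finite uqsl2"
  defines "E \<equiv> genE" and "F \<equiv> genF" and "K \<equiv> genK" and "Kinv \<equiv> genKinv"
    and "q \<equiv> qroot CARD('p)"
  shows "K * Kinv = 1" "Kinv * K = 1"
    "K * E * Kinv = q\<^sup>2 *\<^sub>U E" "K * F * Kinv = inverse (q\<^sup>2) *\<^sub>U F"
    "E * F - F * E = (1 / (q - inverse q)) *\<^sub>U (K - Kinv)"
    "E ^ CARD('p) = 0" "F ^ CARD('p) = 0" "K ^ (2 * CARD('p)) = 1"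
proof -
  have pow: "abs_uqsl2 x ^ n = (abs_uqsl2 (x ^ n) :: 'p uqsl2)" for x n
    by (induction n) (simp_all add: one_uqsl2.abs_eq times_uqsl2.abs_eq)
  note eqs = genE.abs_eq genF.abs_eq genK.abs_eq genKinv.abs_eq pow zero_uqsl2.abs_eq
    one_uqsl2.abs_eq times_uqsl2.abs_eq minus_uqsl2.abs_eq scaleU.abs_eq uqsl2.abs_eq_iff
  show "K * Kinv = 1" "Kinv * K = 1"
    "K * E * Kinv = q\<^sup>2 *\<^sub>U E" "K * F * Kinv = inverse (q\<^sup>2) *\<^sub>U F"
    "E * F - F * E = (1 / (q - inverse q)) *\<^sub>U (K - Kinv)"
    "E ^ CARD('p) = 0" "F ^ CARD('p) = 0" "K ^ (2 * CARD('p)) = 1"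
    unfolding assms eqs by (rule rel_ideal.relator; simp add: relators_def)+
qed


section \<open>Balancing element, integrals and Casimir element\<close>

definition bal :: "'p::finite uqsl2" where
  "bal = genK ^ (CARD('p) + 1)"

definition bal_inv :: "'p::finite uqsl2" where
  "bal_inv = genKinv ^ (CARD('p) + 1)"

lemma bal_inverse: "bal * bal_inv = (1 :: 'p::finite uqsl2)" "bal_inv * bal = (1 :: 'p uqsl2)"
  unfolding bal_def bal_inv_def by (intro left_right_inverse_power uqsl2_relations)+

definition pbw :: "nat \<Rightarrow> nat \<Rightarrow> nat \<Rightarrow> 'p::finite uqsl2" where
  "pbw m n l = genE ^ m * genF ^ n * genK ^ l"

definition lam :: "'p::finite uqsl2 \<Rightarrow> complex" where
  "lam = (THE f. Vector_Spaces.linear scaleU (*) f \<and>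
     (\<forall>m < CARD('p). \<forall>n < CARD('p). \<forall>l < 2 * CARD('p).
        f (pbw m n l) = of_bool (m = CARD('p) - 1 \<and> n = CARD('p) - 1 \<and> l = CARD('p) - 1)))"

definition mu :: "'p::finite uqsl2 \<Rightarrow> complex" where
  "mu = (THE f. Vector_Spaces.linear scaleU (*) f \<and>
     (\<forall>m < CARD('p). \<forall>n < CARD('p). \<forall>l < 2 * CARD('p).
        f (pbw m n l) = of_bool (m = CARD('p) - 1 \<and> n = CARD('p) - 1 \<and> l = CARD('p) + 1)))"

definition left_hook ::
    "'p::finite uqsl2 \<Rightarrow> ('p uqsl2 \<Rightarrow> complex) \<Rightarrow> 'p uqsl2 \<Rightarrow> complex"  (infixr \<open>\<rightharpoonup>\<^sub>U\<close> 70) where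
  "(a \<rightharpoonup>\<^sub>U f) = (\<lambda>b. f (b * a))"

definition right_hook ::
    "('p::finite uqsl2 \<Rightarrow> complex) \<Rightarrow> 'p uqsl2 \<Rightarrow> 'p uqsl2 \<Rightarrow> complex"  (infixl \<open>\<leftharpoonup>\<^sub>U\<close> 70) where
  "(f \<leftharpoonup>\<^sub>U a) = (\<lambda>b. f (a * b))"

definition casimir :: "'p::finite uqsl2" where
  "casimir = (let q = qroot CARD('p) in
     genE * genF + (1 / (q - inverse q)\<^sup>2) *\<^sub>U (inverse q *\<^sub>U genK + q *\<^sub>U genKinv))"

definition casimir_eig :: "nat \<Rightarrow> nat \<Rightarrow> complex" where
  "casimir_eig p s =
     (qroot p ^ s + inverse (qroot p) ^ s) / (qroot p - inverse (qroot p))\<^sup>2"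

text \<open>The block \<open>Q\<^sub>s\<close>, and the projection onto it along the other blocks.\<close>

definition blk :: "nat \<Rightarrow> 'p::finite uqsl2 set" where
  "blk s = {x. \<exists>n. (casimir - casimir_eig CARD('p) s *\<^sub>U 1) ^ n * x = 0}"

definition blk_proj :: "nat \<Rightarrow> 'p::finite uqsl2 \<Rightarrow> 'p uqsl2" where
  "blk_proj s x = (THE y. (\<forall>j \<le> CARD('p). y j \<in> blk j) \<and> (\<forall>j > CARD('p). y j = 0)
                        \<and> x = (\<Sum>j \<le> CARD('p). y j)) s"


section \<open>Bases of the blocks\<close>

text \<open>Signs are the complex numbers \<open>\<alpha> = 1\<close> and \<open>\<alpha> = -1\<close>.\<close>

definition vvec :: "complex \<Rightarrow> nat \<Rightarrow> nat \<Rightarrow> 'p::finite uqsl2" where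
  "vvec \<alpha> s t = (\<Sum>l < 2 * CARD('p).
     (\<alpha> * qroot CARD('p) powi (- (int s - 2 * int t + 1))) ^ l *\<^sub>U genK ^ l)"

definition avec :: "complex \<Rightarrow> nat \<Rightarrow> nat \<Rightarrow> nat \<Rightarrow> 'p::finite uqsl2" where
  "avec \<alpha> n s t = genF ^ n * genE ^ (CARD('p) - 1) * genF ^ (CARD('p) - t) * vvec \<alpha> s t"

definition mucoef :: "nat \<Rightarrow> complex \<Rightarrow> nat \<Rightarrow> nat \<Rightarrow> complex" where
  "mucoef p \<alpha> m s = (\<Prod>j = p - s - (m - 1)..p - s - 1. - \<alpha> * qint p j * qint p (p - s - j))"

definition bvec :: "complex \<Rightarrow> nat \<Rightarrow> nat \<Rightarrow> nat \<Rightarrow> 'p::finite uqsl2" where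
  "bvec \<alpha> n s t = genF ^ n * (\<Sum>m = 1..CARD('p) - s. mucoef CARD('p) \<alpha> m s *\<^sub>U
     (genE ^ (CARD('p) - m - 1) * genF ^ (CARD('p) - t - m) * vvec \<alpha> s t))"

definition yvec :: "complex \<Rightarrow> nat \<Rightarrow> nat \<Rightarrow> nat \<Rightarrow> 'p::finite uqsl2" where
  "yvec \<alpha> k s t = genF ^ (s + k) * bvec \<alpha> 0 s t"

definition xvec :: "complex \<Rightarrow> nat \<Rightarrow> nat \<Rightarrow> nat \<Rightarrow> 'p::finite uqsl2" where
  "xvec \<alpha> k s t =
     (1 / (\<Prod>i = k + 1..CARD('p) - s - 1. - \<alpha> * qint CARD('p) i * qint CARD('p) (CARD('p) - s - i))) *\<^sub>U
     (genE ^ (CARD('p) - s - k - 1) * (\<Sum>m = 1..CARD('p) - s. mucoef CARD('p) \<alpha> m s *\<^sub>U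
        (genE ^ (CARD('p) - m) * genF ^ (CARD('p) - t - m) * vvec \<alpha> s t)))"

text \<open>In \<open>Bb\<close>, \<open>Xb\<close>, \<open>Yb\<close>, \<open>Ab\<close> the argument \<open>s\<close> is the index of the block \<open>Q\<^sub>s\<close>, with
  normalisation constants \<open>\<gamma>\<^sub>s\<close>, \<open>\<delta>\<^sub>s\<close> for both signs, while \<open>r\<close> is the first argument of
  \<open>a\<^sup>\<alpha>\<close>, \<open>b\<^sup>\<alpha>\<close>, \<open>x\<^sup>\<alpha>\<close>, \<open>y\<^sup>\<alpha>\<close>: it is \<open>s\<close> for \<open>\<alpha> = 1\<close> and \<open>p - s\<close> for \<open>\<alpha> = -1\<close>.\<close>

definition Ab :: "nat \<Rightarrow> complex \<Rightarrow> nat \<Rightarrow> nat \<Rightarrow> nat \<Rightarrow> 'p::finite uqsl2" where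
  "Ab s \<alpha> n r t = (1 / gam CARD('p) s) *\<^sub>U avec \<alpha> n r t"

definition Bb :: "nat \<Rightarrow> complex \<Rightarrow> nat \<Rightarrow> nat \<Rightarrow> nat \<Rightarrow> 'p::finite uqsl2" where
  "Bb s \<alpha> n r t = (1 / gam CARD('p) s) *\<^sub>U
     (bvec \<alpha> n r t - (del CARD('p) s / gam CARD('p) s) *\<^sub>U avec \<alpha> n r t)"

definition Xb :: "nat \<Rightarrow> complex \<Rightarrow> nat \<Rightarrow> nat \<Rightarrow> nat \<Rightarrow> 'p::finite uqsl2" where
  "Xb s \<alpha> k r t = (1 / gam CARD('p) s) *\<^sub>U xvec \<alpha> k r t"

definition Yb :: "nat \<Rightarrow> complex \<Rightarrow> nat \<Rightarrow> nat \<Rightarrow> nat \<Rightarrow> 'p::finite uqsl2" where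
  "Yb s \<alpha> k r t = (1 / gam CARD('p) s) *\<^sub>U yvec \<alpha> k r t"

definition half_basis :: "nat \<Rightarrow> complex \<Rightarrow> nat \<Rightarrow> 'p::finite uqsl2 set" where
  "half_basis s \<alpha> r =
     {Bb s \<alpha> n r t | n t. n < r \<and> 1 \<le> t \<and> t \<le> r} \<union>
     {Xb s \<alpha> k r t | k t. k < CARD('p) - r \<and> 1 \<le> t \<and> t \<le> r} \<union>
     {Yb s \<alpha> k r t | k t. k < CARD('p) - r \<and> 1 \<le> t \<and> t \<le> r} \<union>
     {Ab s \<alpha> n r t | n t. n < r \<and> 1 \<le> t \<and> t \<le> r}"

definition blk_basis :: "nat \<Rightarrow> 'p::finite uqsl2 set" where
  "blk_basis s = half_basis s 1 s \<union> half_basis s (-1) (CARD('p) - s)"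

text \<open>The two extreme blocks: \<open>Q\<^sub>p\<close> for \<open>\<alpha> = 1\<close> and \<open>Q\<^sub>0\<close> for \<open>\<alpha> = -1\<close>.\<close>

definition Aend :: "complex \<Rightarrow> nat \<Rightarrow> nat \<Rightarrow> 'p::finite uqsl2" where
  "Aend \<alpha> n t =
     (1 / (2 * of_nat CARD('p) * (\<Prod>i = 1..CARD('p) - 1. \<alpha> * qint CARD('p) i * qint CARD('p) (CARD('p) - i))))
     *\<^sub>U avec \<alpha> n CARD('p) t"

definition end_basis :: "complex \<Rightarrow> 'p::finite uqsl2 set" where
  "end_basis \<alpha> = {Aend \<alpha> n t | n t. n < CARD('p) \<and> 1 \<le> t \<and> t \<le> CARD('p)}"


section \<open>The linear functions\<close>

definition Tp :: "'p::finite uqsl2 \<Rightarrow> complex" where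
  "Tp x = (\<Sum>t = 1..CARD('p). coeffU (end_basis 1) (blk_proj CARD('p) x) (Aend 1 (t - 1) t))"

definition T0 :: "'p::finite uqsl2 \<Rightarrow> complex" where
  "T0 x = (\<Sum>t = 1..CARD('p). coeffU (end_basis (-1)) (blk_proj 0 x) (Aend (-1) (t - 1) t))"

definition Tplus :: "nat \<Rightarrow> 'p::finite uqsl2 \<Rightarrow> complex" where
  "Tplus s x = (\<Sum>t = 1..s. coeffU (blk_basis s) (blk_proj s x) (Bb s 1 (t - 1) s t))"

definition Tminus :: "nat \<Rightarrow> 'p::finite uqsl2 \<Rightarrow> complex" where
  "Tminus s x = (\<Sum>u = 1..CARD('p) - s.
     coeffU (blk_basis s) (blk_proj s x) (Bb s (-1) (u - 1) (CARD('p) - s) u))"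

definition Gfun :: "nat \<Rightarrow> 'p::finite uqsl2 \<Rightarrow> complex" where
  "Gfun s x =
     (\<Sum>t = 1..s. coeffU (blk_basis s) (blk_proj s x) (Ab s 1 (t - 1) s t)) +
     (\<Sum>u = 1..CARD('p) - s.
       coeffU (blk_basis s) (blk_proj s x) (Ab s (-1) (u - 1) (CARD('p) - s) u))"

end

(*
  Up to translation by the balancing element, both integrals equal the linear form tau with
  tau(E^m F^n K^l) = 1 if m = n = p - 1 and 2p divides l, and 0 otherwise.  It exists because it is
  built from matrix coefficients of the modules induced from the weights of K.  Among the basis
  elements of the blocks tau is easy to evaluate: b_n, x_k, y_k have too small a degree in E or in F,
  so tau vanishes on them, and tau(a_n(s,t)) = 1 if n = t - 1 and 0 otherwise.  This gives the
  coefficients, provided that the proposed elements do form a basis.  They are separated by the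
  Casimir element, by right and by left multiplication by K, up to pairs {A, B} and {X, Y}, and these
  are separated by applying powers of E and F, which lead back to a_0; a_0 is nonzero because tau does
  not vanish on F^(t-1) a_0.  There are 2 p^3 of them, as many as the monomials spanning the algebra.
*)

theory Submission
  imports Defs "HOL-Computational_Algebra.Polynomial"
begin

section \<open>Quantum integers at a root of unity\<close>

text \<open>The algebra is a bare quotient of a free algebra, so its dimension is not known
  beforehand. That the monomials span it is a rewriting argument; their independence is never shown
  directly but replaced by the count of the block vectors. Both \<open>lam\<close> and
  \<open>mu\<close> are definite descriptions: spanning gives uniqueness, while existence needs an
  actual linear form on the quotient, which is why tau must be built from modules. One form serves
  both integrals because g = K^(p+1) raises the exponent p - 1 of K to 2p, and g^(-1) = K^(p-1) does
  so for p + 1. The coefficients can be read off the normalisations: A = a/gamma_s gives 1/gamma_s,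
  and in B = (b - (delta_s/gamma_s) a)/gamma_s only the correction by a is seen by tau, which gives
  -delta_s/gamma_s^2. The decomposition into blocks, on which the projections depend, is likewise a
  result: existence comes from the expansion in the basis, uniqueness from the distinct Casimir
  eigenvalues.\<close>

definition bra :: "nat \<Rightarrow> complex \<Rightarrow> complex" where
  "bra p c = (c - inverse c) / (qroot p - inverse (qroot p))"

text \<open>\<open>bra p c\<close> is the scalar by which E F - F E acts on a vector of K-weight
  \<open>c\<close>; quantum integers are the case c = q^n. Keeping \<open>c\<close> free also covers
  weights with a sign.\<close>

lemma qint_eq_bra: "qint p n = bra p (qroot p ^ n)"
  by (simp add: qint_def bra_def power_inverse)

lemma qroot_cis: "qroot p = cis (pi / real p)"
  by (simp add: qroot_def cis_conv_exp mult.commute)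

lemma qroot_nonzero [simp]: "qroot p \<noteq> 0"
  by (simp add: qroot_def)

lemma qroot_powi_cis: "qroot p powi k = cis (of_int k * (pi / real p))"
  by (simp add: qroot_cis cis_power_int)

lemma qroot_powi_eq_1_iff:
  assumes "p \<ge> 2"
  shows "qroot p powi k = 1 \<longleftrightarrow> 2 * int p dvd k"
proof
  assume "qroot p powi k = 1"
  then have "cos (of_int k * (pi / real p)) = 1"
    by (metis qroot_powi_cis cis.sel(1) one_complex.sel(1))
  then obtain n :: int where "of_int k * (pi / real p) = of_int n * 2 * pi"
    unfolding cos_one_2pi_int by auto
  then have "of_int k = (of_int (2 * int p * n) :: real)"
    using assms by (simp add: field_simps)
  then have "k = 2 * int p * n" by (simp only: of_int_eq_iff)
  then show "2 * int p dvd k" by simp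
next
  assume "2 * int p dvd k"
  then obtain n where "k = 2 * int p * n" by blast
  then have "of_int k * (pi / real p) = 2 * pi * of_int n"
    using assms by simp
  then show "qroot p powi k = 1"
    unfolding qroot_powi_cis by (simp add: cis_multiple_2pi)
qed

lemma qroot_pow_p:
  assumes "p \<ge> 2"
  shows "qroot p ^ p = -1"
  using qroot_powi_cis[of p "int p"] assms by (simp add: complex_eq_iff)

lemma qroot_powi_add_p:
  assumes "p \<ge> 2"
  shows "qroot p powi (k + int p) = - (qroot p powi k)"
  using qroot_pow_p[OF assms] by (simp add: power_int_add)

lemma qroot_pow_2p:
  assumes "p \<ge> 2"
  shows "qroot p ^ (2 * p) = 1"
  using qroot_pow_p[OF assms] by (simp add: mult.commute[of 2] power_mult)

lemma qroot_powi_eq_iff: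
  assumes "p \<ge> 2"
  shows "qroot p powi k = qroot p powi l \<longleftrightarrow> 2 * int p dvd k - l"
proof -
  have "qroot p powi k = qroot p powi l \<longleftrightarrow> qroot p powi (k - l) = 1"
    by (simp add: power_int_diff)
  then show ?thesis using qroot_powi_eq_1_iff[OF assms] by simp
qed

text \<open>q^2 is a primitive p-th root of unity, so weights descending in steps of q^(-2) repeat
  only after p steps. This serves the right weights, the left weights and the roots of a polynomial
  below.\<close>

lemma qroot_powi_shift_inj:
  assumes "p \<ge> 2" "qroot p powi (c - 2 * int i) = qroot p powi (c - 2 * int j)" "\<bar>int i - int j\<bar> < int p"
  shows "i = j"
proof -
  have "2 * int p dvd 2 * (int j - int i)"
    using assms(2) unfolding qroot_powi_eq_iff[OF assms(1)] by (simp add: right_diff_distrib)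
  then have "int p dvd int j - int i" unfolding dvd_mult_cancel_left by simp
  then show ?thesis using assms(3) dvd_imp_le_int[of "int j - int i" "int p"] by (cases "i = j") auto
qed

lemma qroot_diff_sin: "qroot p - inverse (qroot p) = \<i> * of_real (2 * sin (pi / real p))"
proof -
  have "inverse (qroot p) = cis (- (pi / real p))" by (simp add: qroot_cis)
  then show ?thesis by (simp add: qroot_cis complex_eq_iff)
qed

lemma qroot_diff_nonzero:
  assumes "p \<ge> 2"
  shows "qroot p - inverse (qroot p) \<noteq> 0"
proof -
  have "sin (pi / real p) > 0"
    using assms by (intro sin_gt_zero) (auto simp: divide_simps)
  then show ?thesis unfolding qroot_diff_sin by simp
qed

lemma bra_qroot_eq_0_iff:
  assumes "p \<ge> 2"
  shows "bra p (qroot p powi k) = 0 \<longleftrightarrow> int p dvd k"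
proof -
  have "bra p (qroot p powi k) = 0 \<longleftrightarrow> qroot p powi k = qroot p powi (- k)"
    using qroot_diff_nonzero[OF assms] by (simp add: bra_def power_int_minus)
  also have "\<dots> \<longleftrightarrow> 2 * int p dvd 2 * k"
    using qroot_powi_eq_iff[OF assms, of k "- k"] by simp
  finally show ?thesis by simp
qed

lemma bra_minus: "bra p (- c) = - bra p c"
proof -
  have "- c - inverse (- c) = - (c - inverse c)" by simp
  then show ?thesis unfolding bra_def by (metis minus_divide_left)
qed

lemma bra_sign:
  assumes "\<alpha> = 1 \<or> \<alpha> = -1"
  shows "bra p (\<alpha> * c) = \<alpha> * bra p c"
  using assms by (auto simp: bra_minus)

lemma qint_eq_bra_powi: "qint p n = bra p (qroot p powi int n)"
  by (simp add: qint_eq_bra)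

lemma qint_nonzero:
  assumes "p \<ge> 2" "0 < n" "n < p"
  shows "qint p n \<noteq> 0"
  using assms bra_qroot_eq_0_iff[OF assms(1), of "int n"]
  by (auto simp: qint_eq_bra dest: zdvd_imp_le)

lemma qint_0 [simp]: "qint p 0 = 0"
  by (simp add: qint_def)

lemma qint_p:
  assumes "p \<ge> 2"
  shows "qint p p = 0"
  using bra_qroot_eq_0_iff[OF assms, of "int p"] by (simp add: qint_eq_bra)

lemma qint_1:
  assumes "p \<ge> 2"
  shows "qint p (Suc 0) = 1"
  using qroot_diff_nonzero[OF assms] by (simp add: qint_def)

text \<open>From q^p = -1 one gets q^(p-n) = -q^(-n), and \<open>bra\<close> changes sign under
  negation as well as under inversion.\<close>

lemma qint_symm:
  assumes "p \<ge> 2" "n \<le> p"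
  shows "qint p (p - n) = qint p n"
proof -
  have "qroot p powi int (p - n) = - (qroot p powi (- int n))"
    using qroot_powi_add_p[OF assms(1), of "- int n"] assms(2)
    by (simp add: of_nat_diff algebra_simps)
  then show ?thesis
    unfolding qint_eq_bra_powi by (simp add: bra_def power_int_minus minus_divide_left)
qed

text \<open>These identities drive the inductions that commute \<open>E\<close> with \<open>F\<^sup>n\<^sup>+\<^sup>1\<close>, and \<open>F\<close> with
  \<open>E\<^sup>n\<^sup>+\<^sup>1\<close>, on a vector of weight \<open>c\<close>.\<close>

lemma bra_commutator_F:
  assumes "p \<ge> 2" "c \<noteq> 0"
  shows "qint p (Suc (Suc n)) * bra p (c * inverse (qroot p) ^ Suc n)
    = qint p (Suc n) * bra p (c * inverse (qroot p) ^ n) + bra p (c * inverse ((qroot p)\<^sup>2) ^ Suc n)"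
proof -
  define q where "q = qroot p"
  define x where "x = q ^ n"
  have nz: "q \<noteq> 0" "x \<noteq> 0" and d: "q - inverse q \<noteq> 0"
    using qroot_diff_nonzero[OF assms(1)] by (auto simp: q_def x_def)
  have eqs: "q ^ Suc (Suc n) = q * q * x" "q ^ Suc n = q * x" "c * inverse q ^ Suc n = c / (q * x)"
    "c * inverse q ^ n = c / x" "c * inverse (q\<^sup>2) ^ Suc n = c / (q * q * x * x)"
    by (simp_all add: x_def power_inverse power_mult_distrib power2_eq_square field_simps)
  \<comment> \<open>Clears the denominator as an opaque nonzero \<open>d\<close>; the remaining
    identity between Laurent monomials needs only that q, x and c are nonzero.\<close>
  have frac: "A / d * (B / d) = C / d * (D / d) + G / d"
    if "A * B = C * D + d * G" "d \<noteq> 0" for A B C D G d :: complex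
    using that by (simp add: divide_simps)
  have "(q * q * x - inverse (q * q * x)) * (c / (q * x) - inverse (c / (q * x)))
     = (q * x - inverse (q * x)) * (c / x - inverse (c / x))
      + (q - inverse q) * (c / (q * q * x * x) - inverse (c / (q * q * x * x)))"
    using nz assms(2) by (simp add: field_simps)
  from frac[OF this d] show ?thesis
    unfolding qint_eq_bra bra_def q_def[symmetric] eqs .
qed

text \<open>Replace c by its inverse in the identity for F: \<open>bra\<close> is odd under
  inversion, and q^(-1) turns into q.\<close>

lemma bra_commutator_E:
  assumes "p \<ge> 2" "c \<noteq> 0"
  shows "qint p (Suc (Suc n)) * bra p (c * qroot p ^ Suc n)
    = qint p (Suc n) * bra p (c * qroot p ^ n) + bra p (c * (qroot p)\<^sup>2 ^ Suc n)"
proof -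
  have inv: "bra p (inverse x) = - bra p x" for x
    by (simp add: bra_def minus_divide_left)
  have "qint p (Suc (Suc n)) * bra p (inverse (c * qroot p ^ Suc n))
    = qint p (Suc n) * bra p (inverse (c * qroot p ^ n)) + bra p (inverse (c * (qroot p)\<^sup>2 ^ Suc n))"
    using bra_commutator_F[OF assms(1), of "inverse c" n] assms(2) by (simp add: power_inverse)
  then show ?thesis unfolding inv by (simp add: algebra_simps neg_eq_iff_add_eq_0)
qed

lemma casimir_eig_cos:
  "casimir_eig p s = of_real (2 * cos (of_nat s * (pi / real p))) / (qroot p - inverse (qroot p))\<^sup>2"
proof -
  have "qroot p ^ s + inverse (qroot p) ^ s
    = cis (of_nat s * (pi / real p)) + cis (- (of_nat s * (pi / real p)))"
    by (simp add: qroot_cis DeMoivre flip: power_inverse)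
  also have "\<dots> = of_real (2 * cos (of_nat s * (pi / real p)))"
    by (simp add: complex_eq_iff)
  finally show ?thesis by (simp add: casimir_eig_def)
qed

text \<open>The eigenvalue is a fixed nonzero multiple of cos(pi s/p), and the cosine is injective
  on [0, pi].\<close>

lemma casimir_eig_inj:
  assumes "p \<ge> 2"
  shows "inj_on (casimir_eig p) {..p}"
proof
  fix s t assume st: "s \<in> {..p}" "t \<in> {..p}" and eq: "casimir_eig p s = casimir_eig p t"
  have "of_real (2 * cos (of_nat s * (pi / real p))) = (of_real (2 * cos (of_nat t * (pi / real p))) :: complex)"
    using eq qroot_diff_nonzero[OF assms] unfolding casimir_eig_cos by simp
  then have "cos (of_nat s * (pi / real p)) = cos (of_nat t * (pi / real p))"
    unfolding of_real_eq_iff by simp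
  then have "of_nat s * (pi / real p) = of_nat t * (pi / real p)"
    by (rule cos_inj_pi[rotated 4]) (use st assms in \<open>auto simp: field_simps\<close>)
  then show "s = t" using assms by simp
qed

text \<open>Value at 1 of the factorisation of 1 + z + ... + z^(p-1) into the factors z - w^i, where
  w = q^2 is a primitive p-th root of unity.\<close>

lemma prod_one_minus_roots_of_unity:
  assumes "p \<ge> 2"
  shows "(\<Prod>i = 1..<p. 1 - ((qroot p)\<^sup>2) ^ i) = of_nat p"
proof -
  define \<omega> where "\<omega> = (qroot p)\<^sup>2"
  define P where "P = (\<Sum>k<p. monom (1::complex) k)"
  define Q where "Q = (\<Prod>i = 1..<p. [:- (\<omega> ^ i), 1:])"
  have w: "\<omega> ^ i = qroot p powi int (2 * i)" for i
    unfolding power_int_of_nat by (simp add: \<omega>_def power_mult)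
  have wp: "\<omega> ^ p = 1"
    unfolding \<omega>_def using qroot_pow_2p[OF assms] by (simp add: power_mult)
  have inj: "inj_on (\<lambda>i. \<omega> ^ i) {..<p}"
  proof
    fix i j assume ij: "i \<in> {..<p}" "j \<in> {..<p}" "\<omega> ^ i = \<omega> ^ j"
    then have "qroot p powi (0 - 2 * int i) = qroot p powi (0 - 2 * int j)"
      unfolding w by (simp add: power_int_minus)
    then show "i = j" by (rule qroot_powi_shift_inj[OF assms]) (use ij in auto)
  qed
  have degQ: "degree Q = p - 1"
    unfolding Q_def by (subst degree_prod_eq_sum_degree) auto
  have lcQ: "lead_coeff Q = 1"
    unfolding Q_def lead_coeff_prod by simp
  have "P = Q"
  \<comment> \<open>Polynomials of degree at most p - 1 with equal top coefficient coincide once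
    they agree at p - 1 points, here the common roots w^i.\<close>
  proof (rule poly_eqI_degree_lead_coeff)
    show "coeff P (p - 1) = coeff Q (p - 1)"
      using lcQ degQ assms by (simp add: P_def coeff_sum)
    show "card ((\<lambda>i. \<omega> ^ i) ` {1..<p}) \<ge> p - 1"
      using inj by (subst card_image) (auto elim: inj_on_subset)
    show "degree P \<le> p - 1"
      unfolding P_def by (rule degree_sum_le) (auto intro: order_trans[OF degree_monom_le])
    show "degree Q \<le> p - 1" using degQ by simp
    fix z assume "z \<in> (\<lambda>i. \<omega> ^ i) ` {1..<p}"
    then obtain i where i: "1 \<le> i" "i < p" "z = \<omega> ^ i" by auto
    have "z \<noteq> 1"
      using inj_onD[OF inj, of i 0] i by auto
    moreover have "z ^ p = 1"
      unfolding i(3) power_mult[symmetric] by (metis mult.commute power_mult power_one wp)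
    ultimately have "(\<Sum>k<p. z ^ k) = 0"
      by (simp add: geometric_sum)
    then have "poly P z = 0" by (simp add: P_def poly_sum poly_monom)
    moreover have "poly Q z = 0"
      using i by (auto simp: Q_def poly_prod)
    ultimately show "poly P z = poly Q z" by simp
  qed
  then have "poly P 1 = poly Q 1" by simp
  then show ?thesis
    by (simp add: P_def Q_def poly_sum poly_monom poly_prod \<omega>_def[symmetric])
qed

text \<open>Source of the sine powers: q - q^(-1) = 2 i sin(pi/p), and q^(p-i) = -q^(-i) turns
  [i][p-i] into (1 - w^i)(1 - w^(p-i)) over (2 sin(pi/p))^2, with w = q^2. Each of the two families
  of factors multiplies to p.\<close>

lemma prod_qint_symm:
  assumes "p \<ge> 2"
  shows "(\<Prod>i = 1..p - 1. qint p i * qint p (p - i))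
    = of_nat p ^ 2 / of_real (2 * sin (pi / real p)) ^ (2 * (p - 1))"
proof -
  define q where "q = qroot p"
  have nz: "q \<noteq> 0" by (simp add: q_def)
  have iv: "{1..p - 1} = {1..<p}" by auto
  have factor: "qint p i * qint p (p - i)
      = (1 - q\<^sup>2 ^ i) * (1 - q\<^sup>2 ^ (p - i)) / of_real (2 * sin (pi / real p)) ^ 2"
    if "i \<in> {1..<p}" for i
  proof -
    have "q ^ i * q ^ (p - i) = -1"
      using that qroot_pow_p[OF assms] by (simp add: q_def flip: power_add)
    then have x: "q ^ (p - i) = - inverse (q ^ i)"
      using nz by (simp add: field_simps)
    have d: "(q - inverse q)\<^sup>2 = - (of_real (2 * sin (pi / real p)) ^ 2)"
      unfolding q_def qroot_diff_sin by (simp add: power_mult_distrib)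
    have "(q ^ i - inverse (q ^ i)) * (q ^ (p - i) - inverse (q ^ (p - i)))
        = - ((1 - q ^ i * q ^ i) * (1 - q ^ (p - i) * q ^ (p - i)))"
      unfolding x using nz by (simp add: field_simps)
    moreover have "q\<^sup>2 ^ k = q ^ k * q ^ k" for k
      by (simp add: power2_eq_square power_mult_distrib)
    ultimately show ?thesis
      unfolding qint_eq_bra bra_def q_def[symmetric]
      by (simp add: times_divide_times_eq d flip: power2_eq_square)
  qed
  have "(\<Prod>i = 1..<p. 1 - q\<^sup>2 ^ (p - i)) = (\<Prod>i = 1..<p. 1 - q\<^sup>2 ^ i)"
    by (rule prod.reindex_bij_witness[of _ "\<lambda>i. p - i" "\<lambda>i. p - i"]) auto
  then have "(\<Prod>i = 1..<p. (1 - q\<^sup>2 ^ i) * (1 - q\<^sup>2 ^ (p - i))) = of_nat p ^ 2"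
    using prod_one_minus_roots_of_unity[OF assms]
    by (simp add: prod.distrib q_def power2_eq_square)
  moreover have "(\<Prod>i = 1..<p. qint p i * qint p (p - i))
      = (\<Prod>i = 1..<p. (1 - q\<^sup>2 ^ i) * (1 - q\<^sup>2 ^ (p - i)) / of_real (2 * sin (pi / real p)) ^ 2)"
    by (intro prod.cong refl factor)
  ultimately show ?thesis
    unfolding iv prod_dividef by (simp only: prod_constant power_mult card_atLeastLessThan)
qed

section \<open>Closed forms for gamma_s and delta_s\<close>

lemma prod_qint_diff:
  "(\<Prod>i = 1..n - 1. qint p i * qint p (n - i)) = (\<Prod>i = 1..n - 1. qint p i)\<^sup>2"
proof -
  have "(\<Prod>i = 1..n - 1. qint p (n - i)) = (\<Prod>i = 1..n - 1. qint p i)"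
    by (rule prod.reindex_bij_witness[of _ "\<lambda>i. n - i" "\<lambda>i. n - i"]) auto
  then show ?thesis by (simp add: prod.distrib power2_eq_square)
qed

lemma gam_nonzero:
  assumes "p \<ge> 2" "s \<le> p"
  shows "gam p s \<noteq> 0"
  using assms unfolding gam_def by (auto simp: qint_nonzero)

text \<open>With \<open>f n\<close> the quantum factorial [n]!, gamma_s is up to sign 2p ([p-s-1]!
  [s-1]!)^2, and [p-i] = [i] gives [p-1]! = [p-s-1]! [s-1]! [s]. So gamma_s [s]^2 follows from the
  product over 1..p-1.\<close>

lemma inverse_gam:
  assumes "p \<ge> 2" "1 \<le> s" "s < p"
  shows "1 / gam p s = (-1) ^ (p - s - 1) / (2 * of_nat p ^ 3) * (qint p s)\<^sup>2
    * of_real (2 * sin (pi / real p)) ^ (2 * (p - 1))"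
proof -
  define f where "f n = (\<Prod>i = 1..n. qint p i)" for n
  define S where "S = (of_real (2 * sin (pi / real p)) :: complex) ^ (2 * (p - 1))"
  have S0: "S \<noteq> 0"
    using qroot_diff_nonzero[OF assms(1)] unfolding S_def qroot_diff_sin by simp
  have "f (p - 1) = f (p - s - 1) * (\<Prod>i = p - s..p - 1. qint p i)"
  proof -
    have "{1..p - 1} = {1..p - s - 1} \<union> {p - s..p - 1}" using assms by auto
    then show ?thesis
      using assms unfolding f_def by (simp add: prod.union_disjoint disjoint_iff)
  qed
  also have "(\<Prod>i = p - s..p - 1. qint p i) = (\<Prod>i = 1..s. qint p i)"
    by (rule prod.reindex_bij_witness[of _ "\<lambda>i. p - i" "\<lambda>i. p - i"])
      (use assms qint_symm in auto)
  also have "\<dots> = f (s - 1) * qint p s"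
    using assms(2) by (cases s) (auto simp: f_def)
  finally have fp: "f (p - 1) = f (p - s - 1) * (f (s - 1) * qint p s)" .
  have sq: "(f (p - 1))\<^sup>2 = of_nat p ^ 2 / S"
    using prod_qint_symm[OF assms(1)] prod_qint_diff[of p p] by (simp add: f_def S_def)
  have "(\<Prod>m = 1..p - s - 1. - qint p m * qint p (p - s - m))
      = (-1) ^ (p - s - 1) * (f (p - s - 1))\<^sup>2"
    using prod_qint_diff[where n = "p - s" and p = p] by (simp add: prod_uminus f_def)
  then have g: "gam p s = 2 * of_nat p * (-1) ^ (p - s - 1) * (f (p - s - 1) * f (s - 1))\<^sup>2"
    unfolding gam_def prod_qint_diff by (simp add: f_def power_mult_distrib)
  have qs: "qint p s \<noteq> 0" using assms by (intro qint_nonzero) auto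
  have "(f (p - s - 1) * f (s - 1))\<^sup>2 * (qint p s)\<^sup>2 = of_nat p ^ 2 / S"
    unfolding sq[symmetric] fp by (simp add: power_mult_distrib)
  then have g2: "gam p s * (qint p s)\<^sup>2 = 2 * of_nat p * (-1) ^ (p - s - 1) * (of_nat p ^ 2 / S)"
    unfolding g by (metis mult.assoc)
  have sg: "(-1::complex) ^ (p - s - 1) * (-1) ^ (p - s - 1) = 1"
    by (simp flip: power_add)
  have "gam p s * ((-1) ^ (p - s - 1) / (2 * of_nat p ^ 3) * (qint p s)\<^sup>2 * S)
     = (gam p s * (qint p s)\<^sup>2) * (-1) ^ (p - s - 1) * S / (2 * of_nat p ^ 3)"
    by simp
  also have "\<dots> = ((-1) ^ (p - s - 1) * (-1) ^ (p - s - 1)) * (2 * of_nat p ^ 3) / (2 * of_nat p ^ 3)"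
    unfolding g2 using S0 by (simp add: power2_eq_square power3_eq_cube)
  also have "\<dots> = 1" using assms(1) sg by simp
  finally show ?thesis
    using gam_nonzero[OF assms(1) less_imp_le[OF assms(3)]] unfolding S_def[symmetric] by (simp add: field_simps)
qed

lemma sum_prod_remove:
  fixes f :: "'a \<Rightarrow> 'b::field"
  assumes "finite A" "\<And>k. k \<in> A \<Longrightarrow> f k \<noteq> 0"
  shows "(\<Sum>j\<in>A. \<Prod>k\<in>A - {j}. f k) = (\<Prod>k\<in>A. f k) * (\<Sum>j\<in>A. 1 / f j)"
  unfolding sum_distrib_left
  by (rule sum.cong[OF refl]) (use assms in \<open>simp add: prod_diff1\<close>)

text \<open>delta_s is gamma_s times a logarithmic derivative, as omitting one factor of a product
  is dividing by it. The second sum gets its minus sign from the factors -[k][p-s-k].\<close>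

lemma del_over_gam:
  assumes "p \<ge> 2" "1 \<le> s" "s < p"
  shows "del p s = gam p s * ((\<Sum>l = 1..s - 1. 1 / (qint p l * qint p (s - l)))
    - (\<Sum>l = 1..p - s - 1. 1 / (qint p l * qint p (p - s - l))))"
proof -
  have a: "(\<Sum>j = 1..s - 1. \<Prod>k \<in> {1..s - 1} - {j}. qint p k * qint p (s - k))
    = (\<Prod>i = 1..s - 1. qint p i * qint p (s - i)) * (\<Sum>j = 1..s - 1. 1 / (qint p j * qint p (s - j)))"
    by (rule sum_prod_remove) (use assms in \<open>auto simp: qint_nonzero\<close>)
  have b: "(\<Sum>n = 1..p - s - 1. \<Prod>k \<in> {1..p - s - 1} - {n}. - qint p k * qint p (p - s - k))
    = (\<Prod>i = 1..p - s - 1. - qint p i * qint p (p - s - i))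
      * (\<Sum>j = 1..p - s - 1. 1 / (- qint p j * qint p (p - s - j)))"
    by (rule sum_prod_remove) (use assms in \<open>auto simp: qint_nonzero\<close>)
  show ?thesis
    unfolding del_def gam_def a b by (simp add: algebra_simps sum_negf)
qed

section \<open>Words acting on coordinate functions\<close>

text \<open>For each weight \<open>q\<^sup>j\<close>, the module induced from the subalgebra of \<open>K\<close> has a basis
  \<open>E\<^sup>m F\<^sup>n v\<close>, \<open>m, n < p\<close>.  Letters act from the right on its coordinate functions
  \<open>\<phi> m n\<close>, so that no sums occur; \<open>\<phi>\<close> is required to vanish outside the range of the basis.\<close>

definition wt :: "nat \<Rightarrow> int \<Rightarrow> nat \<Rightarrow> nat \<Rightarrow> complex" where
  "wt p j m n = qroot p powi (j + 2 * (int m - int n))"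

text \<open>Coefficient in F E^m F^n v = E^m F^(n+1) v - \<open>coefF\<close> E^(m-1) F^n v. Its
  factor [m] makes the truncated index m - 1 harmless at m = 0.\<close>

definition coefF :: "nat \<Rightarrow> int \<Rightarrow> nat \<Rightarrow> nat \<Rightarrow> complex" where
  "coefF p j m n = qint p m * bra p (qroot p powi (j - 2 * int n + int m - 1))"

fun lact :: "nat \<Rightarrow> int \<Rightarrow> letter \<Rightarrow> (nat \<Rightarrow> nat \<Rightarrow> complex) \<Rightarrow> nat \<Rightarrow> nat \<Rightarrow> complex" where
  "lact p j LE \<phi> = (\<lambda>m n. \<phi> (Suc m) n)"
| "lact p j LF \<phi> = (\<lambda>m n. \<phi> m (Suc n) - coefF p j m n * \<phi> (m - 1) n)"
| "lact p j LK \<phi> = (\<lambda>m n. wt p j m n * \<phi> m n)"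
| "lact p j LKinv \<phi> = (\<lambda>m n. inverse (wt p j m n) * \<phi> m n)"

text \<open>\<open>fold\<close> lets the first letter act first, as a right action requires: \<phi>
  followed by u and then by v is the function w -> \<phi>(u v w).\<close>

fun wact :: "nat \<Rightarrow> int \<Rightarrow> word \<Rightarrow> (nat \<Rightarrow> nat \<Rightarrow> complex) \<Rightarrow> nat \<Rightarrow> nat \<Rightarrow> complex" where
  "wact p j (Word u) \<phi> = fold (lact p j) u \<phi>"

text \<open>At (0, 0) this is the value of \<phi> on f v, that is, a matrix coefficient of the
  induced module.\<close>

definition coact :: "nat \<Rightarrow> int \<Rightarrow> falg \<Rightarrow> (nat \<Rightarrow> nat \<Rightarrow> complex) \<Rightarrow> nat \<Rightarrow> nat \<Rightarrow> complex" where
  "coact p j f \<phi> = (\<lambda>m n. \<Sum>w. Poly_Mapping.lookup f w * wact p j w \<phi> m n)"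

definition boxed :: "nat \<Rightarrow> (nat \<Rightarrow> nat \<Rightarrow> complex) \<Rightarrow> bool" where
  "boxed p \<phi> \<longleftrightarrow> (\<forall>m n. m \<ge> p \<or> n \<ge> p \<longrightarrow> \<phi> m n = 0)"

lemma wt_nonzero [simp]: "wt p j m n \<noteq> 0"
  by (simp add: wt_def)

lemma wt_Suc_left: "wt p j (Suc m) n = (qroot p)\<^sup>2 * wt p j m n"
proof -
  have "j + 2 * (int (Suc m) - int n) = 2 + (j + 2 * (int m - int n))" by simp
  then show ?thesis unfolding wt_def by (simp only: power_int_add[OF disjI1[OF qroot_nonzero]]) simp
qed

lemma wt_Suc_right: "wt p j m (Suc n) = inverse ((qroot p)\<^sup>2) * wt p j m n"
proof -
  have "j + 2 * (int m - int (Suc n)) = - 2 + (j + 2 * (int m - int n))" by simp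
  then show ?thesis unfolding wt_def by (simp only: power_int_add[OF disjI1[OF qroot_nonzero]]) (simp add: power_int_minus)
qed

lemma wact_0 [simp]: "wact p j 0 \<phi> = \<phi>"
  by (simp add: zero_word_def)

lemma wact_add: "wact p j (u + v) \<phi> = wact p j v (wact p j u \<phi>)"
  by (cases u; cases v) simp

lemma lact_add: "lact p j l (\<lambda>m n. \<phi> m n + \<psi> m n) = (\<lambda>m n. lact p j l \<phi> m n + lact p j l \<psi> m n)"
  by (cases l) (auto simp: algebra_simps)

lemma lact_scale: "lact p j l (\<lambda>m n. c * \<phi> m n) = (\<lambda>m n. c * lact p j l \<phi> m n)"
  by (cases l) (auto simp: algebra_simps)

lemma wact_linear:
  "wact p j w (\<lambda>m n. \<phi> m n + \<psi> m n) = (\<lambda>m n. wact p j w \<phi> m n + wact p j w \<psi> m n)"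
  "wact p j w (\<lambda>m n. c * \<phi> m n) = (\<lambda>m n. c * wact p j w \<phi> m n)"
proof -
  have "fold (lact p j) u (\<lambda>m n. \<phi> m n + \<psi> m n)
      = (\<lambda>m n. fold (lact p j) u \<phi> m n + fold (lact p j) u \<psi> m n)" for u
    by (induction u arbitrary: \<phi> \<psi>) (simp_all add: lact_add)
  then show "wact p j w (\<lambda>m n. \<phi> m n + \<psi> m n) = (\<lambda>m n. wact p j w \<phi> m n + wact p j w \<psi> m n)"
    by (cases w) simp
  have "fold (lact p j) u (\<lambda>m n. c * \<phi> m n) = (\<lambda>m n. c * fold (lact p j) u \<phi> m n)" for u
    by (induction u arbitrary: \<phi>) (simp_all add: lact_scale)
  then show "wact p j w (\<lambda>m n. c * \<phi> m n) = (\<lambda>m n. c * wact p j w \<phi> m n)"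
    by (cases w) simp
qed

lemma coact_single: "coact p j (Poly_Mapping.single w c) \<phi> = (\<lambda>m n. c * wact p j w \<phi> m n)"
proof (intro ext)
  fix m n
  have "coact p j (Poly_Mapping.single w c) \<phi> m n
      = (\<Sum>v. (if v = w then c * wact p j w \<phi> m n else 0))"
    unfolding coact_def by (rule arg_cong[where f = Sum_any]) (auto simp: lookup_single when_def)
  then show "coact p j (Poly_Mapping.single w c) \<phi> m n = c * wact p j w \<phi> m n" by simp
qed

lemma coact_add: "coact p j (f + g) \<phi> = (\<lambda>m n. coact p j f \<phi> m n + coact p j g \<phi> m n)"
proof -
  have "finite {w. Poly_Mapping.lookup f w * wact p j w \<phi> m n \<noteq> 0}" for f :: falg and m n
    by (rule finite_subset[OF _ finite_lookup[of f]]) auto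
  then show ?thesis
    unfolding coact_def lookup_add distrib_right by (simp add: Sum_any.distrib)
qed

lemma coact_zero [simp]: "coact p j 0 \<phi> = (\<lambda>m n. 0)"
  by (simp add: coact_def)

lemma coact_diff: "coact p j (f - g) \<phi> = (\<lambda>m n. coact p j f \<phi> m n - coact p j g \<phi> m n)"
proof -
  have "coact p j (f - g + g) \<phi> m n = coact p j (f - g) \<phi> m n + coact p j g \<phi> m n" for m n
    by (simp only: coact_add)
  then show ?thesis by (simp add: fun_eq_iff)
qed

lemma coact_linear:
  "coact p j f (\<lambda>m n. \<phi> m n + \<psi> m n) = (\<lambda>m n. coact p j f \<phi> m n + coact p j f \<psi> m n)"
  "coact p j f (\<lambda>m n. c * \<phi> m n) = (\<lambda>m n. c * coact p j f \<phi> m n)"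
proof -
  show "coact p j f (\<lambda>m n. \<phi> m n + \<psi> m n) = (\<lambda>m n. coact p j f \<phi> m n + coact p j f \<psi> m n)"
  proof (induction f rule: falg_induct)
    case (single w c)
    then show ?case by (simp add: coact_single wact_linear distrib_left)
  qed (simp_all add: coact_add algebra_simps)
  show "coact p j f (\<lambda>m n. c * \<phi> m n) = (\<lambda>m n. c * coact p j f \<phi> m n)"
  proof (induction f rule: falg_induct)
    case (single w c)
    then show ?case by (simp add: coact_single wact_linear mult_ac)
  qed (simp_all add: coact_add algebra_simps)
qed

lemma coact_mult: "coact p j (f * g) \<phi> = coact p j g (coact p j f \<phi>)"
proof -
  have zero: "coact p j g (\<lambda>m n. 0) = (\<lambda>m n. 0)" for g
    using coact_linear(2)[of p j g 0 "\<lambda>m n. 0"] by simp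
  have single_mult: "coact p j (Poly_Mapping.single w c * g) \<phi> = coact p j g (coact p j (Poly_Mapping.single w c) \<phi>)"
    for w c
  proof (induction g rule: falg_induct)
    case (single v d)
    then show ?case by (simp add: mult_single coact_single wact_add wact_linear mult_ac)
  next
    case (add g1 g2)
    then show ?case by (simp add: distrib_left coact_add)
  qed simp
  show ?thesis
  proof (induction f rule: falg_induct)
    case (add f1 f2)
    then show ?case by (simp add: distrib_right coact_add coact_linear)
  qed (simp_all add: single_mult zero)
qed

lemma coact_fconst: "coact p j (fconst c) \<phi> = (\<lambda>m n. c * \<phi> m n)"
  by (simp add: fconst_def coact_single)

lemma coact_one [simp]: "coact p j 1 \<phi> = \<phi>"
  using coact_fconst[of p j 1 \<phi>] by (simp add: fconst_simps)

lemma coact_fgen: "coact p j (fgen l) \<phi> = lact p j l \<phi>"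
  by (simp add: fgen_def coact_single)

lemma coact_power: "coact p j (f ^ n) \<phi> = (coact p j f ^^ n) \<phi>"
  by (induction n) (simp_all add: coact_mult power_Suc2 del: power_Suc)

lemma coact_fgen_power: "coact p j (fgen l ^ n) \<phi> = (lact p j l ^^ n) \<phi>"
proof -
  have "coact p j (fgen l) = lact p j l" by (rule ext) (rule coact_fgen)
  then show ?thesis by (simp add: coact_power)
qed

section \<open>The defining relations hold on boxed functions\<close>

lemma lact_boxed:
  assumes "p \<ge> 2" "boxed p \<phi>"
  shows "boxed p (lact p j l \<phi>)"
proof (cases l)
  case LF
  \<comment> \<open>For m > p the value of \<phi> is zero; at m = p it need not be, and there [p] =
    0 helps.\<close>
  have "coefF p j m n * \<phi> (m - 1) n = 0" if "m \<ge> p" for m n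
    using assms that by (cases "m = p") (auto simp: boxed_def coefF_def qint_p)
  then show ?thesis using assms(2) by (auto simp: LF boxed_def)
qed (use assms(2) in \<open>auto simp: boxed_def\<close>)

lemma coact_boxed:
  assumes "p \<ge> 2" "boxed p \<phi>"
  shows "boxed p (coact p j f \<phi>)"
proof (induction f rule: falg_induct)
  case (single w c)
  have "boxed p (fold (lact p j) u \<phi>)" for u
    using assms(2) by (induction u arbitrary: \<phi>) (simp_all add: lact_boxed[OF assms(1)])
  then show ?case by (cases w) (simp add: coact_single boxed_def)
qed (simp_all add: boxed_def coact_add)

text \<open>The relation for E F - F E: in the right action the word E F applies
  \<open>lact LE\<close> first. It rests on the difference of \<open>coefF\<close> at m + 1 and m
  being the commutator scalar.\<close>

lemma lact_commutator:
  assumes "p \<ge> 2"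
  shows "lact p j LF (lact p j LE \<phi>) m n
    = lact p j LE (lact p j LF \<phi>) m n + bra p (wt p j m n) * \<phi> m n"
proof -
  define q where "q = qroot p"
  define a b where "a = q ^ m" and "b = q powi (j - 2 * int n)"
  have nz: "q \<noteq> 0" "a \<noteq> 0" "b \<noteq> 0" and d: "q - inverse q \<noteq> 0"
    using qroot_diff_nonzero[OF assms] by (auto simp: q_def a_def b_def)
  have eqs: "q ^ Suc m = a * q" "q powi (j - 2 * int n + int (Suc m) - 1) = a * b"
    "q powi (j - 2 * int n + int m - 1) = a * b / q" "wt p j m n = a * a * b"
    using nz unfolding wt_def a_def b_def q_def[symmetric]
    by (simp_all add: power_int_add power_int_diff right_diff_distrib field_simps power2_eq_square
        power_int_mult flip: power_mult power_mult_distrib)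
  have frac: "A / d * (B / d) - C / d * (D / d) = G / d"
    if "A * B - C * D = d * G" "d \<noteq> 0" for A B C D G d :: complex
  proof -
    have "A / d * (B / d) - C / d * (D / d) = (A * B - C * D) / (d * d)"
      by (simp add: diff_divide_distrib)
    then show ?thesis using that by simp
  qed
  have "(a * q - inverse (a * q)) * (a * b - inverse (a * b))
      - (a - inverse a) * (a * b / q - inverse (a * b / q))
      = (q - inverse q) * (a * a * b - inverse (a * a * b))"
    using nz by (simp add: field_simps)
  from frac[OF this d] have c: "coefF p j (Suc m) n - coefF p j m n = bra p (wt p j m n)"
    unfolding coefF_def qint_eq_bra bra_def q_def[symmetric] eqs a_def[symmetric] .
  \<comment> \<open>At m = 0 truncation makes the arguments of \<phi> differ, but then the
    coefficient is zero.\<close>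
  have "coefF p j m n * \<phi> (Suc (m - 1)) n = coefF p j m n * \<phi> m n"
    by (cases m) (simp_all add: coefF_def)
  then show ?thesis unfolding c[symmetric] lact.simps by (simp only: left_diff_distrib diff_Suc_1) simp
qed

text \<open>The same identity with F peeled off at the other end: substitute c^(-1) q^(2n+2) and
  invert.\<close>

lemma bra_commutator_F_left:
  assumes "p \<ge> 2" "c \<noteq> 0"
  shows "qint p (Suc (Suc n)) * bra p (c * inverse (qroot p) ^ Suc n)
    = bra p c + qint p (Suc n) * bra p (c * inverse (qroot p) ^ Suc (Suc n))"
proof -
  have inv: "bra p (inverse x) = - bra p x" for x
    by (simp add: bra_def minus_divide_left)
  have "qint p (Suc (Suc n)) * bra p (inverse (c * inverse (qroot p) ^ Suc n))
    = qint p (Suc n) * bra p (inverse (c * inverse (qroot p) ^ Suc (Suc n))) + bra p (inverse c)"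
    using bra_commutator_F[OF assms(1), of "inverse c * (qroot p)\<^sup>2 ^ Suc n" n] assms(2)
    by (simp add: power_inverse power2_eq_square power_mult_distrib field_simps)
  then show ?thesis unfolding inv by (simp add: algebra_simps)
qed

text \<open>Aimed at k + 1 = p, where [p] = 0 makes F^p commute with E. The weight enters as the
  function \<open>wt\<close> of the position, so the coefficient has to be pulled through
  \<open>lact LF\<close>.\<close>

lemma lact_F_power_E:
  assumes "p \<ge> 2"
  shows "(lact p j LF ^^ Suc k) (lact p j LE \<phi>) m n
    = lact p j LE ((lact p j LF ^^ Suc k) \<phi>) m n
      + qint p (Suc k) * bra p (wt p j m n * inverse (qroot p) ^ k) * (lact p j LF ^^ k) \<phi> m n"
proof (induction k arbitrary: m n)
  case 0
  then show ?case
    using lact_commutator[OF assms] by (simp add: qint_1[OF assms])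
next
  case (Suc k)
  define \<psi> where "\<psi> = (lact p j LF ^^ k) \<phi>"
  define g where "g m n = qint p (Suc k) * bra p (wt p j m n * inverse (qroot p) ^ k)" for m n
  have IH: "(lact p j LF ^^ Suc k) (lact p j LE \<phi>) = (\<lambda>m n. lact p j LE (lact p j LF \<psi>) m n + g m n * \<psi> m n)"
    using Suc unfolding fun_eq_iff \<psi>_def g_def funpow.simps o_apply by blast
  \<comment> \<open>Both terms of \<open>lact LF\<close> see the same weight, since
    \<open>wt\<close> at (m - 1, n) equals \<open>wt\<close> at (m, n + 1).\<close>
  have "lact p j LF (\<lambda>m n. g m n * \<psi> m n) m n = g m (Suc n) * lact p j LF \<psi> m n"
  proof (cases m)
    case (Suc m')
    have "wt p j m' n = wt p j m (Suc n)"
      unfolding Suc wt_Suc_left wt_Suc_right by simp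
    then show ?thesis by (simp add: Suc g_def algebra_simps)
  qed (simp add: coefF_def)
  moreover have "g m (Suc n) = qint p (Suc k) * bra p (wt p j m n * inverse (qroot p) ^ Suc (Suc k))"
    unfolding g_def wt_Suc_right by (simp add: power2_eq_square mult_ac)
  ultimately have "(lact p j LF ^^ Suc (Suc k)) (lact p j LE \<phi>) m n
     = lact p j LE (lact p j LF (lact p j LF \<psi>)) m n
       + (bra p (wt p j m n) + qint p (Suc k) * bra p (wt p j m n * inverse (qroot p) ^ Suc (Suc k)))
         * lact p j LF \<psi> m n"
    unfolding funpow.simps(2)[of "Suc k"] o_apply IH lact_add
    by (simp only: lact_commutator[OF assms]) (simp add: algebra_simps)
  then show ?case
    unfolding bra_commutator_F_left[OF assms wt_nonzero, symmetric] \<psi>_def funpow.simps o_apply .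
qed

lemma lact_E_power: "(lact p j LE ^^ k) \<phi> m n = \<phi> (m + k) n"
  by (induction k arbitrary: m) simp_all

lemma lact_F_power_0: "(lact p j LF ^^ k) \<phi> 0 n = \<phi> 0 (n + k)"
  by (induction k arbitrary: n) (simp_all add: coefF_def)

lemma lact_K_power: "(lact p j LK ^^ k) \<phi> m n = wt p j m n ^ k * \<phi> m n"
  by (induction k) simp_all

text \<open>Since F^p commutes with E, its value at (m, n) can be computed at (0, n), where F merely
  raises n and p steps leave the box.\<close>

lemma lact_F_nilpotent:
  assumes "p \<ge> 2" "boxed p \<phi>"
  shows "(lact p j LF ^^ p) \<phi> m n = 0"
proof -
  obtain p' where p': "p = Suc p'" using assms(1) by (cases p) auto
  have comm: "(lact p j LF ^^ p) (lact p j LE \<psi>) = lact p j LE ((lact p j LF ^^ p) \<psi>)" for \<psi>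
    using lact_F_power_E[OF assms(1), where j = j and k = p' and \<phi> = \<psi>] qint_p[OF assms(1)]
    unfolding p'[symmetric] by (simp add: fun_eq_iff)
  have comm': "(lact p j LF ^^ p) ((lact p j LE ^^ k) \<phi>) = (lact p j LE ^^ k) ((lact p j LF ^^ p) \<phi>)" for k
    by (induction k) (simp_all only: funpow.simps o_apply id_apply comm)
  have "(lact p j LF ^^ p) \<phi> m n = (lact p j LE ^^ m) ((lact p j LF ^^ p) \<phi>) 0 n"
    by (simp add: lact_E_power)
  also have "\<dots> = \<phi> m (n + p)"
    by (simp only: comm'[symmetric] lact_F_power_0) (simp add: lact_E_power)
  finally show ?thesis using assms(2) by (simp add: boxed_def)
qed

lemma wt_pow_2p:
  assumes "p \<ge> 2"
  shows "wt p j m n ^ (2 * p) = 1"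
proof -
  have "wt p j m n ^ (2 * p) = qroot p powi ((j + 2 * (int m - int n)) * int (2 * p))"
    unfolding wt_def power_int_mult power_int_of_nat ..
  then show ?thesis by (simp only: qroot_powi_eq_1_iff[OF assms]) simp
qed

text \<open>Boxedness is what kills E^p and F^p. The induction ranges over all boxed \<phi>, because
  a left factor a replaces \<phi> by its image under a, which is again boxed.\<close>

lemma coact_rel_ideal:
  assumes "p \<ge> 2" "f \<in> rel_ideal p" "boxed p \<phi>"
  shows "coact p j f \<phi> = (\<lambda>m n. 0)"
  using assms(2,3)
proof (induction arbitrary: \<phi>)
  case (relator f)
  note coact_simps = coact_mult coact_diff coact_fconst coact_fgen coact_fgen_power
  have E: "coact p j (fgen LE ^ p) \<phi> = (\<lambda>m n. 0)"
    using relator(2) by (simp add: coact_simps lact_E_power boxed_def fun_eq_iff)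
  have F: "coact p j (fgen LF ^ p) \<phi> = (\<lambda>m n. 0)"
    using lact_F_nilpotent[OF assms(1) relator(2)] by (simp add: coact_simps fun_eq_iff)
  have K: "coact p j (fgen LK ^ (2 * p) - 1) \<phi> = (\<lambda>m n. 0)"
    by (simp add: coact_simps lact_K_power wt_pow_2p[OF assms(1)] fun_eq_iff)
  have KF: "coact p j (fgen LK * fgen LF * fgen LKinv - fconst (inverse ((qroot p)\<^sup>2)) * fgen LF) \<phi> = (\<lambda>m n. 0)"
  proof (intro ext)
    fix m n
    have "inverse (wt p j m n) * (coefF p j m n * wt p j (m - 1) n) = coefF p j m n * inverse ((qroot p)\<^sup>2)"
      by (cases m) (simp_all add: coefF_def wt_Suc_left)
    moreover have "inverse w * (r * w * a - c * (w' * b)) - (r * a - c * (r * b)) = 0"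
      if "inverse w * (c * w') = c * r" "w \<noteq> 0" for w w' r a b c :: complex
    proof -
      have "inverse w * (r * w * a - c * (w' * b)) = r * a - (inverse w * (c * w')) * b"
        using that(2) by (simp add: right_diff_distrib)
      then show ?thesis by (simp add: that(1))
    qed
    ultimately show "coact p j (fgen LK * fgen LF * fgen LKinv - fconst (inverse ((qroot p)\<^sup>2)) * fgen LF) \<phi> m n = 0"
      by (simp only: coact_simps lact.simps wt_Suc_right wt_nonzero not_False_eq_True)
  qed
  have EF: "coact p j (fgen LE * fgen LF - fgen LF * fgen LE
       - fconst (1 / (qroot p - inverse (qroot p))) * (fgen LK - fgen LKinv)) \<phi> = (\<lambda>m n. 0)"
    unfolding coact_simps lact_commutator[OF assms(1)] lact.simps(3,4)
    by (simp add: fun_eq_iff bra_def algebra_simps diff_divide_distrib)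
  show ?case
    using relator(1) E F K KF EF
    by (auto simp: relators_def coact_simps wt_Suc_left fun_eq_iff)
next
  case (mult_left x a)
  then show ?case by (simp add: coact_mult coact_boxed[OF assms(1)])
next
  case (mult_right x a)
  then show ?case using coact_linear(2)[of p j a 0 "\<lambda>m n. 0"] by (simp add: coact_mult)
qed (simp_all add: coact_add)


section \<open>The symmetric linear form\<close>

text \<open>The coefficient of E^(p-1) F^(p-1) v in f v, averaged over the 2p weights q^j of v: K^l
  contributes q^(j l), whose mean over j is 1 if 2p divides l and 0 otherwise.\<close>

definition ftau :: "nat \<Rightarrow> falg \<Rightarrow> complex" where
  "ftau p f = (\<Sum>j<2 * p. coact p (int j) f (\<lambda>m n. of_bool (m = p - 1 \<and> n = p - 1)) 0 0) / (2 * of_nat p)"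

lemma ftau_diff: "ftau p (f - g) = ftau p f - ftau p g"
  by (simp add: ftau_def coact_diff sum_subtractf diff_divide_distrib)

lemma ftau_rel_ideal:
  assumes "p \<ge> 2" "f \<in> rel_ideal p"
  shows "ftau p f = 0"
proof -
  have "boxed p (\<lambda>m n. of_bool (m = p - 1 \<and> n = p - 1))"
    using assms(1) by (auto simp: boxed_def)
  then show ?thesis by (simp add: ftau_def coact_rel_ideal[OF assms])
qed

text \<open>For \<open>p = 1\<close> the denominators \<open>q - q\<^sup>-\<^sup>1\<close> vanish, whence the case distinction.\<close>

lift_definition tau :: "'p::finite uqsl2 \<Rightarrow> complex"
  is "\<lambda>f. if 2 \<le> CARD('p) then ftau CARD('p) f else 0"
  using ftau_rel_ideal ftau_diff by (metis eq_iff_diff_eq_0)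

section \<open>Linearity of tau and its values on monomials\<close>

lemma fconst_commute: "fconst c * f = f * fconst c"
proof (induction f rule: falg_induct)
  case (single w d)
  then show ?case by (simp add: fconst_def mult_single mult.commute)
qed (simp_all add: algebra_simps)

lemma scaleU_mult_left [simp]: "(c *\<^sub>U x) * y = c *\<^sub>U (x * y)" for x y :: "'p::finite uqsl2"
  by transfer (simp add: rel_ideal.zero mult.assoc)

lemma scaleU_mult_right [simp]: "x * (c *\<^sub>U y) = c *\<^sub>U (x * y)" for x y :: "'p::finite uqsl2"
proof transfer
  fix x y c
  have "x * (fconst c * y) = fconst c * (x * y)"
    using fconst_commute[of c x] by (metis mult.assoc)
  then show "x * (fconst c * y) - fconst c * (x * y) \<in> rel_ideal CARD('p)"
    by (simp add: rel_ideal.zero)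
qed

lemma tau_linear: "Vector_Spaces.linear scaleU (*) (tau :: 'p::finite uqsl2 \<Rightarrow> complex)"
proof (intro Vector_Spaces.linear_iff[THEN iffD2] conjI allI)
  show "vector_space (scaleU :: complex \<Rightarrow> 'p uqsl2 \<Rightarrow> 'p uqsl2)" by (rule U.vector_space_axioms)
  show "vector_space ((*) :: complex \<Rightarrow> complex \<Rightarrow> complex)"
    by unfold_locales (simp_all add: algebra_simps)
  show "tau (x + y) = tau x + tau y" for x y :: "'p uqsl2"
    by transfer (simp add: ftau_def coact_add sum.distrib add_divide_distrib)
  show "tau (c *\<^sub>U x) = c * tau x" for c and x :: "'p uqsl2"
    by transfer (simp add: ftau_def fconst_commute coact_mult coact_fconst sum_distrib_left)
qed

lemma abs_uqsl2_power: "abs_uqsl2 f ^ n = (abs_uqsl2 (f ^ n) :: 'p::finite uqsl2)"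
  by (induction n) (simp_all add: one_uqsl2.abs_eq times_uqsl2.abs_eq)

lemma tau_monomial:
  assumes "2 \<le> CARD('p::finite)"
  shows "tau (genE ^ m * genF ^ n * genK ^ l :: 'p uqsl2)
    = of_bool (m = CARD('p) - 1 \<and> n = CARD('p) - 1 \<and> 2 * CARD('p) dvd l)"
proof -
  define p where "p = CARD('p)"
  have p: "p \<ge> 2" using assms by (simp add: p_def)
  define \<phi> :: "nat \<Rightarrow> nat \<Rightarrow> complex" where "\<phi> = (\<lambda>m n. of_bool (m = p - 1 \<and> n = p - 1))"
  define z where "z = qroot p ^ l"
  have z: "z = 1 \<longleftrightarrow> 2 * p dvd l"
    using qroot_powi_eq_1_iff[OF p, of "int l"] unfolding z_def power_int_of_nat
    by (metis int_dvd_int_iff of_nat_mult of_nat_numeral)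
  have z2: "z ^ (2 * p) = 1"
    unfolding z_def by (metis mult.commute p power_mult power_one qroot_pow_2p)
  have "tau (genE ^ m * genF ^ n * genK ^ l :: 'p uqsl2)
      = ftau p (fgen LE ^ m * fgen LF ^ n * fgen LK ^ l)"
    using assms by (simp add: p_def genE.abs_eq genF.abs_eq genK.abs_eq abs_uqsl2_power
        times_uqsl2.abs_eq tau.abs_eq)
  also have "\<dots> = (\<Sum>j<2 * p. wt p (int j) 0 0 ^ l * \<phi> m n) / (2 * of_nat p)"
    unfolding ftau_def \<phi>_def[symmetric]
    by (simp add: coact_mult coact_fgen_power lact_K_power lact_F_power_0 lact_E_power)
  also have "(\<Sum>j<2 * p. wt p (int j) 0 0 ^ l * \<phi> m n) = \<phi> m n * (\<Sum>j<2 * p. z ^ j)"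
    unfolding sum_distrib_left
    by (rule sum.cong) (simp_all add: wt_def z_def mult.commute flip: power_mult)
  also have "(\<Sum>j<2 * p. z ^ j) = (if 2 * p dvd l then 2 * of_nat p else 0)"
    using z z2 by (auto simp: geometric_sum)
  finally show ?thesis using p by (auto simp: \<phi>_def p_def)
qed

section \<open>Commutation relations\<close>

definition has_weight :: "complex \<Rightarrow> 'p::finite uqsl2 \<Rightarrow> bool" where
  "has_weight c w \<longleftrightarrow> genK * w = c *\<^sub>U w"

lemma has_weight_scale: "has_weight c w \<Longrightarrow> has_weight c (a *\<^sub>U w)"
  by (simp add: has_weight_def mult.commute)

lemma has_weight_sum: "(\<And>i. i \<in> I \<Longrightarrow> has_weight c (f i)) \<Longrightarrow> has_weight c (\<Sum>i\<in>I. f i)"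
  by (simp add: has_weight_def sum_distrib_left U.scale_sum_right)

lemma has_weight_diff: "has_weight c x \<Longrightarrow> has_weight c y \<Longrightarrow> has_weight c (x - y)"
  by (simp add: has_weight_def right_diff_distrib U.scale_right_diff_distrib)

lemma genK_genE: "genK * genE = (qroot CARD('p))\<^sup>2 *\<^sub>U (genE * genK :: 'p::finite uqsl2)"
proof -
  have "genK * genE = (genK * genE * genKinv) * (genK :: 'p uqsl2)"
    by (simp add: mult.assoc uqsl2_relations)
  then show ?thesis by (simp add: uqsl2_relations)
qed

lemma genK_genF: "genK * genF = inverse ((qroot CARD('p))\<^sup>2) *\<^sub>U (genF * genK :: 'p::finite uqsl2)"
proof -
  have "genK * genF = (genK * genF * genKinv) * (genK :: 'p uqsl2)"
    by (simp add: mult.assoc uqsl2_relations)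
  then show ?thesis by (simp add: uqsl2_relations)
qed

lemma genKinv_genE: "genKinv * genE = inverse ((qroot CARD('p))\<^sup>2) *\<^sub>U (genE * genKinv :: 'p::finite uqsl2)"
proof -
  have "(qroot CARD('p))\<^sup>2 *\<^sub>U (genKinv * genE) = genKinv * (genK * genE * genKinv :: 'p uqsl2)"
    by (simp add: uqsl2_relations)
  also have "\<dots> = (genKinv * genK) * (genE * genKinv)" by (simp only: mult.assoc)
  also have "\<dots> = genE * genKinv" by (simp add: uqsl2_relations)
  finally show ?thesis by (metis U.scale_left_imp_eq U.scale_one U.scale_scale left_inverse power_not_zero qroot_nonzero)
qed

lemma genKinv_genF: "genKinv * genF = (qroot CARD('p))\<^sup>2 *\<^sub>U (genF * genKinv :: 'p::finite uqsl2)"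
proof -
  have "inverse ((qroot CARD('p))\<^sup>2) *\<^sub>U (genKinv * genF) = genKinv * (genK * genF * genKinv :: 'p uqsl2)"
    by (simp add: uqsl2_relations)
  also have "\<dots> = (genKinv * genK) * (genF * genKinv)" by (simp only: mult.assoc)
  also have "\<dots> = genF * genKinv" by (simp add: uqsl2_relations)
  finally show ?thesis by (metis U.scale_one U.scale_scale right_inverse power_not_zero qroot_nonzero)
qed

lemma has_weight_E: "has_weight c w \<Longrightarrow> has_weight (c * (qroot CARD('p))\<^sup>2) (genE * w)" for w :: "'p::finite uqsl2"
proof -
  assume w: "has_weight c w"
  have "genK * (genE * w) = (genK * genE) * w" by (simp only: mult.assoc)
  also have "\<dots> = (qroot CARD('p))\<^sup>2 *\<^sub>U (genE * (genK * w))"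
    by (simp only: genK_genE scaleU_mult_left mult.assoc)
  finally show ?thesis using w by (simp add: has_weight_def mult.commute)
qed

lemma has_weight_F: "has_weight c w \<Longrightarrow> has_weight (c * inverse ((qroot CARD('p))\<^sup>2)) (genF * w)" for w :: "'p::finite uqsl2"
proof -
  assume w: "has_weight c w"
  have "genK * (genF * w) = (genK * genF) * w" by (simp only: mult.assoc)
  also have "\<dots> = inverse ((qroot CARD('p))\<^sup>2) *\<^sub>U (genF * (genK * w))"
    by (simp only: genK_genF scaleU_mult_left mult.assoc)
  finally show ?thesis using w by (simp add: has_weight_def mult.commute)
qed

lemma has_weight_E_power: "has_weight c w \<Longrightarrow> has_weight (c * ((qroot CARD('p))\<^sup>2) ^ n) (genE ^ n * w)"
  for w :: "'p::finite uqsl2"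
proof (induction n)
  case (Suc n)
  from has_weight_E[OF Suc.IH[OF Suc.prems]] show ?case
    by (simp only: power_Suc2[of "(qroot CARD('p))\<^sup>2"] power_Suc[of genE] mult.assoc)
qed simp

lemma has_weight_F_power: "has_weight c w \<Longrightarrow> has_weight (c * inverse ((qroot CARD('p))\<^sup>2) ^ n) (genF ^ n * w)"
  for w :: "'p::finite uqsl2"
proof (induction n)
  case (Suc n)
  from has_weight_F[OF Suc.IH[OF Suc.prems]] show ?case
    by (simp only: power_Suc2[of "inverse ((qroot CARD('p))\<^sup>2)"] power_Suc[of genF] mult.assoc)
qed simp

lemma genKinv_weight:
  fixes w :: "'p::finite uqsl2"
  assumes "has_weight c w" "c \<noteq> 0"
  shows "genKinv * w = inverse c *\<^sub>U w"
proof -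
  have "w = genKinv * (genK * w)" by (simp add: uqsl2_relations flip: mult.assoc)
  also have "\<dots> = c *\<^sub>U (genKinv * w)" using assms(1) by (simp add: has_weight_def)
  finally have "inverse c *\<^sub>U w = inverse c *\<^sub>U c *\<^sub>U (genKinv * w)" by simp
  then show ?thesis using assms(2) by simp
qed

lemma genE_genF_weight:
  fixes w :: "'p::finite uqsl2"
  assumes "has_weight c w" "c \<noteq> 0"
  shows "genE * (genF * w) = genF * (genE * w) + bra CARD('p) c *\<^sub>U w"
proof -
  have "genE * (genF * w) - genF * (genE * w) = (genE * genF - genF * genE) * w"
    by (simp add: left_diff_distrib mult.assoc)
  also have "\<dots> = bra CARD('p) c *\<^sub>U w"
    using assms(1) genKinv_weight[OF assms]
    by (simp add: uqsl2_relations has_weight_def left_diff_distrib bra_def flip: U.scale_left_diff_distrib)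
  finally show ?thesis by (simp add: algebra_simps)
qed

lemma genE_genF_power:
  fixes w :: "'p::finite uqsl2"
  assumes "2 \<le> CARD('p)" "has_weight c w" "c \<noteq> 0"
  shows "genE * (genF ^ Suc n * w) = genF ^ Suc n * (genE * w)
    + (qint CARD('p) (Suc n) * bra CARD('p) (c * inverse (qroot CARD('p)) ^ n)) *\<^sub>U (genF ^ n * w)"
proof (induction n)
  case 0
  then show ?case using genE_genF_weight[OF assms(2,3)] by (simp add: qint_1[OF assms(1)])
next
  case (Suc n)
  let ?p = "CARD('p)"
  have "genE * (genF ^ Suc (Suc n) * w) = genE * (genF * (genF ^ Suc n * w))"
    by (simp add: mult.assoc)
  also have "\<dots> = genF * (genE * (genF ^ Suc n * w))
      + bra ?p (c * inverse ((qroot ?p)\<^sup>2) ^ Suc n) *\<^sub>U (genF ^ Suc n * w)"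
    by (rule genE_genF_weight[OF has_weight_F_power[OF assms(2)]]) (use assms(3) in simp)
  also have "\<dots> = genF ^ Suc (Suc n) * (genE * w)
      + (qint ?p (Suc n) * bra ?p (c * inverse (qroot ?p) ^ n)
         + bra ?p (c * inverse ((qroot ?p)\<^sup>2) ^ Suc n)) *\<^sub>U (genF ^ Suc n * w)"
    unfolding Suc by (simp add: distrib_left mult.assoc U.scale_left_distrib)
  finally show ?case unfolding bra_commutator_F[OF assms(1,3), symmetric] .
qed

lemma genF_genE_power:
  fixes w :: "'p::finite uqsl2"
  assumes "2 \<le> CARD('p)" "has_weight c w" "c \<noteq> 0"
  shows "genF * (genE ^ Suc n * w) = genE ^ Suc n * (genF * w)
    - (qint CARD('p) (Suc n) * bra CARD('p) (c * qroot CARD('p) ^ n)) *\<^sub>U (genE ^ n * w)"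
proof (induction n)
  case 0
  then show ?case using genE_genF_weight[OF assms(2,3)] by (simp add: qint_1[OF assms(1)])
next
  case (Suc n)
  let ?p = "CARD('p)"
  have "genF * (genE ^ Suc (Suc n) * w) = genF * (genE * (genE ^ Suc n * w))"
    by (simp add: mult.assoc)
  also have "\<dots> = genE * (genF * (genE ^ Suc n * w))
      - bra ?p (c * (qroot ?p)\<^sup>2 ^ Suc n) *\<^sub>U (genE ^ Suc n * w)"
    using genE_genF_weight[OF has_weight_E_power[OF assms(2), of "Suc n"]] assms(3) by simp
  also have "\<dots> = genE ^ Suc (Suc n) * (genF * w)
      - (qint ?p (Suc n) * bra ?p (c * qroot ?p ^ n)
         + bra ?p (c * (qroot ?p)\<^sup>2 ^ Suc n)) *\<^sub>U (genE ^ Suc n * w)"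
    unfolding Suc by (simp add: right_diff_distrib mult.assoc U.scale_left_distrib)
  finally show ?case unfolding bra_commutator_E[OF assms(1,3), symmetric] .
qed

text \<open>With F E in place of E F, the part of C in K becomes q K + q^(-1) K^(-1). A vector
  annihilated by E is then visibly an eigenvector.\<close>

lemma casimir_weight:
  fixes w :: "'p::finite uqsl2"
  assumes "2 \<le> CARD('p)" "has_weight c w" "c \<noteq> 0"
  shows "casimir * w = genF * (genE * w)
    + ((qroot CARD('p) * c + inverse (qroot CARD('p) * c)) / (qroot CARD('p) - inverse (qroot CARD('p)))\<^sup>2) *\<^sub>U w"
proof -
  define q d where "q = qroot CARD('p)" and "d = q - inverse q"
  have d: "d \<noteq> 0" and q: "q \<noteq> 0" using qroot_diff_nonzero[OF assms(1)] by (simp_all add: d_def q_def)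
  have "casimir * w = genE * (genF * w) + ((inverse q * c + q * inverse c) / d\<^sup>2) *\<^sub>U w"
    using assms(2) genKinv_weight[OF assms(2,3)]
    by (simp add: casimir_def Let_def q_def[symmetric] d_def[symmetric] distrib_right mult.assoc
        has_weight_def flip: U.scale_left_distrib add_divide_distrib)
  also have "\<dots> = genF * (genE * w) + (bra CARD('p) c + (inverse q * c + q * inverse c) / d\<^sup>2) *\<^sub>U w"
    unfolding genE_genF_weight[OF assms(2,3)] by (simp add: U.scale_left_distrib)
  also have "bra CARD('p) c + (inverse q * c + q * inverse c) / d\<^sup>2
      = (d * (c - inverse c) + (inverse q * c + q * inverse c)) / d\<^sup>2"
    using d by (simp add: bra_def q_def[symmetric] d_def[symmetric] add_divide_distrib power2_eq_square)
  also have "d * (c - inverse c) + (inverse q * c + q * inverse c) = q * c + inverse (q * c)"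
    using q assms(3) by (simp add: d_def field_simps)
  finally show ?thesis by (simp add: q_def d_def)
qed

text \<open>Pulling E out to the left turns C into its other form, with F E and with q and q^(-1)
  exchanged; the two forms agree by the relation for E F - F E.\<close>

lemma casimir_genE:
  assumes "2 \<le> CARD('p::finite)"
  shows "casimir * genE = genE * (casimir :: 'p uqsl2)"
proof -
  define q d where "q = qroot CARD('p)" and "d = q - inverse q"
  have d: "d \<noteq> 0" and q: "q \<noteq> 0" using qroot_diff_nonzero[OF assms] by (simp_all add: d_def q_def)
  have qq: "inverse q * q\<^sup>2 = q" "q * inverse (q\<^sup>2) = inverse q"
    using q by (simp_all add: power2_eq_square)
  have "genF * genE = genE * genF - (1 / d) *\<^sub>U (genK - genKinv :: 'p uqsl2)"
    using uqsl2_relations(5)[where 'p = 'p] by (simp add: d_def q_def algebra_simps)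
  then have "casimir * genE = genE * (genE * genF - (1 / d) *\<^sub>U (genK - genKinv)
     + (1 / d\<^sup>2) *\<^sub>U (q *\<^sub>U genK + inverse q *\<^sub>U genKinv :: 'p uqsl2))"
    by (simp add: casimir_def Let_def distrib_right distrib_left mult.assoc genK_genE genKinv_genE qq
        flip: q_def d_def)
  also have "genE * genF - (1 / d) *\<^sub>U (genK - genKinv)
     + (1 / d\<^sup>2) *\<^sub>U (q *\<^sub>U genK + inverse q *\<^sub>U genKinv) = (casimir :: 'p uqsl2)"
  proof -
    have "1 / d\<^sup>2 * q - 1 / d = 1 / d\<^sup>2 * inverse q" "1 / d\<^sup>2 * inverse q + 1 / d = 1 / d\<^sup>2 * q"
      using d q by (simp_all add: power2_eq_square divide_simps) (simp_all add: d_def field_simps)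
    then have "(1 / d\<^sup>2 * inverse q) *\<^sub>U (genK :: 'p uqsl2) = (1 / d\<^sup>2 * q) *\<^sub>U genK - (1 / d) *\<^sub>U genK"
      "(1 / d\<^sup>2 * q) *\<^sub>U (genKinv :: 'p uqsl2) = (1 / d\<^sup>2 * inverse q) *\<^sub>U genKinv + (1 / d) *\<^sub>U genKinv"
      by (metis U.scale_left_diff_distrib, metis U.scale_left_distrib)
    then show ?thesis
      by (simp add: casimir_def Let_def U.scale_right_distrib U.scale_right_diff_distrib flip: q_def d_def)
  qed
  finally show ?thesis .
qed

lemma casimir_genF:
  assumes "2 \<le> CARD('p::finite)"
  shows "casimir * genF = genF * (casimir :: 'p uqsl2)"
proof -
  define q d where "q = qroot CARD('p)" and "d = q - inverse q"
  have d: "d \<noteq> 0" and q: "q \<noteq> 0" using qroot_diff_nonzero[OF assms] by (simp_all add: d_def q_def)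
  have qq: "inverse q * q\<^sup>2 = q" "q * inverse (q\<^sup>2) = inverse q"
    using q by (simp_all add: power2_eq_square)
  have EF: "genE * genF = genF * genE + (1 / d) *\<^sub>U (genK - genKinv :: 'p uqsl2)"
    using uqsl2_relations(5)[where 'p = 'p] by (simp add: d_def q_def algebra_simps)
  have coeff: "q / d\<^sup>2 = inverse q / d\<^sup>2 + 1 / d"
    using d q by (simp add: power2_eq_square divide_simps) (simp add: d_def field_simps)
  have "(q / d\<^sup>2) *\<^sub>U x = (inverse q / d\<^sup>2) *\<^sub>U x + (1 / d) *\<^sub>U x" for x :: "'p uqsl2"
    unfolding coeff U.scale_left_distrib ..
  then have "casimir = genF * genE + (1 / d\<^sup>2) *\<^sub>U (q *\<^sub>U genK + inverse q *\<^sub>U (genKinv :: 'p uqsl2))"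
    unfolding casimir_def Let_def q_def[symmetric] d_def[symmetric] EF
    by (simp add: U.scale_right_distrib U.scale_right_diff_distrib)
  then have "casimir * genF = (genF * genE
      + (1 / d\<^sup>2) *\<^sub>U (q *\<^sub>U genK + inverse q *\<^sub>U (genKinv :: 'p uqsl2))) * genF"
    by (rule arg_cong)
  also have "\<dots> = genF * (genE * genF
     + (1 / d\<^sup>2) *\<^sub>U (inverse q *\<^sub>U genK + q *\<^sub>U (genKinv :: 'p uqsl2)))"
    by (simp add: distrib_right distrib_left mult.assoc genK_genF genKinv_genF qq flip: q_def)
  finally show ?thesis by (simp add: casimir_def Let_def q_def d_def)
qed

lemma casimir_genE_power:
  fixes x :: "'p::finite uqsl2"
  assumes "2 \<le> CARD('p)"
  shows "casimir * (genE ^ n * x) = genE ^ n * (casimir * x)"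
proof (induction n)
  case (Suc n)
  have "casimir * (genE ^ Suc n * x) = (casimir * genE) * (genE ^ n * x)" by (simp add: mult.assoc)
  also have "\<dots> = genE * (casimir * (genE ^ n * x))" by (simp only: casimir_genE[OF assms] mult.assoc)
  finally show ?case by (simp add: Suc mult.assoc)
qed simp

lemma casimir_genF_power:
  fixes x :: "'p::finite uqsl2"
  assumes "2 \<le> CARD('p)"
  shows "casimir * (genF ^ n * x) = genF ^ n * (casimir * x)"
proof (induction n)
  case (Suc n)
  have "casimir * (genF ^ Suc n * x) = (casimir * genF) * (genF ^ n * x)" by (simp add: mult.assoc)
  also have "\<dots> = genF * (casimir * (genF ^ n * x))" by (simp only: casimir_genF[OF assms] mult.assoc)
  finally show ?case by (simp add: Suc mult.assoc)
qed simp


section \<open>The filtration by the degree in \<open>E\<close>\<close>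

text \<open>F passes E^m only up to terms of lower degree in E. The exponents of F and K stay
  unrestricted here; they are reduced in \<open>span_pbw_basis\<close>.\<close>

definition filt :: "nat \<Rightarrow> 'p::finite uqsl2 set" where
  "filt d = U.span {pbw m n l | m n l. m < d}"

lemma pbw_in_filt: "m < d \<Longrightarrow> pbw m n l \<in> filt d"
  unfolding filt_def by (rule U.span_base) blast

lemmas filt_closed =
  U.span_zero[of "{pbw m n l | m n l. m < d}" for d, folded filt_def]
  U.span_add[of _ "{pbw m n l | m n l. m < d}" for d, folded filt_def]
  U.span_diff[of _ "{pbw m n l | m n l. m < d}" for d, folded filt_def]
  U.span_scale[of _ "{pbw m n l | m n l. m < d}" for d, folded filt_def]

lemma filt_mono: "d \<le> e \<Longrightarrow> filt d \<subseteq> filt e"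
  unfolding filt_def by (rule U.span_mono) (auto intro: order_less_le_trans)

lemma genKinv_eq: "genKinv = (genK ^ (2 * CARD('p) - 1) :: 'p::finite uqsl2)"
proof -
  have "Suc (2 * CARD('p) - 1) = 2 * CARD('p)" by simp
  then have "genK * genK ^ (2 * CARD('p) - 1) = (1 :: 'p uqsl2)"
    by (metis power_Suc uqsl2_relations(8))
  then have "genKinv = genKinv * (genK * (genK ^ (2 * CARD('p) - 1) :: 'p uqsl2))" by simp
  also have "\<dots> = (genKinv * genK) * genK ^ (2 * CARD('p) - 1)" by (simp only: mult.assoc)
  finally show ?thesis by (simp add: uqsl2_relations)
qed

lemma genK_genE_power: "genK * genE ^ m = (qroot CARD('p))\<^sup>2 ^ m *\<^sub>U (genE ^ m * genK :: 'p::finite uqsl2)"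
proof (induction m)
  case (Suc m)
  have "genK * genE ^ Suc m = (genK * genE) * (genE ^ m :: 'p uqsl2)" by (simp add: mult.assoc)
  also have "\<dots> = (qroot CARD('p))\<^sup>2 *\<^sub>U (genE * (genK * genE ^ m))"
    by (simp add: genK_genE mult.assoc)
  finally show ?case by (simp add: Suc mult.assoc)
qed simp

lemma genK_genF_power: "genK * genF ^ m = inverse ((qroot CARD('p))\<^sup>2) ^ m *\<^sub>U (genF ^ m * genK :: 'p::finite uqsl2)"
proof (induction m)
  case (Suc m)
  have "genK * genF ^ Suc m = (genK * genF) * (genF ^ m :: 'p uqsl2)" by (simp add: mult.assoc)
  also have "\<dots> = inverse ((qroot CARD('p))\<^sup>2) *\<^sub>U (genF * (genK * genF ^ m))"
    by (simp add: genK_genF mult.assoc)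
  finally show ?case by (simp add: Suc mult.assoc)
qed simp

lemma genK_pbw:
  "genK * pbw m n l = ((qroot CARD('p))\<^sup>2 ^ m * inverse ((qroot CARD('p))\<^sup>2) ^ n) *\<^sub>U (pbw m n (Suc l) :: 'p::finite uqsl2)"
proof -
  have "genK * pbw m n l = (genK * genE ^ m) * genF ^ n * (genK ^ l :: 'p uqsl2)"
    by (simp add: pbw_def mult.assoc)
  also have "\<dots> = (qroot CARD('p))\<^sup>2 ^ m *\<^sub>U (genE ^ m * (genK * genF ^ n) * genK ^ l)"
    by (simp add: genK_genE_power mult.assoc)
  finally show ?thesis by (simp add: genK_genF_power pbw_def mult.assoc)
qed

lemma genK_power_pbw:
  "genK ^ k * pbw m n l
    = ((qroot CARD('p))\<^sup>2 ^ m * inverse ((qroot CARD('p))\<^sup>2) ^ n) ^ k *\<^sub>U (pbw m n (l + k) :: 'p::finite uqsl2)"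
proof (induction k)
  case (Suc k)
  have "genK ^ Suc k * pbw m n l = genK * (genK ^ k * (pbw m n l :: 'p uqsl2))" by (simp add: mult.assoc)
  then show ?case by (simp add: Suc genK_pbw mult.commute)
qed simp

lemma filt_induct [consumes 1, case_names base]:
  fixes y :: "'p::finite uqsl2"
  assumes x: "x \<in> filt d" and base: "\<And>m n l. m < d \<Longrightarrow> y * pbw m n l \<in> filt e"
  shows "y * x \<in> filt e"
  using x unfolding filt_def[of d]
proof (induction rule: U.span_induct_alt)
  case base
  then show ?case by (simp add: filt_closed)
next
  case (step c x y)
  then show ?case by (auto simp: distrib_left intro!: filt_closed assms(2))
qed

lemma genK_power_filt: "x \<in> filt d \<Longrightarrow> genK ^ k * x \<in> filt d"
  by (induction rule: filt_induct) (auto simp: genK_power_pbw intro!: filt_closed pbw_in_filt)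

text \<open>An identity in the algebra, free of weight vectors. The scalars may stay implicit
  because both correction terms have E-degree m and are absorbed by the filtration.\<close>

lemma genF_genE_power_expand:
  "\<exists>a b. genF * genE ^ Suc m = genE ^ Suc m * genF + a *\<^sub>U (genK * genE ^ m) + b *\<^sub>U (genKinv * genE ^ m :: 'p::finite uqsl2)"
proof -
  define k where "k = 1 / (qroot CARD('p) - inverse (qroot CARD('p)))"
  define Q where "Q = (qroot CARD('p))\<^sup>2"
  have Q: "Q \<noteq> 0" by (simp add: Q_def)
  have EK: "genE * genK = inverse Q *\<^sub>U (genK * genE :: 'p uqsl2)"
    "genE * genKinv = Q *\<^sub>U (genKinv * genE :: 'p uqsl2)"
    using Q by (simp_all add: genK_genE genKinv_genE flip: Q_def)
  have FE: "genF * genE = genE * genF - k *\<^sub>U (genK - genKinv :: 'p uqsl2)"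
    using uqsl2_relations(5)[where 'p = 'p] by (simp add: k_def algebra_simps)
  show ?thesis
  proof (induction m)
    case 0
    have "genF * genE ^ Suc 0 = genE ^ Suc 0 * genF + (- k) *\<^sub>U (genK * genE ^ 0) + k *\<^sub>U (genKinv * genE ^ 0 :: 'p uqsl2)"
      by (simp add: FE U.scale_right_diff_distrib)
    then show ?case by blast
  next
    case (Suc m)
    then obtain a b where ab: "genF * genE ^ Suc m
        = genE ^ Suc m * genF + a *\<^sub>U (genK * genE ^ m) + b *\<^sub>U (genKinv * genE ^ m :: 'p uqsl2)" by blast
    have "genF * genE ^ Suc (Suc m) = (genF * genE) * genE ^ Suc m" by (simp add: mult.assoc)
    also have "\<dots> = genE * (genF * genE ^ Suc m) - k *\<^sub>U (genK * genE ^ Suc m) + k *\<^sub>U (genKinv * genE ^ Suc m :: 'p uqsl2)"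
      by (simp add: FE left_diff_distrib U.scale_right_diff_distrib mult.assoc)
    also have "\<dots> = genE ^ Suc (Suc m) * genF + (a * inverse Q - k) *\<^sub>U (genK * genE ^ Suc m)
       + (b * Q + k) *\<^sub>U (genKinv * genE ^ Suc m)"
      unfolding ab distrib_left scaleU_mult_right mult.assoc[symmetric] EK
      by (simp add: mult.assoc U.scale_left_distrib U.scale_left_diff_distrib)
    finally show ?case by blast
  qed
qed

lemma genF_pbw: "genF * pbw m n l - pbw m (Suc n) l \<in> (filt m :: 'p::finite uqsl2 set)"
proof (cases m)
  case (Suc m')
  obtain a b where ab: "genF * genE ^ Suc m'
      = genE ^ Suc m' * genF + a *\<^sub>U (genK * genE ^ m') + b *\<^sub>U (genKinv * genE ^ m' :: 'p uqsl2)"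
    using genF_genE_power_expand by blast
  have "genF * pbw m n l = (genF * genE ^ Suc m') * genF ^ n * (genK ^ l :: 'p uqsl2)"
    by (simp add: pbw_def Suc mult.assoc)
  also have "\<dots> = pbw m (Suc n) l + a *\<^sub>U (genK ^ 1 * pbw m' n l)
      + b *\<^sub>U (genK ^ (2 * CARD('p) - 1) * pbw m' n l)"
    unfolding ab genKinv_eq by (simp add: pbw_def Suc distrib_right mult.assoc)
  finally show ?thesis
    by (simp add: filt_closed genK_power_filt[of _ _ 1, simplified] genK_power_filt pbw_in_filt Suc)
qed (simp add: pbw_def filt_closed mult.assoc)

lemma genF_filt: "x \<in> filt d \<Longrightarrow> genF * x \<in> (filt d :: 'p::finite uqsl2 set)"
proof (induction rule: filt_induct)
  case (base m n l)
  have "(genF * pbw m n l - pbw m (Suc n) l) + pbw m (Suc n) l \<in> (filt d :: 'p uqsl2 set)"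
    by (rule filt_closed(2)[OF subsetD[OF filt_mono genF_pbw] pbw_in_filt]) (use base in auto)
  then show ?case by simp
qed

lemma genF_power_pbw: "genF ^ k * pbw m n l - pbw m (n + k) l \<in> (filt m :: 'p::finite uqsl2 set)"
proof (induction k)
  case (Suc k)
  have "genF * (genF ^ k * pbw m n l - pbw m (n + k) l) + (genF * pbw m (n + k) l - pbw m (Suc (n + k)) l)
      \<in> (filt m :: 'p uqsl2 set)"
    using genF_filt[OF Suc] genF_pbw by (rule filt_closed)
  then show ?case by (simp add: right_diff_distrib mult.assoc)
qed (simp add: filt_closed)

lemma pbw_E_overflow: "m \<ge> CARD('p) \<Longrightarrow> pbw m n l = (0 :: 'p::finite uqsl2)"
  using uqsl2_relations(6)[where 'p = 'p] by (simp add: pbw_def le_iff_add power_add) (metis mult_zero_left power_add)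

lemma pbw_F_overflow: "n \<ge> CARD('p) \<Longrightarrow> pbw m n l = (0 :: 'p::finite uqsl2)"
proof -
  assume "n \<ge> CARD('p)"
  then obtain k where "n = CARD('p) + k" using le_iff_add by blast
  then show ?thesis by (simp add: pbw_def power_add uqsl2_relations)
qed

lemma pbw_mod: "pbw m n l = (pbw m n (l mod (2 * CARD('p))) :: 'p::finite uqsl2)"
proof -
  have "genK ^ l = (genK ^ (2 * CARD('p))) ^ (l div (2 * CARD('p))) * (genK ^ (l mod (2 * CARD('p))) :: 'p uqsl2)"
    by (metis mult_div_mod_eq power_add power_mult)
  then show ?thesis by (simp add: pbw_def uqsl2_relations)
qed

lemma genE_filt: "x \<in> filt CARD('p) \<Longrightarrow> genE * x \<in> (filt CARD('p) :: 'p::finite uqsl2 set)"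
proof (induction rule: filt_induct)
  case (base m n l)
  have "genE * pbw m n l = (pbw (Suc m) n l :: 'p uqsl2)" by (simp add: pbw_def mult.assoc)
  then show ?case
    using base pbw_E_overflow[where 'p = 'p and m = "Suc m" and n = n and l = l] by (cases "Suc m < CARD('p)") (auto simp: pbw_in_filt filt_closed)
qed

text \<open>A subspace that contains 1 and is stable under left multiplication by all letters is
  everything. E preserves it because E^p = 0, and K^(-1) because it is a power of K.\<close>

lemma filt_full: "(x :: 'p::finite uqsl2) \<in> filt CARD('p)"
proof -
  have letter: "abs_uqsl2 (fgen l) * y \<in> filt CARD('p)" if "y \<in> filt CARD('p)" for l and y :: "'p uqsl2"
    using that genE_filt[of y] genF_filt[of y] genK_power_filt[of y _ 1] genK_power_filt[of y _ "2 * CARD('p) - 1"]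
    by (cases l) (simp_all add: genKinv_eq flip: genE.abs_eq genF.abs_eq genK.abs_eq genKinv.abs_eq)
  have "abs_uqsl2 f * y \<in> filt CARD('p)" if "y \<in> filt CARD('p)" for f and y :: "'p uqsl2"
    using that
  proof (induction f rule: falg_induct)
    case zero
    then show ?case by (simp add: filt_closed flip: zero_uqsl2.abs_eq)
  next
    case (single w c)
    have "abs_uqsl2 (Poly_Mapping.single (Word u) 1) * y \<in> filt CARD('p)" for u
    proof (induction u)
      case Nil
      then show ?case
        using single by (simp add: zero_word_def[symmetric] flip: one_uqsl2.abs_eq)
    next
      case (Cons l u)
      have "Poly_Mapping.single (Word (l # u)) 1 = fgen l * (Poly_Mapping.single (Word u) 1 :: falg)"
        by (simp add: fgen_def mult_single)
      then show ?case using letter[OF Cons] by (simp add: mult.assoc flip: times_uqsl2.abs_eq)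
    qed
    then have "c *\<^sub>U (abs_uqsl2 (Poly_Mapping.single w 1) * y) \<in> filt CARD('p)"
      by (cases w) (simp add: filt_closed)
    moreover have "Poly_Mapping.single w c = fconst c * (Poly_Mapping.single w 1 :: falg)"
      by (simp add: fconst_def mult_single)
    ultimately show ?case by (simp flip: scaleU.abs_eq)
  next
    case (add f g)
    then show ?case by (simp add: distrib_right filt_closed flip: plus_uqsl2.abs_eq)
  qed
  moreover have "pbw 0 0 0 \<in> (filt CARD('p) :: 'p uqsl2 set)" by (rule pbw_in_filt) simp
  then have "(1 :: 'p uqsl2) \<in> filt CARD('p)" by (simp add: pbw_def)
  ultimately have "abs_uqsl2 f * 1 \<in> (filt CARD('p) :: 'p uqsl2 set)" for f by blast
  then have "(abs_uqsl2 (rep_uqsl2 x) :: 'p uqsl2) \<in> filt CARD('p)" by (simp only: mult_1_right)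
  then show ?thesis by (simp only: Quotient_abs_rep[OF Quotient_uqsl2])
qed

section \<open>Spanning monomials and uniqueness of linear forms\<close>

definition pbw_basis :: "'p::finite uqsl2 set" where
  "pbw_basis = (\<lambda>(m, n, l). pbw m n l) ` ({..<CARD('p)} \<times> {..<CARD('p)} \<times> {..<2 * CARD('p)})"

lemma span_pbw_basis: "U.span pbw_basis = (UNIV :: 'p::finite uqsl2 set)"
proof -
  have "pbw m n l \<in> U.span (pbw_basis :: 'p uqsl2 set)" if "m < CARD('p)" for m n l
  proof (cases "n < CARD('p)")
    case True
    then have "pbw m n (l mod (2 * CARD('p))) \<in> (pbw_basis :: 'p uqsl2 set)"
      using that unfolding pbw_basis_def by (intro image_eqI[of _ _ "(m, n, l mod (2 * CARD('p)))"]) auto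
    then show ?thesis using pbw_mod U.span_base by metis
  qed (simp add: pbw_F_overflow U.span_zero)
  then have "filt CARD('p) \<subseteq> U.span (pbw_basis :: 'p uqsl2 set)"
    unfolding filt_def by (intro U.span_minimal U.subspace_span) auto
  then show ?thesis using filt_full by blast
qed

text \<open>Only an upper bound: distinct exponents are not known at this point to give distinct
  elements.\<close>

lemma card_pbw_basis: "finite (pbw_basis :: 'p::finite uqsl2 set)"
    "card (pbw_basis :: 'p uqsl2 set) \<le> 2 * CARD('p) ^ 3"
proof -
  show "finite (pbw_basis :: 'p uqsl2 set)" by (simp add: pbw_basis_def)
  have "card (pbw_basis :: 'p uqsl2 set) \<le> card ({..<CARD('p)} \<times> {..<CARD('p)} \<times> {..<2 * CARD('p)})"
    unfolding pbw_basis_def by (rule card_image_le) simp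
  then show "card (pbw_basis :: 'p uqsl2 set) \<le> 2 * CARD('p) ^ 3"
    by (simp add: card_cartesian_product power3_eq_cube algebra_simps)
qed

lemma linear_form_iff: "Vector_Spaces.linear scaleU (*) (f :: 'p::finite uqsl2 \<Rightarrow> complex)
  \<longleftrightarrow> (\<forall>x y. f (x + y) = f x + f y) \<and> (\<forall>c x. f (c *\<^sub>U x) = c * f x)"
proof -
  have "vector_space ((*) :: complex \<Rightarrow> complex \<Rightarrow> complex)"
    by unfold_locales (simp_all add: algebra_simps)
  then show ?thesis by (simp add: Vector_Spaces.linear_iff U.vector_space_axioms)
qed

text \<open>Provides the uniqueness half of the definite descriptions \<open>lam\<close> and
  \<open>mu\<close>.\<close>

lemma linear_form_eqI:
  fixes f g :: "'p::finite uqsl2 \<Rightarrow> complex"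
  assumes "Vector_Spaces.linear scaleU (*) f" "Vector_Spaces.linear scaleU (*) g"
    and eq: "\<And>m n l. m < CARD('p) \<Longrightarrow> n < CARD('p) \<Longrightarrow> l < 2 * CARD('p) \<Longrightarrow> f (pbw m n l) = g (pbw m n l)"
  shows "f = g"
proof
  fix x :: "'p uqsl2"
  have lin: "f (x + y) = f x + f y" "g (x + y) = g x + g y" "f (c *\<^sub>U x) = c * f x" "g (c *\<^sub>U x) = c * g x" for x y :: "'p uqsl2" and c
    using assms(1,2) by (simp_all add: linear_form_iff)
  have zero: "f 0 = 0" "g 0 = 0" using lin(3,4)[of 0 0] by simp_all
  have "x \<in> U.span pbw_basis" by (simp add: span_pbw_basis)
  then show "f x = g x"
    by (induction rule: U.span_induct_alt) (auto simp: zero lin pbw_basis_def eq)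
qed


section \<open>The integrals\<close>

lemma tau_add: "tau (x + y) = tau x + tau y"
  and tau_scale: "tau (c *\<^sub>U x) = c * tau x"
  for x y :: "'p::finite uqsl2"
  using tau_linear[where 'p = 'p] by (simp_all add: linear_form_iff)

lemma tau_zero [simp]: "tau (0 :: 'p::finite uqsl2) = 0"
  using tau_scale[of 0 "0 :: 'p uqsl2"] by simp

lemma tau_sum: "tau (\<Sum>i\<in>I. f i) = (\<Sum>i\<in>I. tau (f i :: 'p::finite uqsl2))"
  by (induction I rule: infinite_finite_induct) (simp_all add: tau_add)

lemma tau_diff: "tau (x - y) = tau x - tau (y :: 'p::finite uqsl2)"
  using tau_add[of "x - y" y] by simp

lemma tau_pbw:
  assumes "2 \<le> CARD('p::finite)"
  shows "tau (pbw m n l :: 'p uqsl2) = of_bool (m = CARD('p) - 1 \<and> n = CARD('p) - 1 \<and> 2 * CARD('p) dvd l)"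
  using tau_monomial[OF assms] by (simp add: pbw_def)

text \<open>Right multiplication by g adds p + 1 to the exponent of K, and p - 1 is the only
  exponent below 2p for which this yields a multiple of 2p.\<close>

lemma lam_eq_tau:
  assumes "2 \<le> CARD('p::finite)"
  shows "lam = (\<lambda>x :: 'p uqsl2. tau (x * bal))"
  unfolding lam_def
proof (rule the_equality)
  let ?P = "\<lambda>f :: 'p uqsl2 \<Rightarrow> complex. Vector_Spaces.linear scaleU (*) f \<and>
     (\<forall>m < CARD('p). \<forall>n < CARD('p). \<forall>l < 2 * CARD('p).
        f (pbw m n l) = of_bool (m = CARD('p) - 1 \<and> n = CARD('p) - 1 \<and> l = CARD('p) - 1))"
  have "tau (pbw m n l * bal :: 'p uqsl2) = of_bool (m = CARD('p) - 1 \<and> n = CARD('p) - 1 \<and> l = CARD('p) - 1)"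
    if "l < 2 * CARD('p)" for m n l
  proof -
    have "pbw m n l * bal = (pbw m n (l + (CARD('p) + 1)) :: 'p uqsl2)"
      unfolding pbw_def bal_def power_add[of genK l] mult.assoc ..
    moreover have "2 * CARD('p) dvd l + (CARD('p) + 1) \<longleftrightarrow> l = CARD('p) - 1"
    proof
      assume "2 * CARD('p) dvd l + (CARD('p) + 1)"
      then obtain k where k: "l + (CARD('p) + 1) = 2 * CARD('p) * k" by blast
      moreover have "l + (CARD('p) + 1) < 2 * CARD('p) * 2" using that assms by simp
      ultimately have "k < 2" "k \<noteq> 0" by (simp, cases k) auto
      then have "k = 1" by simp
      then show "l = CARD('p) - 1" using k assms by simp
    qed (use assms in \<open>auto simp flip: mult_2\<close>)
    ultimately show ?thesis by (simp add: tau_pbw[OF assms])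
  qed
  then show P: "?P (\<lambda>x. tau (x * bal))"
    by (simp add: linear_form_iff tau_add tau_scale distrib_right)
  show "f = (\<lambda>x. tau (x * bal))" if "?P f" for f
    by (rule linear_form_eqI) (use that P in auto)
qed

text \<open>Here g^(-1) = K^(p-1) must cross E^m F^n, which costs a power of q^(2(m-n)); tau only
  sees m = n = p - 1, where this factor is 1.\<close>

lemma mu_eq_tau:
  assumes "2 \<le> CARD('p::finite)"
  shows "mu = (\<lambda>x :: 'p uqsl2. tau (bal_inv * x))"
  unfolding mu_def
proof (rule the_equality)
  let ?P = "\<lambda>f :: 'p uqsl2 \<Rightarrow> complex. Vector_Spaces.linear scaleU (*) f \<and>
     (\<forall>m < CARD('p). \<forall>n < CARD('p). \<forall>l < 2 * CARD('p).
        f (pbw m n l) = of_bool (m = CARD('p) - 1 \<and> n = CARD('p) - 1 \<and> l = CARD('p) + 1))"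
  have bal_inv: "bal_inv = (genK ^ (CARD('p) - 1) :: 'p uqsl2)"
  proof -
    have "bal * genK ^ (CARD('p) - 1) = (1 :: 'p uqsl2)"
      using uqsl2_relations(8)[where 'p = 'p] assms
      unfolding bal_def power_add[symmetric] by (simp add: mult_2)
    then have "bal_inv * (bal * genK ^ (CARD('p) - 1)) = (bal_inv :: 'p uqsl2)" by simp
    then show ?thesis by (simp add: bal_inverse flip: mult.assoc)
  qed
  have "tau (bal_inv * pbw m n l :: 'p uqsl2) = of_bool (m = CARD('p) - 1 \<and> n = CARD('p) - 1 \<and> l = CARD('p) + 1)"
    if "l < 2 * CARD('p)" for m n l
  proof -
    have "2 * CARD('p) dvd l + (CARD('p) - 1) \<longleftrightarrow> l = CARD('p) + 1"
    proof
      assume "2 * CARD('p) dvd l + (CARD('p) - 1)"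
      then obtain k where k: "l + (CARD('p) - 1) = 2 * CARD('p) * k" by blast
      moreover have "l + (CARD('p) - 1) < 2 * CARD('p) * 2" using that assms by simp
      ultimately have "k < 2" "k \<noteq> 0" using assms by (simp, cases k) auto
      then have "k = 1" by simp
      then show "l = CARD('p) + 1" using k assms by simp
    qed (use assms in \<open>auto simp flip: mult_2\<close>)
    moreover have "((qroot CARD('p))\<^sup>2 ^ m * inverse ((qroot CARD('p))\<^sup>2) ^ m) ^ (CARD('p) - 1) = 1"
      by (simp flip: power_mult_distrib)
    ultimately show ?thesis unfolding bal_inv genK_power_pbw tau_scale tau_pbw[OF assms] by auto
  qed
  then show P: "?P (\<lambda>x. tau (bal_inv * x))"
    by (simp add: linear_form_iff tau_add tau_scale distrib_left)
  show "f = (\<lambda>x. tau (bal_inv * x))" if "?P f" for f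
    by (rule linear_form_eqI) (use that P in auto)
qed

lemma hooks_eq_tau:
  assumes "2 \<le> CARD('p::finite)"
  shows "(bal_inv \<rightharpoonup>\<^sub>U lam) = (tau :: 'p uqsl2 \<Rightarrow> complex)"
    and "(mu \<leftharpoonup>\<^sub>U bal) = (tau :: 'p uqsl2 \<Rightarrow> complex)"
  by (simp_all add: left_hook_def right_hook_def lam_eq_tau[OF assms] mu_eq_tau[OF assms]
      mult.assoc bal_inverse flip: mult.assoc[of bal_inv])

section \<open>Values of tau after reordering\<close>

lemma tau_filt:
  fixes x :: "'p::finite uqsl2"
  assumes "2 \<le> CARD('p)" "x \<in> filt (CARD('p) - 1)"
  shows "tau x = 0"
  using assms(2) unfolding filt_def
  by (induction rule: U.span_induct_alt) (auto simp: tau_add tau_scale tau_pbw[OF assms(1)])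

text \<open>Moving F^n to the right of E^m changes the element only by terms of E-degree below p -
  1, where tau vanishes. Of the powers K^l in v only l = 0 contributes.\<close>

lemma tau_F_E_F_vvec:
  assumes "2 \<le> CARD('p::finite)" "m < CARD('p)"
  shows "tau (genF ^ n * (genE ^ m * (genF ^ k * vvec \<alpha> s t)) :: 'p uqsl2)
    = of_bool (m = CARD('p) - 1 \<and> n + k = CARD('p) - 1)"
proof -
  define z where "z = \<alpha> * qroot CARD('p) powi (- (int s - 2 * int t + 1))"
  have pbw: "tau (genF ^ n * pbw m k l :: 'p uqsl2)
      = of_bool (m = CARD('p) - 1 \<and> n + k = CARD('p) - 1 \<and> 2 * CARD('p) dvd l)" for l
  proof -
    have "genF ^ n * pbw m k l - pbw m (k + n) l \<in> (filt (CARD('p) - 1) :: 'p uqsl2 set)"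
      using genF_power_pbw filt_mono[of m "CARD('p) - 1"] assms(2) by fastforce
    from tau_filt[OF assms(1) this] show ?thesis
      by (simp add: tau_diff tau_pbw[OF assms(1)] add.commute)
  qed
  have "genF ^ n * (genE ^ m * (genF ^ k * vvec \<alpha> s t)) = (\<Sum>l<2 * CARD('p). z ^ l *\<^sub>U (genF ^ n * pbw m k l :: 'p uqsl2))"
    by (simp add: vvec_def z_def sum_distrib_left pbw_def mult.assoc)
  then have "tau (genF ^ n * (genE ^ m * (genF ^ k * vvec \<alpha> s t)) :: 'p uqsl2)
      = (\<Sum>l<2 * CARD('p). z ^ l * of_bool (m = CARD('p) - 1 \<and> n + k = CARD('p) - 1 \<and> 2 * CARD('p) dvd l))"
    by (simp only: tau_sum tau_scale pbw)
  also have "\<dots> = (\<Sum>l<2 * CARD('p). if l = 0 then of_bool (m = CARD('p) - 1 \<and> n + k = CARD('p) - 1) else 0)"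
    by (rule sum.cong) (auto dest: dvd_imp_le)
  also have "\<dots> = of_bool (m = CARD('p) - 1 \<and> n + k = CARD('p) - 1)"
    by (subst sum.delta) auto
  finally show ?thesis .
qed

lemma tau_E_E_F_vvec:
  assumes "2 \<le> CARD('p::finite)" "k < CARD('p) - 1"
  shows "tau (genE ^ n * (genE ^ m * (genF ^ k * vvec \<alpha> s t)) :: 'p uqsl2) = 0"
proof -
  define z where "z = \<alpha> * qroot CARD('p) powi (- (int s - 2 * int t + 1))"
  have "genE ^ n * (genE ^ m * (genF ^ k * vvec \<alpha> s t)) = (\<Sum>l<2 * CARD('p). z ^ l *\<^sub>U (pbw (n + m) k l :: 'p uqsl2))"
    by (simp add: vvec_def z_def sum_distrib_left pbw_def power_add mult.assoc)
  then show ?thesis using assms(2) by (simp add: tau_sum tau_scale tau_pbw[OF assms(1)])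
qed

section \<open>Strings of the basis elements\<close>

text \<open>Up to the factor 2p, v is the idempotent for one eigenvalue of K: multiplying by K
  rotates the summation index, as z^(2p) = 1 and K^(2p) = 1.\<close>

lemma vvec_genK:
  assumes p: "2 \<le> CARD('p::finite)" and \<alpha>: "\<alpha> = 1 \<or> \<alpha> = -1"
  shows "has_weight (\<alpha> * qroot CARD('p) powi (int s - 2 * int t + 1)) (vvec \<alpha> s t :: 'p uqsl2)"
    and "vvec \<alpha> s t * genK = (\<alpha> * qroot CARD('p) powi (int s - 2 * int t + 1)) *\<^sub>U (vvec \<alpha> s t :: 'p uqsl2)"
proof -
  define x where "x = int s - 2 * int t + 1"
  define z where "z = \<alpha> * qroot CARD('p) powi (- x)"
  define c where "c = \<alpha> * qroot CARD('p) powi x"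
  have cz: "c * z = 1"
    using \<alpha> by (auto simp: c_def z_def power_int_minus)
  have z1: "z ^ (2 * CARD('p)) = 1"
  proof -
    have "(qroot CARD('p) powi (- x)) ^ (2 * CARD('p)) = qroot CARD('p) powi (- x * int (2 * CARD('p)))"
      unfolding power_int_mult power_int_of_nat ..
    also have "\<dots> = 1" by (simp only: qroot_powi_eq_1_iff[OF p]) simp
    finally show ?thesis using \<alpha> by (auto simp: z_def power_mult_distrib)
  qed
  have v: "vvec \<alpha> s t = (\<Sum>l<2 * CARD('p). z ^ l *\<^sub>U (genK ^ l :: 'p uqsl2))"
    by (simp add: vvec_def z_def x_def)
  have shift: "(\<Sum>l<2 * CARD('p). z ^ Suc l *\<^sub>U (genK ^ Suc l :: 'p uqsl2)) = (\<Sum>l<2 * CARD('p). z ^ l *\<^sub>U genK ^ l)"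
    using sum.lessThan_Suc_shift[of "\<lambda>l. z ^ l *\<^sub>U (genK ^ l :: 'p uqsl2)" "2 * CARD('p)"]
    unfolding sum.lessThan_Suc uqsl2_relations z1 by simp
  have "c *\<^sub>U vvec \<alpha> s t = (\<Sum>l<2 * CARD('p). c *\<^sub>U z ^ Suc l *\<^sub>U (genK ^ Suc l :: 'p uqsl2))"
    unfolding v shift[symmetric] by (rule U.scale_sum_right)
  also have "\<dots> = (\<Sum>l<2 * CARD('p). z ^ l *\<^sub>U (genK ^ Suc l :: 'p uqsl2))"
    using cz by (simp flip: mult.assoc)
  finally have c: "c *\<^sub>U vvec \<alpha> s t = (\<Sum>l<2 * CARD('p). z ^ l *\<^sub>U (genK ^ Suc l :: 'p uqsl2))" .
  show "has_weight (\<alpha> * qroot CARD('p) powi (int s - 2 * int t + 1)) (vvec \<alpha> s t :: 'p uqsl2)"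
    using c unfolding has_weight_def c_def[symmetric] x_def[symmetric] by (simp add: v sum_distrib_left)
  show "vvec \<alpha> s t * genK = (\<alpha> * qroot CARD('p) powi (int s - 2 * int t + 1)) *\<^sub>U (vvec \<alpha> s t :: 'p uqsl2)"
    using c unfolding c_def[symmetric] x_def[symmetric]
    by (simp add: v sum_distrib_right power_Suc2 del: power_Suc)
qed

text \<open>\<open>E F\<^sup>n x - F\<^sup>n E x = hw n F\<^sup>n\<^sup>-\<^sup>1 x\<close> for \<open>x\<close> of weight \<open>\<alpha> q\<^sup>r\<^sup>-\<^sup>1\<close>.\<close>

definition hw :: "nat \<Rightarrow> complex \<Rightarrow> nat \<Rightarrow> nat \<Rightarrow> complex" where
  "hw p \<alpha> r n = qint p n * bra p (\<alpha> * qroot p powi (int r - int n))"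

lemma hw_self: "hw p \<alpha> r r = 0" if "\<alpha> = 1 \<or> \<alpha> = -1"
  using that by (auto simp: hw_def bra_def)

text \<open>A zero would require p to divide n or r - n, which leaves only n = r. Products of
  \<open>hw\<close> up to n therefore stay nonzero as long as n < r.\<close>

lemma hw_nonzero:
  assumes "p \<ge> 2" "\<alpha> = 1 \<or> \<alpha> = -1" "0 < n" "n < p" "r \<le> p" "n \<noteq> r" "r > 0"
  shows "hw p \<alpha> r n \<noteq> 0"
proof -
  have "\<not> int p dvd int r - int n"
  proof
    assume dvd: "int p dvd int r - int n"
    then have "int p dvd int n - int r" by (simp add: dvd_diff_commute)
    consider "n < r" | "r < n" using assms(6) by linarith
    then show False
    proof cases
      case 1
      then show False using assms zdvd_imp_le[OF dvd] by auto
    next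
      case 2
      then show False using assms zdvd_imp_le[OF \<open>int p dvd int n - int r\<close>] by auto
    qed
  qed
  then have "bra p (\<alpha> * qroot p powi (int r - int n)) \<noteq> 0"
    using assms(2) unfolding bra_sign[OF assms(2)] mult_eq_0_iff bra_qroot_eq_0_iff[OF assms(1)] by auto
  then show ?thesis using qint_nonzero[OF assms(1,3,4)] by (simp add: hw_def)
qed

lemma genE_genF_power_top:
  fixes x :: "'p::finite uqsl2"
  assumes "2 \<le> CARD('p)" "has_weight (\<alpha> * qroot CARD('p) powi (int r - 1)) x" "\<alpha> = 1 \<or> \<alpha> = -1"
  shows "genE * (genF ^ Suc n * x) = genF ^ Suc n * (genE * x) + hw CARD('p) \<alpha> r (Suc n) *\<^sub>U (genF ^ n * x)"
proof -
  have "\<alpha> * qroot CARD('p) powi (int r - 1) * inverse (qroot CARD('p)) ^ n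
    = \<alpha> * qroot CARD('p) powi (int r - int (Suc n))"
    by (simp add: power_int_diff power_int_add field_simps)
  then show ?thesis
    using genE_genF_power[OF assms(1,2), of n] assms(3) unfolding hw_def by auto
qed

text \<open>In the next three lemmas \<open>a\<close> and \<open>b\<close> stand for \<open>a\<^sub>0\<close> and \<open>b\<^sub>0\<close>.  The relation \<open>F E b = a\<close>
  says that the Casimir element acts on \<open>b\<close> by a Jordan block with \<open>a\<close> as eigenvector.\<close>

lemma string_a:
  fixes a :: "'p::finite uqsl2"
  assumes p: "2 \<le> CARD('p)" and wt: "has_weight (\<alpha> * qroot CARD('p) powi (int r - 1)) a"
    and \<alpha>: "\<alpha> = 1 \<or> \<alpha> = -1" and Ea: "genE * a = 0"
  shows "genE ^ n * (genF ^ n * a) = (\<Prod>i = 1..n. hw CARD('p) \<alpha> r i) *\<^sub>U a"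
proof (induction n)
  case (Suc n)
  have "genE ^ Suc n * (genF ^ Suc n * a) = genE ^ n * (genE * (genF ^ Suc n * a))"
    by (simp only: power_Suc2 mult.assoc)
  then show ?case
    unfolding genE_genF_power_top[OF p wt \<alpha>] by (simp add: Ea Suc mult.commute)
qed simp

text \<open>As F E b = a, pushing E through F^(n+1) b leaves an extra term in a at every step. The
  product in front of b dies at n = r by \<open>hw_self\<close>, and from there on a nonzero
  multiple of a remains.\<close>

lemma string_b:
  fixes a b :: "'p::finite uqsl2"
  assumes p: "2 \<le> CARD('p)" and wt: "has_weight (\<alpha> * qroot CARD('p) powi (int r - 1)) a"
      "has_weight (\<alpha> * qroot CARD('p) powi (int r - 1)) b"
    and \<alpha>: "\<alpha> = 1 \<or> \<alpha> = -1" and Ea: "genE * a = 0" and FEb: "genF * (genE * b) = a"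
  shows "genE ^ Suc n * (genF ^ Suc n * b)
      = (\<Prod>i = 1..n. hw CARD('p) \<alpha> r i) *\<^sub>U a + hw CARD('p) \<alpha> r (Suc n) *\<^sub>U (genE ^ n * (genF ^ n * b))"
    and "\<exists>c. genE ^ n * (genF ^ n * b) = (\<Prod>i = 1..n. hw CARD('p) \<alpha> r i) *\<^sub>U b + c *\<^sub>U a"
    and "\<lbrakk>0 < r; r \<le> n; n < CARD('p); r < CARD('p)\<rbrakk> \<Longrightarrow> \<exists>c. c \<noteq> 0 \<and> genE ^ n * (genF ^ n * b) = c *\<^sub>U a"
proof -
  show Suc': "genE ^ Suc n * (genF ^ Suc n * b)
      = (\<Prod>i = 1..n. hw CARD('p) \<alpha> r i) *\<^sub>U a + hw CARD('p) \<alpha> r (Suc n) *\<^sub>U (genE ^ n * (genF ^ n * b))" for n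
  proof -
    have "genE ^ Suc n * (genF ^ Suc n * b) = genE ^ n * (genE * (genF ^ Suc n * b))"
      by (simp only: power_Suc2 mult.assoc)
    also have "\<dots> = genE ^ n * (genF ^ Suc n * (genE * b)) + hw CARD('p) \<alpha> r (Suc n) *\<^sub>U (genE ^ n * (genF ^ n * b))"
      unfolding genE_genF_power_top[OF p wt(2) \<alpha>] by (simp add: distrib_left)
    also have "genF ^ Suc n * (genE * b) = genF ^ n * a"
      by (simp only: power_Suc2 mult.assoc FEb)
    finally show ?thesis unfolding string_a[OF p wt(1) \<alpha> Ea] .
  qed
  show "\<exists>c. genE ^ n * (genF ^ n * b) = (\<Prod>i = 1..n. hw CARD('p) \<alpha> r i) *\<^sub>U b + c *\<^sub>U a"
  proof (induction n)
    case 0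
    show ?case by (rule exI[of _ 0]) simp
  next
    case (Suc n)
    then obtain c where "genE ^ n * (genF ^ n * b) = (\<Prod>i = 1..n. hw CARD('p) \<alpha> r i) *\<^sub>U b + c *\<^sub>U a" by blast
    then have "genE ^ Suc n * (genF ^ Suc n * b) = (\<Prod>i = 1..Suc n. hw CARD('p) \<alpha> r i) *\<^sub>U b
        + ((\<Prod>i = 1..n. hw CARD('p) \<alpha> r i) + hw CARD('p) \<alpha> r (Suc n) * c) *\<^sub>U a"
      unfolding Suc' by (simp add: U.scale_right_distrib U.scale_left_distrib mult.commute)
    then show ?case by blast
  qed
  show "\<exists>c. c \<noteq> 0 \<and> genE ^ n * (genF ^ n * b) = c *\<^sub>U a"
    if r: "0 < r" "r \<le> n" "n < CARD('p)" "r < CARD('p)"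
    using r(2,3)
  proof (induction n rule: dec_induct)
    case base
    obtain r' where r': "r = Suc r'" using r(1) by (cases r) auto
    have "hw CARD('p) \<alpha> r i \<noteq> 0" if "i \<in> {1..r'}" for i
      using r r' that by (intro hw_nonzero p \<alpha>) auto
    then have "(\<Prod>i = 1..r'. hw CARD('p) \<alpha> r i) \<noteq> 0" by simp
    moreover have "genE ^ r * (genF ^ r * b) = (\<Prod>i = 1..r'. hw CARD('p) \<alpha> r i) *\<^sub>U a"
      using Suc'[of r'] hw_self[OF \<alpha>, of "CARD('p)" r] unfolding r' by simp
    ultimately show ?case by blast
  next
    case (step n)
    then obtain c where c: "c \<noteq> 0" "genE ^ n * (genF ^ n * b) = c *\<^sub>U a" by auto
    \<comment> \<open>For n at least r the product contains the zero factor i = r, so only the old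
      coefficient c is carried on, times a nonzero scalar.\<close>
    have "(\<Prod>i = 1..n. hw CARD('p) \<alpha> r i) = 0"
      using r step hw_self[OF \<alpha>] by (auto intro!: bexI[of _ r])
    then have "genE ^ Suc n * (genF ^ Suc n * b) = (hw CARD('p) \<alpha> r (Suc n) * c) *\<^sub>U a"
      unfolding Suc' c by simp
    moreover have "hw CARD('p) \<alpha> r (Suc n) \<noteq> 0"
      using r step by (intro hw_nonzero p \<alpha>) auto
    ultimately show ?case using c by (metis mult_eq_0_iff)
  qed
qed

text \<open>F descends the string of the E^n b: by F E b = a and E a = 0, F E^(n+2) b is a multiple
  of E^(n+1) b. The scalar is up to sign [n+1][r+n+1], nonzero because r + n + 1 < p.\<close>

lemma string_x:
  fixes a b :: "'p::finite uqsl2"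
  assumes p: "2 \<le> CARD('p)" and wt: "has_weight (\<alpha> * qroot CARD('p) powi (int r - 1)) b"
    and \<alpha>: "\<alpha> = 1 \<or> \<alpha> = -1" and Ea: "genE * a = 0" and FEb: "genF * (genE * b) = a"
    and n: "r + Suc n \<le> CARD('p)" "0 < r"
  shows "\<exists>c. c \<noteq> 0 \<and> genF ^ Suc n * (genE ^ Suc n * b) = c *\<^sub>U a"
  using n(1)
proof (induction n)
  case 0
  show ?case by (rule exI[of _ 1]) (simp add: FEb)
next
  case (Suc n)
  let ?q = "qroot CARD('p)"
  obtain c where c: "c \<noteq> 0" "genF ^ Suc n * (genE ^ Suc n * b) = c *\<^sub>U a" using Suc by auto
  have wt': "has_weight (\<alpha> * ?q powi (int r - 1) * ?q\<^sup>2) (genE * b)"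
    using has_weight_E[OF wt] .
  define k where "k = qint CARD('p) (Suc n) * bra CARD('p) (\<alpha> * ?q powi (int r - 1) * ?q\<^sup>2 * ?q ^ n)"
  have e: "\<alpha> * ?q powi (int r - 1) * ?q\<^sup>2 * ?q ^ n = \<alpha> * ?q powi (int (r + Suc n))"
  proof -
    have "int (r + Suc n) = (int r - 1) + int 2 + int n" by simp
    then show ?thesis
      by (simp only: power_int_add[OF disjI1[OF qroot_nonzero]] power_int_of_nat mult.assoc)
  qed
  have "\<not> int CARD('p) dvd int (r + Suc n)"
    using zdvd_imp_le[of "int CARD('p)" "int (r + Suc n)"] Suc.prems by auto
  then have k: "k \<noteq> 0"
    using \<alpha> Suc.prems n(2) qint_nonzero[OF p, of "Suc n"]
    unfolding k_def e bra_sign[OF \<alpha>] mult_eq_0_iff bra_qroot_eq_0_iff[OF p] by auto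
  have "genF * (genE ^ Suc (Suc n) * b) = genF * (genE ^ Suc n * (genE * b))"
    by (simp only: power_Suc2 mult.assoc)
  also have "\<dots> = genE ^ Suc n * a - k *\<^sub>U (genE ^ n * (genE * b))"
    using genF_genE_power[OF p wt', of n] \<alpha> unfolding FEb k_def by auto
  also have "genE ^ Suc n * a = 0" by (simp only: power_Suc2 mult.assoc Ea mult_zero_right)
  finally have "genF * (genE ^ Suc (Suc n) * b) = (- k) *\<^sub>U (genE ^ Suc n * b)"
    by (simp add: power_commutes flip: mult.assoc)
  then have "genF ^ Suc (Suc n) * (genE ^ Suc (Suc n) * b) = (- k * c) *\<^sub>U a"
    unfolding power_Suc2[of genF "Suc n"] mult.assoc by (simp add: c del: power_Suc)
  then show ?case using c k by (metis mult_eq_0_iff neg_equal_0_iff_equal)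
qed

section \<open>The vectors a, b, x, y and their weights\<close>

lemma avec_eq: "avec \<alpha> n r t = genF ^ n * (avec \<alpha> 0 r t :: 'p::finite uqsl2)"
  by (simp add: avec_def mult.assoc)

lemma bvec_eq: "bvec \<alpha> n r t = genF ^ n * (bvec \<alpha> 0 r t :: 'p::finite uqsl2)"
  by (simp add: bvec_def)

text \<open>The integer \<open>d\<close> records that the exponent of q matters only modulo
  2p.\<close>

lemma monomial_weight:
  assumes p: "2 \<le> CARD('p::finite)" and \<alpha>: "\<alpha> = 1 \<or> \<alpha> = -1"
    and c: "int r - 2 * int t + 1 + 2 * int m - 2 * int n = c + 2 * int CARD('p) * d"
  shows "has_weight (\<alpha> * qroot CARD('p) powi c) (genE ^ m * (genF ^ n * vvec \<alpha> r t) :: 'p uqsl2)"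
proof -
  let ?q = "qroot CARD('p)"
  have "\<alpha> * ?q powi (int r - 2 * int t + 1) * inverse (?q\<^sup>2) ^ n * ?q\<^sup>2 ^ m
      = \<alpha> * ?q powi (int r - 2 * int t + 1 + 2 * int m - 2 * int n)"
  proof -
    have "?q\<^sup>2 ^ k = ?q powi (2 * int k)" for k
      unfolding power_mult[symmetric] by (metis of_nat_mult of_nat_numeral power_int_of_nat)
    then show ?thesis
      by (simp only: power_inverse power_int_diff power_int_add[OF disjI1[OF qroot_nonzero]] qroot_nonzero
          simp_thms) (simp add: field_simps)
  qed
  also have "?q powi (int r - 2 * int t + 1 + 2 * int m - 2 * int n) = ?q powi c"
    unfolding c qroot_powi_eq_iff[OF p] by simp
  finally have e: "\<alpha> * ?q powi (int r - 2 * int t + 1) * inverse (?q\<^sup>2) ^ n * ?q\<^sup>2 ^ m = \<alpha> * ?q powi c" .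
  show ?thesis
    using has_weight_E_power[OF has_weight_F_power[OF vvec_genK(1)[OF p \<alpha>, of r t], of n], of m]
    unfolding e .
qed

lemma avec_0_facts:
  assumes p: "2 \<le> CARD('p::finite)" and \<alpha>: "\<alpha> = 1 \<or> \<alpha> = -1" and t: "1 \<le> t" "t \<le> r" "r \<le> CARD('p)"
  shows "has_weight (\<alpha> * qroot CARD('p) powi (int r - 1)) (avec \<alpha> 0 r t :: 'p uqsl2)"
    and "genE * (avec \<alpha> 0 r t :: 'p uqsl2) = 0"
    and "(avec \<alpha> 0 r t :: 'p uqsl2) \<noteq> 0"
proof -
  have a: "avec \<alpha> 0 r t = genE ^ (CARD('p) - 1) * (genF ^ (CARD('p) - t) * (vvec \<alpha> r t :: 'p uqsl2))"
    by (simp add: avec_def mult.assoc)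
  show "has_weight (\<alpha> * qroot CARD('p) powi (int r - 1)) (avec \<alpha> 0 r t :: 'p uqsl2)"
    unfolding a by (rule monomial_weight[OF p \<alpha>, where d = 0]) (use t p in auto)
  have "genE * genE ^ (CARD('p) - 1) = (0 :: 'p uqsl2)"
    using uqsl2_relations(6)[where 'p = 'p] p by (metis Suc_diff_1 power_Suc zero_less_card_finite)
  then show "genE * (avec \<alpha> 0 r t :: 'p uqsl2) = 0"
    unfolding a by (simp flip: mult.assoc)
  have "tau (genF ^ (t - 1) * (avec \<alpha> 0 r t :: 'p uqsl2)) = 1"
    unfolding a using t p by (subst tau_F_E_F_vvec[OF p]) auto
  then show "(avec \<alpha> 0 r t :: 'p uqsl2) \<noteq> 0" by auto
qed

lemma mucoef_1: "mucoef p \<alpha> (Suc 0) s = 1" if "s < p"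
proof -
  have "{p - s..p - s - 1} = {}" using that by auto
  then show ?thesis unfolding mucoef_def by simp
qed

lemma mucoef_Suc:
  assumes "1 \<le> m" "m < p - s"
  shows "mucoef p \<alpha> (Suc m) s = - \<alpha> * (qint p (p - s - m) * qint p m) * mucoef p \<alpha> m s"
proof -
  have "{p - s - (Suc m - 1)..p - s - 1} = insert (p - s - m) {p - s - (m - 1)..p - s - 1}"
    using assms by auto
  moreover have "p - s - m \<notin> {p - s - (m - 1)..p - s - 1}" using assms by auto
  moreover have "p - s - (p - s - m) = m" using assms by simp
  ultimately show ?thesis unfolding mucoef_def by simp
qed

text \<open>Passing E^(p-m) yields the scalar [p-m] times \<open>bra\<close> of \<alpha> q^(r+m+p).
  By q^p = -1 and [p-i] = [i] this is -\<alpha> [m][p-r-m], the ratio of consecutive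
  \<open>mucoef\<close>.\<close>

lemma genF_u:
  assumes p: "2 \<le> CARD('p::finite)" and \<alpha>: "\<alpha> = 1 \<or> \<alpha> = -1"
    and t: "1 \<le> t" "t \<le> r" "r < CARD('p)" and m: "1 \<le> m" "m \<le> CARD('p) - r"
  shows "genF * (genE ^ (CARD('p) - m) * (genF ^ (CARD('p) - t - m) * (vvec \<alpha> r t :: 'p uqsl2)))
    = genE ^ (CARD('p) - m) * (genF ^ (CARD('p) - t - (m - 1)) * vvec \<alpha> r t)
     + (\<alpha> * (qint CARD('p) m * qint CARD('p) (CARD('p) - r - m)))
        *\<^sub>U (genE ^ (CARD('p) - Suc m) * (genF ^ (CARD('p) - t - m) * vvec \<alpha> r t))"
proof -
  let ?q = "qroot CARD('p)"
  have nz: "\<alpha> * ?q powi (int r + 1 + 2 * int m) \<noteq> 0" using \<alpha> by auto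
  obtain k where k: "CARD('p) - m = Suc k" using m t by (cases "CARD('p) - m") auto
  \<comment> \<open>The exponent of q after applying F^(p-t-m) to v is r + 1 + 2 m - 2p, whence d =
    -1.\<close>
  have wt: "has_weight (\<alpha> * ?q powi (int r + 1 + 2 * int m)) (genE ^ 0 * (genF ^ (CARD('p) - t - m) * (vvec \<alpha> r t :: 'p uqsl2)))"
    by (rule monomial_weight[OF p \<alpha>, where d = "-1"]) (use m t in \<open>simp add: of_nat_diff\<close>)
  then have wt: "has_weight (\<alpha> * ?q powi (int r + 1 + 2 * int m)) (genF ^ (CARD('p) - t - m) * (vvec \<alpha> r t :: 'p uqsl2))"
    by simp
  have "?q powi (int r + 1 + 2 * int m) * ?q ^ k = ?q powi (int r + int m + int CARD('p))"
  proof -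
    have "int r + int m + int CARD('p) = (int r + 1 + 2 * int m) + int k" using k m t by simp
    then show ?thesis by (simp only: power_int_add[OF disjI1[OF qroot_nonzero]] power_int_of_nat)
  qed
  then have "bra CARD('p) (\<alpha> * ?q powi (int r + 1 + 2 * int m) * ?q ^ k) = - \<alpha> * bra CARD('p) (?q powi (int (r + m)))"
    using qroot_powi_add_p[OF p, of "int r + int m"] bra_sign[OF \<alpha>] by (simp add: mult.assoc bra_minus)
  also have "bra CARD('p) (?q powi (int (r + m))) = qint CARD('p) (CARD('p) - r - m)"
    using qint_symm[OF p, of "r + m"] m t by (simp add: qint_eq_bra_powi del: power_int_of_nat)
  finally have coeff: "qint CARD('p) (Suc k) * bra CARD('p) (\<alpha> * ?q powi (int r + 1 + 2 * int m) * ?q ^ k)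
      = - (\<alpha> * (qint CARD('p) m * qint CARD('p) (CARD('p) - r - m)))"
    using qint_symm[OF p, of m] m t k by simp
  have F: "genF * (genF ^ (CARD('p) - t - m) * vvec \<alpha> r t) = genF ^ (CARD('p) - t - (m - 1)) * (vvec \<alpha> r t :: 'p uqsl2)"
  proof -
    have "CARD('p) - t - (m - 1) = Suc (CARD('p) - t - m)" using m t by simp
    then show ?thesis by (simp only: power_Suc mult.assoc)
  qed
  have "CARD('p) - Suc m = k" using k by simp
  then show ?thesis
    using genF_genE_power[OF p wt nz, of k] unfolding k coeff F by simp
qed

text \<open>The coefficients \<open>mucoef\<close> are made for this: every summand of F E b_0 is a
  difference of consecutive terms, so the sum telescopes to its first term, which is a_0.\<close>

lemma bvec_0_facts:
  assumes p: "2 \<le> CARD('p::finite)" and \<alpha>: "\<alpha> = 1 \<or> \<alpha> = -1" and t: "1 \<le> t" "t \<le> r" "r < CARD('p)"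
  shows "has_weight (\<alpha> * qroot CARD('p) powi (int r - 1)) (bvec \<alpha> 0 r t :: 'p uqsl2)"
    and genE_bvec_0: "genE * (bvec \<alpha> 0 r t :: 'p uqsl2)
      = (\<Sum>m = 1..CARD('p) - r. mucoef CARD('p) \<alpha> m r *\<^sub>U
        (genE ^ (CARD('p) - m) * (genF ^ (CARD('p) - t - m) * vvec \<alpha> r t)))"
    and "genF * (genE * bvec \<alpha> 0 r t) = (avec \<alpha> 0 r t :: 'p uqsl2)"
proof -
  show "has_weight (\<alpha> * qroot CARD('p) powi (int r - 1)) (bvec \<alpha> 0 r t :: 'p uqsl2)"
    unfolding bvec_def mult.assoc power_0 mult_1_left
  proof (intro has_weight_sum has_weight_scale)
    fix m assume "m \<in> {1..CARD('p) - r}"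
    then show "has_weight (\<alpha> * qroot CARD('p) powi (int r - 1))
        (genE ^ (CARD('p) - m - 1) * (genF ^ (CARD('p) - t - m) * (vvec \<alpha> r t :: 'p uqsl2)))"
      by (intro monomial_weight[OF p \<alpha>, where d = 0]) (use t p in \<open>auto simp: of_nat_diff\<close>)
  qed
  show E: "genE * (bvec \<alpha> 0 r t :: 'p uqsl2)
      = (\<Sum>m = 1..CARD('p) - r. mucoef CARD('p) \<alpha> m r *\<^sub>U
        (genE ^ (CARD('p) - m) * (genF ^ (CARD('p) - t - m) * vvec \<alpha> r t)))"
    unfolding bvec_def power_0 mult_1_left sum_distrib_left
  proof (rule sum.cong[OF refl])
    fix m assume "m \<in> {1..CARD('p) - r}"
    then have "CARD('p) - m = Suc (CARD('p) - m - 1)" using t by auto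
    then have "genE ^ (CARD('p) - m) = genE * (genE ^ (CARD('p) - m - 1) :: 'p uqsl2)"
      by (metis power_Suc)
    then show "genE * (mucoef CARD('p) \<alpha> m r *\<^sub>U (genE ^ (CARD('p) - m - 1) * genF ^ (CARD('p) - t - m) * vvec \<alpha> r t))
      = mucoef CARD('p) \<alpha> m r *\<^sub>U (genE ^ (CARD('p) - m) * (genF ^ (CARD('p) - t - m) * (vvec \<alpha> r t :: 'p uqsl2)))"
      by (simp add: mult.assoc)
  qed
  define u :: "nat \<Rightarrow> 'p uqsl2" where
    "u m = genE ^ (CARD('p) - m) * (genF ^ (CARD('p) - t - (m - 1)) * vvec \<alpha> r t)" for m
  \<comment> \<open>The cut-off beyond p - r agrees with the recursion of \<open>mucoef\<close>,
    whose factor [p-r-m] vanishes at m = p - r.\<close>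
  define M where "M m = (if m \<le> CARD('p) - r then mucoef CARD('p) \<alpha> m r else 0)" for m
  have summand: "genF * (mucoef CARD('p) \<alpha> m r *\<^sub>U (genE ^ (CARD('p) - m) * (genF ^ (CARD('p) - t - m) * (vvec \<alpha> r t :: 'p uqsl2))))
      = M m *\<^sub>U u m - M (Suc m) *\<^sub>U u (Suc m)" if m: "m \<in> {1..CARD('p) - r}" for m
  proof -
    have u_Suc: "u (Suc m) = genE ^ (CARD('p) - Suc m) * (genF ^ (CARD('p) - t - m) * vvec \<alpha> r t)"
      by (simp add: u_def)
    have "M (Suc m) = - (mucoef CARD('p) \<alpha> m r * (\<alpha> * (qint CARD('p) m * qint CARD('p) (CARD('p) - r - m))))"
    proof (cases "m < CARD('p) - r")
      case True
      then show ?thesis using mucoef_Suc[of m "CARD('p)" r \<alpha>] m by (simp add: M_def)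
    next
      case False
      then have "CARD('p) - r - m = 0" by simp
      then show ?thesis using False by (simp add: M_def)
    qed
    moreover have "genF * (genE ^ (CARD('p) - m) * (genF ^ (CARD('p) - t - m) * (vvec \<alpha> r t :: 'p uqsl2)))
        = u m + (\<alpha> * (qint CARD('p) m * qint CARD('p) (CARD('p) - r - m))) *\<^sub>U u (Suc m)"
      unfolding u_Suc u_def[of m] by (rule genF_u[OF p \<alpha> t]) (use m in auto)
    moreover have "M m = mucoef CARD('p) \<alpha> m r" using m by (simp add: M_def)
    ultimately show ?thesis
      by (simp only: scaleU_mult_right U.scale_right_distrib U.scale_scale U.scale_minus_left diff_minus_eq_add)
  qed
  have "genF * (genE * bvec \<alpha> 0 r t) = (\<Sum>m = 1..CARD('p) - r. M m *\<^sub>U u m - M (Suc m) *\<^sub>U u (Suc m))"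
    unfolding E sum_distrib_left by (rule sum.cong[OF refl summand])
  also have "\<dots> = M 1 *\<^sub>U u 1 - M (Suc (CARD('p) - r)) *\<^sub>U u (Suc (CARD('p) - r))"
  proof -
    have "(\<Sum>m = 1..n. f m - f (Suc m)) = f 1 - f (Suc n)" for f :: "nat \<Rightarrow> 'p uqsl2" and n
      by (induction n) simp_all
    then show ?thesis .
  qed
  also have "\<dots> = avec \<alpha> 0 r t"
  proof -
    have "Suc 0 \<le> CARD('p) - r" using t by simp
    then show ?thesis using mucoef_1[OF t(3)] by (simp add: M_def u_def avec_def mult.assoc)
  qed
  finally show "genF * (genE * bvec \<alpha> 0 r t) = (avec \<alpha> 0 r t :: 'p uqsl2)" .
qed

text \<open>The sum in the definition of x_k is E b_0, so x_k is a power of E applied to b_0 up to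
  scaling.\<close>

lemma xvec_eq:
  assumes p: "2 \<le> CARD('p::finite)" and \<alpha>: "\<alpha> = 1 \<or> \<alpha> = -1" and t: "1 \<le> t" "t \<le> r" "r < CARD('p)"
    and k: "k < CARD('p) - r"
  obtains c where "c \<noteq> 0" "xvec \<alpha> k r t = c *\<^sub>U (genE ^ (CARD('p) - r - k) * (bvec \<alpha> 0 r t :: 'p uqsl2))"
proof -
  let ?c = "1 / (\<Prod>i = k + 1..CARD('p) - r - 1. - \<alpha> * qint CARD('p) i * qint CARD('p) (CARD('p) - r - i))"
  have "?c \<noteq> 0" using \<alpha> t by (auto simp: qint_nonzero[OF p])
  moreover have "CARD('p) - r - k = Suc (CARD('p) - r - k - 1)" using k by simp
  then have "genE ^ (CARD('p) - r - k) * (bvec \<alpha> 0 r t :: 'p uqsl2)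
      = genE ^ (CARD('p) - r - k - 1) * (genE * bvec \<alpha> 0 r t)"
    by (metis power_Suc2 mult.assoc)
  then have "xvec \<alpha> k r t = ?c *\<^sub>U (genE ^ (CARD('p) - r - k) * (bvec \<alpha> 0 r t :: 'p uqsl2))"
    unfolding xvec_def genE_bvec_0[OF p \<alpha> t] by (simp add: mult.assoc)
  ultimately show ?thesis using that by blast
qed

lemma basis_right_weight:
  fixes r t :: nat
  assumes p: "2 \<le> CARD('p::finite)" and \<alpha>: "\<alpha> = 1 \<or> \<alpha> = -1"
  defines "c \<equiv> \<alpha> * qroot CARD('p) powi (int r - 2 * int t + 1)"
  shows "avec \<alpha> n r t * genK = c *\<^sub>U (avec \<alpha> n r t :: 'p uqsl2)"
    and "bvec \<alpha> n r t * genK = c *\<^sub>U (bvec \<alpha> n r t :: 'p uqsl2)"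
    and "xvec \<alpha> n r t * genK = c *\<^sub>U (xvec \<alpha> n r t :: 'p uqsl2)"
    and "yvec \<alpha> n r t * genK = c *\<^sub>U (yvec \<alpha> n r t :: 'p uqsl2)"
  unfolding avec_def bvec_def xvec_def yvec_def
  by (simp_all add: mult.assoc sum_distrib_left sum_distrib_right vvec_genK(2)[OF p \<alpha>] U.scale_sum_right
      c_def mult.commute mult.left_commute)

section \<open>Values of tau on a, b, x, y\<close>

lemma tau_avec:
  assumes p: "2 \<le> CARD('p::finite)" and t: "1 \<le> t" "t \<le> CARD('p)"
  shows "tau (avec \<alpha> n r t :: 'p uqsl2) = of_bool (n = t - 1)"
proof -
  have "tau (genF ^ n * (genE ^ (CARD('p) - 1) * (genF ^ (CARD('p) - t) * vvec \<alpha> r t)) :: 'p uqsl2) = of_bool (n = t - 1)"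
    by (subst tau_F_E_F_vvec[OF p]) (use t in auto)
  then show ?thesis by (simp add: avec_def mult.assoc)
qed

lemma tau_bvec:
  assumes p: "2 \<le> CARD('p::finite)"
  shows "tau (bvec \<alpha> n r t :: 'p uqsl2) = 0"
  unfolding bvec_def sum_distrib_left tau_sum
  by (rule sum.neutral) (use p in \<open>auto simp: tau_scale mult.assoc tau_F_E_F_vvec\<close>)

lemma tau_yvec:
  assumes p: "2 \<le> CARD('p::finite)"
  shows "tau (yvec \<alpha> k r t :: 'p uqsl2) = 0"
  using tau_bvec[OF p] unfolding yvec_def by (metis bvec_eq)

lemma tau_xvec:
  assumes p: "2 \<le> CARD('p::finite)" and t: "1 \<le> t"
  shows "tau (xvec \<alpha> k r t :: 'p uqsl2) = 0"
proof -
  have "tau (genE ^ n * (mucoef CARD('p) \<alpha> m r *\<^sub>U (genE ^ (CARD('p) - m) * genF ^ (CARD('p) - t - m) * vvec \<alpha> r t)) :: 'p uqsl2) = 0"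
    if "1 \<le> m" for n m
    using that p t by (simp add: tau_scale mult.assoc tau_E_E_F_vvec)
  then show ?thesis
    unfolding xvec_def sum_distrib_left tau_scale tau_sum by (simp add: sum.neutral)
qed

section \<open>Separating eigenspaces\<close>

text \<open>Induction on S: a power of L (c i) kills the summand g i and preserves the other
  generalised eigenspaces, on which it is injective. Applied to the Casimir element and, with
  exponent 1, to both multiplications by K.\<close>

lemma generalized_eigenvectors_independent:
  fixes D :: "'p::finite uqsl2 \<Rightarrow> 'p uqsl2" and c :: "'i \<Rightarrow> complex"
  assumes add: "\<And>x y. D (x + y) = D x + D y" and scale: "\<And>a x. D (a *\<^sub>U x) = a *\<^sub>U D x"
    and S: "finite S" "inj_on c S"
    and eig: "\<And>i. i \<in> S \<Longrightarrow> \<exists>n. ((\<lambda>x. D x - c i *\<^sub>U x) ^^ n) (g i) = 0"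
    and sum: "sum g S = 0"
  shows "\<forall>i\<in>S. g i = 0"
proof -
  define L where "L = (\<lambda>a x. D x - a *\<^sub>U x)"
  have D0: "D 0 = 0" using scale[of 0 0] by simp
  have L_add: "L a (x + y) = L a x + L a y" for a x y
    by (simp add: L_def add U.scale_right_distrib)
  have L_scale: "L a (b *\<^sub>U x) = b *\<^sub>U L a x" for a b x
    by (simp add: L_def scale U.scale_right_diff_distrib mult.commute)
  have D_diff: "D (x - y) = D x - D y" for x y
    using add[of "x - y" y] by simp
  have comm: "L a (L b x) = L b (L a x)" for a b x
    by (simp add: L_def D_diff scale U.scale_right_diff_distrib mult.commute)
  have pow_0: "(L a ^^ n) 0 = 0" for a n
    by (induction n) (simp_all add: L_def D0)
  have pow_add: "(L a ^^ n) (x + y) = (L a ^^ n) x + (L a ^^ n) y" for a n x y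
    by (induction n) (simp_all add: L_add)
  have pow_sum: "(L a ^^ n) (sum f T) = (\<Sum>i\<in>T. (L a ^^ n) (f i))" if "finite T" for a n T and f :: "'i \<Rightarrow> 'p uqsl2"
    using that by induction (simp_all add: pow_0 pow_add)
  have comm1: "(L a ^^ n) (L b x) = L b ((L a ^^ n) x)" for a b n x
    by (induction n) (simp_all add: comm)
  have comm2: "(L a ^^ n) ((L b ^^ m) x) = (L b ^^ m) ((L a ^^ n) x)" for a b n m x
    by (induction m) (simp_all add: comm1)
  \<comment> \<open>Induction on m reduces to L a x = 0, where L b is multiplication by the nonzero
    scalar a - b and hence not nilpotent unless x = 0.\<close>
  have coprime: "x = 0" if "(L a ^^ m) x = 0" "(L b ^^ n) x = 0" "a \<noteq> b" for a b m n x
    using that(1,2)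
  proof (induction m arbitrary: x)
    case (Suc m)
    have "(L a ^^ m) (L a x) = 0" using Suc.prems(1) by (simp add: funpow_swap1)
    moreover have "(L b ^^ n) (L a x) = 0"
      by (simp add: comm1 Suc.prems(2)) (simp add: L_def D0)
    ultimately have "L a x = 0" by (rule Suc.IH)
    then have "L b x = (a - b) *\<^sub>U x" by (simp add: L_def U.scale_left_diff_distrib)
    then have "(L b ^^ k) x = (a - b) ^ k *\<^sub>U x" for k
      by (induction k) (simp_all add: L_scale mult.commute)
    then show ?case using Suc.prems(2) that(3) by simp
  qed simp
  have "\<forall>i\<in>S. g i = 0"
    if "finite S" "inj_on c S" "\<And>i. i \<in> S \<Longrightarrow> \<exists>n. (L (c i) ^^ n) (g i) = 0" "sum g S = 0" for S and g :: "'i \<Rightarrow> 'p uqsl2"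
    using that
  proof (induction S arbitrary: g rule: finite_induct)
    case (insert i S)
    obtain n where n: "(L (c i) ^^ n) (g i) = 0" using insert.prems(2) by blast
    have gi: "g i + sum g S = 0" using insert.prems(3) insert.hyps by simp
    have "(L (c i) ^^ n) (g i + sum g S) = 0" unfolding gi by (rule pow_0)
    then have sum0: "(\<Sum>j\<in>S. (L (c i) ^^ n) (g j)) = 0"
      using insert.hyps by (simp add: pow_add pow_sum n)
    have ex: "\<exists>m. (L (c j) ^^ m) ((L (c i) ^^ n) (g j)) = 0" if "j \<in> S" for j
      using insert.prems(2)[of j] that by (metis comm2 insert_iff pow_0)
    have zero: "\<forall>j\<in>S. (L (c i) ^^ n) (g j) = 0"
      by (rule insert.IH) (use insert.prems(1) ex sum0 in auto)
    have "g j = 0" if j: "j \<in> S" for j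
    proof -
      obtain m where "(L (c j) ^^ m) (g j) = 0" using insert.prems(2)[of j] j by blast
      moreover have "c i \<noteq> c j" using insert.prems(1) insert.hyps(2) j by auto
      ultimately show ?thesis using coprime zero j by blast
    qed
    then show ?case using gi by simp
  qed simp
  then show ?thesis using S eig sum unfolding L_def by blast
qed

text \<open>Passes from an indexed family to the set of its values; a coincidence f i = f j would be
  the relation with coefficients 1 and -1.\<close>

lemma linear_family_independent:
  fixes f :: "'i \<Rightarrow> 'p::finite uqsl2"
  assumes "finite J" and indep: "\<And>g. (\<Sum>j\<in>J. g j *\<^sub>U f j) = 0 \<Longrightarrow> \<forall>j\<in>J. g j = 0"
  shows "inj_on f J" "U.independent (f ` J)"
proof -
  show inj: "inj_on f J"
  proof (rule inj_onI, rule ccontr)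
    fix i j assume ij: "i \<in> J" "j \<in> J" "f i = f j" "i \<noteq> j"
    define g where "g k = (if k = i then 1 else 0) - (if k = j then 1 else 0 :: complex)" for k
    have "(\<Sum>k\<in>J. g k *\<^sub>U f k) = (\<Sum>k\<in>J. (if k = i then f k else 0) - (if k = j then f k else 0))"
      by (rule sum.cong) (auto simp: g_def)
    also have "\<dots> = 0" using assms(1) ij by (simp add: sum_subtractf)
    finally have "g i = 0" using indep ij(1) by blast
    then show False using ij by (simp add: g_def)
  qed
  show "U.independent (f ` J)"
  proof
    assume "U.dependent (f ` J)"
    then obtain u where u: "\<exists>v\<in>f ` J. u v \<noteq> 0" "(\<Sum>v\<in>f ` J. u v *\<^sub>U v) = 0"
      using U.dependent_finite[of "f ` J"] assms(1) by auto
    have "(\<Sum>j\<in>J. u (f j) *\<^sub>U f j) = 0" using u(2) by (simp add: sum.reindex[OF inj])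
    then show False using indep[of "\<lambda>j. u (f j)"] u(1) by blast
  qed
qed


section \<open>The basis of the algebra\<close>

text \<open>In the block \<open>Q\<^sub>s\<close> the two signs are merged: \<open>T = t\<close> for \<open>\<alpha> = 1\<close> and \<open>T = s + u\<close> for
  \<open>\<alpha> = -1\<close>, so that \<open>1 \<le> T \<le> p\<close> determines the right weight \<open>q\<^sup>s\<^sup>+\<^sup>1\<^sup>-\<^sup>2\<^sup>T\<close>.  Likewise \<open>N = n\<close> for the
  elements \<open>A\<^sub>n\<close>, \<open>B\<^sub>n\<close> and \<open>N = r + k\<close> for \<open>X\<^sub>k\<close>, \<open>Y\<^sub>k\<close>, so that \<open>N < p\<close> determines the left weight.
  Each pair of weights then occurs twice in \<open>Q\<^sub>s\<close>, and once in \<open>Q\<^sub>0\<close> and in \<open>Q\<^sub>p\<close>.\<close>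

definition sg :: "nat \<Rightarrow> nat \<Rightarrow> complex" where
  "sg s T = (if T \<le> s then 1 else -1)"

definition rk :: "nat \<Rightarrow> nat \<Rightarrow> nat \<Rightarrow> nat" where
  "rk p s T = (if T \<le> s then s else p - s)"

definition ix :: "nat \<Rightarrow> nat \<Rightarrow> nat" where
  "ix s T = (if T \<le> s then T else T - s)"

text \<open>The flag e separates the two elements sharing a pair of weights: True for B and Y, False
  for A and X. In the end blocks r = p, so only the A with flag False occur.\<close>

definition fam :: "nat \<Rightarrow> nat \<times> nat \<times> bool \<Rightarrow> 'p::finite uqsl2" where
  "fam s = (\<lambda>(T, N, e). let \<alpha> = sg s T; r = rk CARD('p) s T; t = ix s T in
     if N < r then (if e then Bb s \<alpha> N r t else Ab s \<alpha> N r t)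
     else (if e then Yb s \<alpha> (N - r) r t else Xb s \<alpha> (N - r) r t))"

definition fam_index :: "nat \<Rightarrow> nat \<Rightarrow> (nat \<times> nat \<times> bool) set" where
  "fam_index p s = {1..p} \<times> {..<p} \<times> (if 0 < s \<and> s < p then UNIV else {False})"

lemma finite_fam_index [simp]: "finite (fam_index p s)"
  by (simp add: fam_index_def)

lemma sg_cases: "sg s T = 1 \<or> sg s T = -1"
  by (simp add: sg_def)

lemma ix_bounds:
  assumes "s \<le> p" "1 \<le> T" "T \<le> p"
  shows "1 \<le> ix s T" "ix s T \<le> rk p s T" "rk p s T \<le> p" "0 < rk p s T"
    and "0 < s \<Longrightarrow> s < p \<Longrightarrow> rk p s T < p" and "s = 0 \<or> s = p \<Longrightarrow> rk p s T = p"
  using assms by (auto simp: ix_def rk_def)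

text \<open>Both signs share one eigenvalue: for \<alpha> = -1 the number q c is -q^(p-s) = q^(-s),
  and \<open>casimir_eig\<close> is symmetric under inversion.\<close>

lemma casimir_eig_eq:
  fixes s T :: nat
  assumes "p \<ge> 2" "s \<le> p"
  defines "c \<equiv> sg s T * qroot p powi (int (rk p s T) - 1)"
  shows "(qroot p * c + inverse (qroot p * c)) / (qroot p - inverse (qroot p))\<^sup>2 = casimir_eig p s"
proof -
  have "qroot p * c = sg s T * qroot p powi int (rk p s T)"
    by (simp add: c_def power_int_diff)
  also have "\<dots> = (if T \<le> s then qroot p ^ s else inverse (qroot p) ^ s)"
  proof -
    have e: "- int s + int p = int (p - s)" using assms(2) by simp
    have "qroot p ^ (p - s) = - inverse (qroot p ^ s)"
      using qroot_powi_add_p[OF assms(1), of "- int s"] unfolding e power_int_minus power_int_of_nat .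
    then show ?thesis by (auto simp: sg_def rk_def power_inverse)
  qed
  finally show ?thesis by (auto simp: casimir_eig_def power_inverse)
qed

definition cas :: "nat \<Rightarrow> 'p::finite uqsl2" where
  "cas s = casimir - casimir_eig CARD('p) s *\<^sub>U 1"

lemma cas_power_commute:
  assumes "2 \<le> CARD('p::finite)"
  shows "cas s * (genE ^ n * x) = genE ^ n * (cas s * x :: 'p uqsl2)"
    and "cas s * (genF ^ n * x) = genF ^ n * (cas s * x :: 'p uqsl2)"
  using casimir_genE_power[OF assms] casimir_genF_power[OF assms]
  by (simp_all add: cas_def left_diff_distrib right_diff_distrib)

context
  fixes s T :: nat
  assumes p: "2 \<le> CARD('p::finite)" and sT: "s \<le> CARD('p)" "1 \<le> T" "T \<le> CARD('p)"
begin

abbreviation (input) "a0 \<equiv> avec (sg s T) 0 (rk CARD('p) s T) (ix s T) :: 'p uqsl2"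
abbreviation (input) "b0 \<equiv> bvec (sg s T) 0 (rk CARD('p) s T) (ix s T) :: 'p uqsl2"

lemmas ixb = ix_bounds[OF sT]
lemmas a0_facts = avec_0_facts[OF p sg_cases[of s T] ixb(1-3)]
lemmas b0_facts = bvec_0_facts[OF p sg_cases[of s T] ixb(1,2) ixb(5)]

lemma top_nonzero: "sg s T * qroot CARD('p) powi (int (rk CARD('p) s T) - 1) \<noteq> 0"
  using sg_cases[of s T] by auto

lemma cas_a0: "cas s * a0 = 0"
  using casimir_weight[OF p a0_facts(1) top_nonzero] a0_facts(2)
  unfolding casimir_eig_eq[OF p sT(1)] by (simp add: cas_def left_diff_distrib)

lemma cas_b0: "0 < s \<Longrightarrow> s < CARD('p) \<Longrightarrow> cas s * b0 = a0"
  using casimir_weight[OF p b0_facts(1) top_nonzero] b0_facts(3)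
  unfolding casimir_eig_eq[OF p sT(1)] by (simp add: cas_def left_diff_distrib)

text \<open>Reduces every element to powers of E and F on a_0 and b_0. With N = r + k the exponent p
  - r - k of E is p - N, and c absorbs the normalisation of x_k.\<close>

lemma fam_cases [consumes 1, case_names A B X Y]:
  assumes "(T, N, e) \<in> fam_index CARD('p) s"
  obtains
    "N < rk CARD('p) s T" "\<not> e" "fam s (T, N, e) = (1 / gam CARD('p) s) *\<^sub>U (genF ^ N * a0)"
  | "0 < s" "s < CARD('p)" "N < rk CARD('p) s T" "e" "fam s (T, N, e) = (1 / gam CARD('p) s) *\<^sub>U
      (genF ^ N * b0 - (del CARD('p) s / gam CARD('p) s) *\<^sub>U (genF ^ N * a0))"
  | c where "0 < s" "s < CARD('p)" "rk CARD('p) s T \<le> N" "N < CARD('p)" "\<not> e" "c \<noteq> 0"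
      "fam s (T, N, e) = c *\<^sub>U (genE ^ (CARD('p) - N) * b0)"
  | "0 < s" "s < CARD('p)" "rk CARD('p) s T \<le> N" "N < CARD('p)" "e"
      "fam s (T, N, e) = (1 / gam CARD('p) s) *\<^sub>U (genF ^ N * b0)"
proof (cases "N < rk CARD('p) s T")
  case True
  show ?thesis
  proof (cases e)
    case e: True
    then have "0 < s" "s < CARD('p)" using assms by (auto simp: fam_index_def split: if_splits)
    then show ?thesis
      using e True that(2) by (simp add: fam_def Let_def Bb_def avec_eq[of _ N] bvec_eq[of _ N])
  next
    case False
    then show ?thesis using True that(1) by (simp add: fam_def Let_def Ab_def avec_eq[of _ N])
  qed
next
  case False
  have N: "N < CARD('p)" using assms by (simp add: fam_index_def)
  then have s: "0 < s" "s < CARD('p)" using ixb(6) sT(1) False by force+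
  show ?thesis
  proof (cases e)
    case True
    then show ?thesis
      using False N s that(4) by (simp add: fam_def Let_def Yb_def yvec_def)
  next
    case e: False
    have "N - rk CARD('p) s T < CARD('p) - rk CARD('p) s T" using N False by simp
    then obtain c where c: "c \<noteq> 0" "xvec (sg s T) (N - rk CARD('p) s T) (rk CARD('p) s T) (ix s T)
        = c *\<^sub>U (genE ^ (CARD('p) - rk CARD('p) s T - (N - rk CARD('p) s T)) * b0)"
      using xvec_eq[OF p sg_cases[of s T] ixb(1,2) ixb(5)[OF s]] by blast
    have "CARD('p) - rk CARD('p) s T - (N - rk CARD('p) s T) = CARD('p) - N" using N False by simp
    then have "fam s (T, N, e) = (1 / gam CARD('p) s * c) *\<^sub>U (genE ^ (CARD('p) - N) * b0)"
      using e False c(2) by (simp add: fam_def Let_def Xb_def)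
    moreover have "1 / gam CARD('p) s * c \<noteq> 0" using c(1) gam_nonzero[OF p sT(1)] by simp
    ultimately show ?thesis using False N s e that(3)[of "1 / gam CARD('p) s * c"] by auto
  qed
qed

lemma cas_fam:
  assumes "(T, N, e) \<in> fam_index CARD('p) s"
  shows "(cas s)\<^sup>2 * (fam s (T, N, e) :: 'p uqsl2) = 0"
  using assms
  by (cases rule: fam_cases)
    (simp_all add: power2_eq_square mult.assoc right_diff_distrib cas_power_commute[OF p] cas_a0 cas_b0)

lemma fam_left_weight:
  assumes "(T, N, e) \<in> fam_index CARD('p) s"
  shows "has_weight (sg s T * qroot CARD('p) powi (int (rk CARD('p) s T) - 1) * inverse ((qroot CARD('p))\<^sup>2) ^ N) (fam s (T, N, e) :: 'p uqsl2)"
  using assms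
proof (cases rule: fam_cases)
  case (X c)
  \<comment> \<open>q^(2p) = 1 gives E^(p-N) b_0 the left weight of F^N b_0, so X and Y may share
    the index N.\<close>
  have "((qroot CARD('p))\<^sup>2) ^ (CARD('p) - N) * ((qroot CARD('p))\<^sup>2) ^ N = 1"
  proof -
    have "(qroot CARD('p))\<^sup>2 ^ CARD('p) = 1" using qroot_pow_2p[OF p] by (simp add: power_mult)
    then show ?thesis using X(4) by (simp flip: power_add)
  qed
  then have "((qroot CARD('p))\<^sup>2) ^ (CARD('p) - N) = inverse ((qroot CARD('p))\<^sup>2) ^ N"
    by (simp add: power_inverse field_simps)
  then show ?thesis
    using has_weight_E_power[OF b0_facts(1)[OF X(1,2)], of "CARD('p) - N"] X(7) by (simp add: has_weight_scale)
qed (auto intro!: has_weight_scale has_weight_diff has_weight_F_power a0_facts b0_facts)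

lemma fam_right_weight:
  "fam s (T, N, e) * genK = (qroot CARD('p) powi (int s + 1 - 2 * int T)) *\<^sub>U (fam s (T, N, e) :: 'p uqsl2)"
proof -
  \<comment> \<open>For \<alpha> = -1 the sign is q^p, which brings r = p - s and t = T - s to the
    common exponent s + 1 - 2 T modulo 2p.\<close>
  have c: "sg s T * qroot CARD('p) powi (int (rk CARD('p) s T) - 2 * int (ix s T) + 1)
      = qroot CARD('p) powi (int s + 1 - 2 * int T)"
  proof (cases "T \<le> s")
    case False
    then have "int (rk CARD('p) s T) - 2 * int (ix s T) + 1 = (int s + 1 - 2 * int T) + int CARD('p)"
      using sT by (simp add: rk_def ix_def of_nat_diff)
    then show ?thesis using False by (simp only: sg_def qroot_powi_add_p[OF p]) simp
  qed (simp add: sg_def rk_def ix_def algebra_simps)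
  define \<kappa> where "\<kappa> = qroot CARD('p) powi (int s + 1 - 2 * int T)"
  note right = basis_right_weight[OF p sg_cases[of s T], where r = "rk CARD('p) s T" and t = "ix s T",
      unfolded c, folded \<kappa>_def]
  show ?thesis
    unfolding fam_def Let_def Ab_def Bb_def Xb_def Yb_def \<kappa>_def[symmetric]
    by (simp add: right left_diff_distrib U.scale_right_diff_distrib mult.commute mult.left_commute)
qed

text \<open>The coefficients of the theorem originate here. For N at least r the value is 0 on X and
  Y, consistently with N = t - 1 being impossible because t is at most r.\<close>

lemma tau_fam:
  "tau (fam s (T, N, e) :: 'p uqsl2)
    = of_bool (N = ix s T - 1) * (if e then - del CARD('p) s / (gam CARD('p) s)\<^sup>2 else 1 / gam CARD('p) s)"
proof -
  have "ix s T \<le> CARD('p)" using ixb(2,3) by simp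
  note ta = tau_avec[OF p ixb(1) this]
  have "\<not> N < rk CARD('p) s T \<Longrightarrow> N \<noteq> ix s T - 1" using ixb(2,4) by linarith
  then show ?thesis
    by (auto simp: fam_def Let_def Ab_def Bb_def Xb_def Yb_def tau_scale tau_diff ta tau_bvec[OF p]
        tau_xvec[OF p ixb(1)] tau_yvec[OF p] power2_eq_square)
qed

text \<open>E^N brings both vectors back to a_0 and b_0 with the same nonzero factor, up to a
  multiple of a_0 added to the second. Then F E kills a_0 and sends b_0 to a_0, which isolates
  y.\<close>

lemma ab_independent:
  assumes s: "0 < s" "s < CARD('p)" and N: "N < rk CARD('p) s T"
    and eq: "x *\<^sub>U (genF ^ N * a0) + y *\<^sub>U (genF ^ N * b0) = 0"
  shows "x = 0 \<and> y = 0"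
proof -
  define P where "P = (\<Prod>i = 1..N. hw CARD('p) (sg s T) (rk CARD('p) s T) i)"
  have "hw CARD('p) (sg s T) (rk CARD('p) s T) i \<noteq> 0" if "i \<in> {1..N}" for i
    using N that ixb by (intro hw_nonzero p sg_cases[of s T]) auto
  then have P: "P \<noteq> 0" by (simp add: P_def)
  obtain c where c: "genE ^ N * (genF ^ N * b0) = P *\<^sub>U b0 + c *\<^sub>U a0"
    using string_b(2)[OF p a0_facts(1) b0_facts(1)[OF s] sg_cases[of s T] a0_facts(2) b0_facts(3)[OF s]]
    unfolding P_def by blast
  have a: "genE ^ N * (genF ^ N * a0) = P *\<^sub>U a0"
    unfolding P_def by (rule string_a[OF p a0_facts(1) sg_cases[of s T] a0_facts(2)])
  have "genF * (genE * (genE ^ N * (x *\<^sub>U (genF ^ N * a0) + y *\<^sub>U (genF ^ N * b0)))) = (y * P) *\<^sub>U a0"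
    by (simp add: distrib_left a c U.scale_right_distrib a0_facts(2) b0_facts(3)[OF s])
  then have y: "y = 0" using eq P a0_facts(3) by simp
  have "genE ^ N * (x *\<^sub>U (genF ^ N * a0) + y *\<^sub>U (genF ^ N * b0)) = (x * P) *\<^sub>U a0" by (simp add: a y)
  then show ?thesis using y P a0_facts(3) unfolding eq by simp
qed

text \<open>F^(p-N) kills F^N b_0 since F^p = 0, but takes E^(p-N) b_0 to a nonzero multiple of a_0;
  this isolates x. Then E^N detects y.\<close>

lemma xy_independent:
  assumes s: "0 < s" "s < CARD('p)" and N: "rk CARD('p) s T \<le> N" "N < CARD('p)"
    and eq: "x *\<^sub>U (genE ^ (CARD('p) - N) * b0) + y *\<^sub>U (genF ^ N * b0) = 0"
  shows "x = 0 \<and> y = 0"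
proof -
  obtain n where n: "CARD('p) - N = Suc n" using N(2) by (cases "CARD('p) - N") auto
  have "rk CARD('p) s T + Suc n \<le> CARD('p)" using N n by simp
  then obtain c where c: "c \<noteq> 0" "genF ^ (CARD('p) - N) * (genE ^ (CARD('p) - N) * b0) = c *\<^sub>U a0"
    using string_x[OF p b0_facts(1)[OF s] sg_cases[of s T] a0_facts(2) b0_facts(3)[OF s] _ ixb(4)] unfolding n by blast
  have "genF ^ (CARD('p) - N) * genF ^ N = (genF ^ CARD('p) :: 'p uqsl2)"
    using N by (simp flip: power_add)
  then have "genF ^ (CARD('p) - N) * (genF ^ N * b0) = 0"
    by (simp add: uqsl2_relations flip: mult.assoc)
  then have "genF ^ (CARD('p) - N) * (x *\<^sub>U (genE ^ (CARD('p) - N) * b0) + y *\<^sub>U (genF ^ N * b0)) = (x * c) *\<^sub>U a0"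
    by (simp add: distrib_left c)
  then have x: "x = 0" using eq c(1) a0_facts(3) by simp
  obtain d where d: "d \<noteq> 0" "genE ^ N * (genF ^ N * b0) = d *\<^sub>U a0"
    using string_b(3)[OF p a0_facts(1) b0_facts(1)[OF s] sg_cases[of s T] a0_facts(2) b0_facts(3)[OF s] ixb(4) N ixb(5)[OF s]]
    by blast
  have "genE ^ N * (x *\<^sub>U (genE ^ (CARD('p) - N) * b0) + y *\<^sub>U (genF ^ N * b0)) = (y * d) *\<^sub>U a0"
    by (simp add: d x)
  then show ?thesis using x d(1) a0_facts(3) unfolding eq by simp
qed

lemma fam_pair_independent:
  assumes s: "0 < s" "s < CARD('p)" and N: "N < CARD('p)"
    and eq: "x *\<^sub>U fam s (T, N, False) + y *\<^sub>U fam s (T, N, True) = (0 :: 'p uqsl2)"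
  shows "x = 0 \<and> y = 0"
proof -
  define g d where "g = gam CARD('p) s" and "d = del CARD('p) s"
  have g: "g \<noteq> 0" unfolding g_def by (rule gam_nonzero[OF p sT(1)])
  have mem: "(T, N, e) \<in> fam_index CARD('p) s" for e
    using s N sT by (simp add: fam_index_def)
  show ?thesis
  proof (cases "N < rk CARD('p) s T")
    case True
    have A: "fam s (T, N, False) = (1 / g) *\<^sub>U (genF ^ N * a0)"
      by (cases rule: fam_cases[OF mem[of False]]) (use True in \<open>auto simp: g_def\<close>)
    have B: "fam s (T, N, True) = (1 / g) *\<^sub>U (genF ^ N * b0 - (d / g) *\<^sub>U (genF ^ N * a0))"
      by (cases rule: fam_cases[OF mem[of True]]) (use True in \<open>auto simp: g_def d_def\<close>)
    have "(x / g - y / g * (d / g)) *\<^sub>U (genF ^ N * a0) + (y / g) *\<^sub>U (genF ^ N * b0) = 0"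
      using eq unfolding A B by (simp add: U.scale_left_diff_distrib U.scale_right_diff_distrib algebra_simps)
    from ab_independent[OF s True this] show ?thesis using g by auto
  next
    case False
    obtain c where c: "c \<noteq> 0" "fam s (T, N, False) = c *\<^sub>U (genE ^ (CARD('p) - N) * b0)"
      by (cases rule: fam_cases[OF mem[of False]]) (use False in auto)
    have Y: "fam s (T, N, True) = (1 / g) *\<^sub>U (genF ^ N * b0)"
      by (cases rule: fam_cases[OF mem[of True]]) (use False in \<open>auto simp: g_def\<close>)
    have "(x * c) *\<^sub>U (genE ^ (CARD('p) - N) * b0) + (y / g) *\<^sub>U (genF ^ N * b0) = 0"
      using eq unfolding c(2) Y by simp
    from xy_independent[OF s _ N this] show ?thesis using g c(1) False by auto
  qed
qed

text \<open>Here r = p, so no \<open>hw\<close> with index below p vanishes and E^N recovers a_0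
  from F^N a_0.\<close>

lemma fam_end_nonzero:
  assumes s: "\<not> (0 < s \<and> s < CARD('p))" and N: "N < CARD('p)"
  shows "(fam s (T, N, False) :: 'p uqsl2) \<noteq> 0"
proof -
  have mem: "(T, N, False) \<in> fam_index CARD('p) s"
    using N sT by (simp add: fam_index_def)
  have rk: "rk CARD('p) s T = CARD('p)" using s sT(1) ixb(6) by auto
  have f: "fam s (T, N, False) = (1 / gam CARD('p) s) *\<^sub>U (genF ^ N * a0)"
    by (cases rule: fam_cases[OF mem]) (use rk s in auto)
  have "hw CARD('p) (sg s T) (rk CARD('p) s T) i \<noteq> 0" if "i \<in> {1..N}" for i
    using N that ixb rk by (intro hw_nonzero p sg_cases[of s T]) auto
  then have "genE ^ N * (genF ^ N * a0) \<noteq> 0"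
    unfolding string_a[OF p a0_facts(1) sg_cases[of s T] a0_facts(2)] using a0_facts(3) by simp
  then have "genF ^ N * a0 \<noteq> 0" by auto
  then show ?thesis unfolding f using gam_nonzero[OF p sT(1)] by simp
qed

end

lemma fam_block_independent:
  assumes p: "2 \<le> CARD('p::finite)" and s: "s \<le> CARD('p)"
    and eq: "(\<Sum>i\<in>fam_index CARD('p) s. g i *\<^sub>U (fam s i :: 'p uqsl2)) = 0"
  shows "\<forall>i\<in>fam_index CARD('p) s. g i = 0"
proof -
  let ?q = "qroot CARD('p)"
  define R :: "bool set" where "R = (if 0 < s \<and> s < CARD('p) then UNIV else {False})"
  define h :: "nat \<Rightarrow> nat \<Rightarrow> 'p uqsl2" where
    "h T N = (\<Sum>e\<in>R. g (T, N, e) *\<^sub>U fam s (T, N, e))" for T N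
  have index: "fam_index CARD('p) s = {1..CARD('p)} \<times> {..<CARD('p)} \<times> R"
    by (simp add: fam_index_def R_def)
  have "(\<Sum>T\<in>{1..CARD('p)}. \<Sum>N<CARD('p). h T N) = 0"
    using eq unfolding index h_def by (simp add: sum.cartesian_product)
  moreover have "inj_on (\<lambda>T. ?q powi (int s + 1 - 2 * int T)) {1..CARD('p)}"
  proof
    fix T T' assume T: "T \<in> {1..CARD('p)}" "T' \<in> {1..CARD('p)}"
      and "?q powi (int s + 1 - 2 * int T) = ?q powi (int s + 1 - 2 * int T')"
    then show "T = T'" by (intro qroot_powi_shift_inj[OF p]) auto
  qed
  moreover have "(\<Sum>N<CARD('p). h T N) * genK = (?q powi (int s + 1 - 2 * int T)) *\<^sub>U (\<Sum>N<CARD('p). h T N)"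
    if "T \<in> {1..CARD('p)}" for T
    using that unfolding h_def sum_distrib_right U.scale_sum_right
    by (intro sum.cong refl) (simp add: fam_right_weight[OF p s] mult.commute)
  ultimately have T: "\<forall>T\<in>{1..CARD('p)}. (\<Sum>N<CARD('p). h T N) = 0"
    by (intro generalized_eigenvectors_independent[where D = "\<lambda>x. x * genK"
        and c = "\<lambda>T. ?q powi (int s + 1 - 2 * int T)"])
      (auto simp: distrib_right intro!: exI[of _ "1 :: nat"])
  have N: "h T N = 0" if T1: "T \<in> {1..CARD('p)}" and "N < CARD('p)" for T N
  proof -
    define \<kappa> where "\<kappa> = sg s T * ?q powi (int (rk CARD('p) s T) - 1)"
    have "\<kappa> \<noteq> 0" using sg_cases[of s T] by (auto simp: \<kappa>_def)
    have "inj_on (\<lambda>N. \<kappa> * inverse (?q\<^sup>2) ^ N) {..<CARD('p)}"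
    proof
      fix N N' assume N: "N \<in> {..<CARD('p)}" "N' \<in> {..<CARD('p)}"
        and "\<kappa> * inverse (?q\<^sup>2) ^ N = \<kappa> * inverse (?q\<^sup>2) ^ N'"
      then have "?q\<^sup>2 ^ N = ?q\<^sup>2 ^ N'" using \<open>\<kappa> \<noteq> 0\<close> by (simp add: power_inverse)
      then have "?q powi int (2 * N) = ?q powi int (2 * N')"
        unfolding power_int_of_nat by (simp add: power_mult)
      then have "?q powi (0 - 2 * int N) = ?q powi (0 - 2 * int N')"
        by (simp add: power_int_minus)
      then show "N = N'" by (rule qroot_powi_shift_inj[OF p]) (use N in auto)
    qed
    moreover have "has_weight (\<kappa> * inverse (?q\<^sup>2) ^ N) (h T N)" if "N < CARD('p)" for N
      unfolding h_def \<kappa>_def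
      by (intro has_weight_sum has_weight_scale fam_left_weight[OF p s])
        (use T1 that in \<open>auto simp: index\<close>)
    ultimately have "\<forall>N\<in>{..<CARD('p)}. h T N = 0"
      using T T1
      by (intro generalized_eigenvectors_independent[where D = "\<lambda>x. genK * x"
          and c = "\<lambda>N. \<kappa> * inverse (?q\<^sup>2) ^ N"])
        (auto simp: distrib_left has_weight_def intro!: exI[of _ "1 :: nat"])
    then show ?thesis using that by simp
  qed
  show ?thesis
  proof
    fix i assume i: "i \<in> fam_index CARD('p) s"
    obtain T N e where i_eq: "i = (T, N, e)" by (cases i)
    have TN: "1 \<le> T" "T \<le> CARD('p)" "N < CARD('p)" and e: "e \<in> R" using i by (auto simp: i_eq index)
    have h0: "h T N = 0" using N TN by simp
    show "g i = 0"
    proof (cases "0 < s \<and> s < CARD('p)")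
      case True
      then have "g (T, N, False) *\<^sub>U fam s (T, N, False) + g (T, N, True) *\<^sub>U (fam s (T, N, True) :: 'p uqsl2) = 0"
        using h0 by (simp add: h_def R_def UNIV_bool add.commute)
      then show ?thesis
        using fam_pair_independent[OF p s TN(1,2), of N "g (T, N, False)" "g (T, N, True)"] True TN
        by (cases e) (auto simp: i_eq)
    next
      case False
      then show ?thesis
        using h0 e fam_end_nonzero[OF p s TN(1,2) False TN(3)] by (auto simp: h_def R_def i_eq)
    qed
  qed
qed

section \<open>From one block to the whole algebra\<close>

lemma cas_funpow: "((\<lambda>x. casimir * x - casimir_eig CARD('p) s *\<^sub>U x) ^^ n) x = cas s ^ n * (x :: 'p::finite uqsl2)"
proof -
  have "(\<lambda>x. casimir * x - casimir_eig CARD('p) s *\<^sub>U x) = (\<lambda>x :: 'p uqsl2. cas s * x)"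
    by (simp add: cas_def left_diff_distrib)
  moreover have "((\<lambda>x :: 'p uqsl2. cas s * x) ^^ n) x = cas s ^ n * x"
    by (induction n) (simp_all add: mult.assoc)
  ultimately show ?thesis by simp
qed

lemma blocks_independent:
  fixes y :: "nat \<Rightarrow> 'p::finite uqsl2"
  assumes p: "2 \<le> CARD('p)" and y: "\<And>s. s \<le> CARD('p) \<Longrightarrow> y s \<in> blk s" "(\<Sum>s\<le>CARD('p). y s) = 0"
    and s: "s \<le> CARD('p)"
  shows "y s = 0"
proof -
  have "\<forall>s\<in>{..CARD('p)}. y s = 0"
  proof (rule generalized_eigenvectors_independent[where D = "\<lambda>x. casimir * x" and c = "casimir_eig CARD('p)"])
    fix s assume "s \<in> {..CARD('p)}"
    then show "\<exists>n. ((\<lambda>x. casimir * x - casimir_eig CARD('p) s *\<^sub>U x) ^^ n) (y s) = 0"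
      unfolding cas_funpow using y(1)[of s] by (auto simp: blk_def cas_def)
  qed (use y(2) casimir_eig_inj[OF p] in \<open>auto simp: distrib_left\<close>)
  then show ?thesis using s by simp
qed

lemma blk_diff:
  fixes x y :: "'p::finite uqsl2"
  assumes "x \<in> blk s" "y \<in> blk s"
  shows "x - y \<in> blk s"
proof -
  obtain m n where mn: "cas s ^ m * x = 0" "cas s ^ n * y = 0"
    using assms by (auto simp: blk_def cas_def)
  have "cas s ^ (n + m) * x = 0" "cas s ^ (m + n) * y = 0"
    by (simp_all add: power_add mult.assoc mn)
  then have "cas s ^ (m + n) * (x - y) = 0" by (simp add: right_diff_distrib add.commute)
  then show ?thesis by (auto simp: blk_def cas_def)
qed

lemma fam_combination_in_blk:
  assumes p: "2 \<le> CARD('p::finite)" and s: "s \<le> CARD('p)"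
  shows "(\<Sum>i\<in>fam_index CARD('p) s. g i *\<^sub>U (fam s i :: 'p uqsl2)) \<in> blk s"
proof -
  have "(cas s)\<^sup>2 * (\<Sum>i\<in>fam_index CARD('p) s. g i *\<^sub>U (fam s i :: 'p uqsl2)) = 0"
    unfolding sum_distrib_left
  proof (rule sum.neutral, rule ballI)
    fix i assume i: "i \<in> fam_index CARD('p) s"
    obtain T N e where "i = (T, N, e)" by (cases i)
    then show "(cas s)\<^sup>2 * (g i *\<^sub>U (fam s i :: 'p uqsl2)) = 0"
      using i cas_fam[OF p s, of T N e] by (simp add: fam_index_def)
  qed
  then show ?thesis unfolding blk_def cas_def by blast
qed

definition full_index :: "nat \<Rightarrow> (nat \<times> nat \<times> nat \<times> bool) set" where
  "full_index p = (SIGMA s:{..p}. fam_index p s)"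

lemma card_full_index:
  assumes "p \<ge> 2"
  shows "card (full_index p) = 2 * p ^ 3"
proof -
  have "card (full_index p) = (\<Sum>s\<le>p. p * p * (if 0 < s \<and> s < p then 2 else 1))"
    unfolding full_index_def by (subst card_SigmaI) (auto simp: fam_index_def card_cartesian_product intro!: sum.cong)
  also have "\<dots> = p * p * (\<Sum>s\<le>p. (if 0 < s \<and> s < p then 2 else 1))"
    by (simp add: sum_distrib_left)
  also have "{..p} = insert 0 (insert p {0<..<p})" using assms by auto
  also have "(\<Sum>s\<in>insert 0 (insert p {0<..<p}). (if 0 < s \<and> s < p then 2 else 1)) = 2 + (\<Sum>s\<in>{0<..<p}. 2 :: nat)"
    using assms by simp
  also have "p * p * \<dots> = 2 * p ^ 3"
  proof -
    have "2 + (\<Sum>s\<in>{0<..<p}. 2) = 2 * p" using assms by simp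
    then show ?thesis by (simp add: power3_eq_cube)
  qed
  finally show ?thesis .
qed

lemma full_family:
  assumes p: "2 \<le> CARD('p::finite)"
  defines "f \<equiv> (\<lambda>(s, i). fam s i :: 'p uqsl2)"
  shows "inj_on f (full_index CARD('p))" "U.independent (f ` full_index CARD('p))"
    "U.span (f ` full_index CARD('p)) = UNIV"
proof -
  have fin: "finite (full_index CARD('p))" by (simp add: full_index_def)
  have indep: "\<forall>j\<in>full_index CARD('p). g j = 0" if "(\<Sum>j\<in>full_index CARD('p). g j *\<^sub>U f j) = 0" for g
  proof -
    define y :: "nat \<Rightarrow> 'p uqsl2" where "y s = (\<Sum>i\<in>fam_index CARD('p) s. g (s, i) *\<^sub>U fam s i)" for s
    have "(\<Sum>s\<le>CARD('p). y s) = 0"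
      using that unfolding full_index_def y_def f_def by (simp add: sum.Sigma split_def)
    then have "y s = 0" if "s \<le> CARD('p)" for s
      using that blocks_independent[OF p, of y s] fam_combination_in_blk[OF p] by (auto simp: y_def)
    then have "\<forall>i\<in>fam_index CARD('p) s. g (s, i) = 0" if "s \<le> CARD('p)" for s
      using that fam_block_independent[OF p that, of "\<lambda>i. g (s, i)"] by (simp add: y_def)
    then show ?thesis by (auto simp: full_index_def)
  qed
  show inj: "inj_on f (full_index CARD('p))"
    by (rule linear_family_independent(1)[OF fin]) (rule indep)
  show ind: "U.independent (f ` full_index CARD('p))"
    by (rule linear_family_independent(2)[OF fin]) (rule indep)
  have card: "card (f ` full_index CARD('p)) = 2 * CARD('p) ^ 3"
    by (simp add: card_image[OF inj] card_full_index[OF p])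
  have "x \<in> U.span (f ` full_index CARD('p))" for x
  proof (rule ccontr)
    assume x: "x \<notin> U.span (f ` full_index CARD('p))"
    have "U.independent (insert x (f ` full_index CARD('p)))"
      using ind x by (rule U.independent_insertI[rotated])
    then have "card (insert x (f ` full_index CARD('p))) \<le> card (pbw_basis :: 'p uqsl2 set)"
      using U.independent_span_bound[OF card_pbw_basis(1)] span_pbw_basis by blast
    moreover have "x \<notin> f ` full_index CARD('p)" using x U.span_base by blast
    ultimately show False
      using card card_pbw_basis(2)[where 'p = 'p] fin by simp
  qed
  then show "U.span (f ` full_index CARD('p)) = UNIV" by blast
qed

text \<open>Given one decomposition, independence of the blocks makes it the one that the definite
  description selects; \<open>z\<close> extends it by 0 as the clause for j > p demands.\<close>

lemma blk_proj_eq: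
  fixes y :: "nat \<Rightarrow> 'p::finite uqsl2"
  assumes p: "2 \<le> CARD('p)" and y: "\<And>s. s \<le> CARD('p) \<Longrightarrow> y s \<in> blk s" "x = (\<Sum>s\<le>CARD('p). y s)"
    and s: "s \<le> CARD('p)"
  shows "blk_proj s x = y s"
proof -
  define z where "z j = (if j \<le> CARD('p) then y j else 0)" for j
  have "(THE y. (\<forall>j \<le> CARD('p). y j \<in> blk j) \<and> (\<forall>j > CARD('p). y j = 0) \<and> x = (\<Sum>j \<le> CARD('p). y j)) = z"
  proof (rule the_equality)
    show "(\<forall>j \<le> CARD('p). z j \<in> blk j) \<and> (\<forall>j > CARD('p). z j = 0) \<and> x = (\<Sum>j \<le> CARD('p). z j)"
      using y by (simp add: z_def)
    fix w :: "nat \<Rightarrow> 'p uqsl2"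
    assume w: "(\<forall>j \<le> CARD('p). w j \<in> blk j) \<and> (\<forall>j > CARD('p). w j = 0) \<and> x = (\<Sum>j \<le> CARD('p). w j)"
    have "w j - y j = 0" if "j \<le> CARD('p)" for j
      by (rule blocks_independent[OF p, of "\<lambda>j. w j - y j"])
        (use w y that in \<open>auto simp: sum_subtractf blk_diff\<close>)
    then show "w = z" using w by (auto simp: z_def fun_eq_iff)
  qed
  then show ?thesis using s by (simp add: blk_proj_def z_def)
qed

text \<open>One expansion serves two purposes: tau is evaluated on it, and its coefficients are the
  coordinates of the block projections.\<close>

lemma block_expansion:
  fixes x :: "'p::finite uqsl2"
  assumes p: "2 \<le> CARD('p)"
  obtains h where "x = (\<Sum>s\<le>CARD('p). \<Sum>i\<in>fam_index CARD('p) s. h s i *\<^sub>U fam s i)"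
    "\<And>s i. s \<le> CARD('p) \<Longrightarrow> i \<in> fam_index CARD('p) s
       \<Longrightarrow> coeffU (fam s ` fam_index CARD('p) s) (blk_proj s x) (fam s i) = h s i"
proof -
  define f where "f = (\<lambda>(s, i). fam s i :: 'p uqsl2)"
  note full = full_family[OF p, folded f_def]
  define g where "g = coeffU (f ` full_index CARD('p)) x"
  define h where "h s i = g (fam s i)" for s i
  have fin: "finite (full_index CARD('p))" by (simp add: full_index_def)
  have "x = (\<Sum>b\<in>f ` full_index CARD('p). g b *\<^sub>U b)"
    unfolding g_def using U.sum_representation_eq[OF full(2), of x "f ` full_index CARD('p)"] full(3) fin by simp
  also have "\<dots> = (\<Sum>j\<in>full_index CARD('p). g (f j) *\<^sub>U f j)"
    by (rule sum.reindex[OF full(1), unfolded o_def])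
  also have "\<dots> = (\<Sum>s\<le>CARD('p). \<Sum>i\<in>fam_index CARD('p) s. h s i *\<^sub>U fam s i)"
    unfolding full_index_def f_def h_def by (simp add: sum.Sigma split_def)
  finally have x: "x = (\<Sum>s\<le>CARD('p). \<Sum>i\<in>fam_index CARD('p) s. h s i *\<^sub>U fam s i)" .
  have "coeffU (fam s ` fam_index CARD('p) s) (blk_proj s x) (fam s i) = h s i"
    if s: "s \<le> CARD('p)" and i: "i \<in> fam_index CARD('p) s" for s i
  proof -
    let ?B = "fam s ` fam_index CARD('p) s :: 'p uqsl2 set"
    have proj: "blk_proj s x = (\<Sum>i\<in>fam_index CARD('p) s. h s i *\<^sub>U fam s i)"
      by (rule blk_proj_eq[OF p _ x s]) (rule fam_combination_in_blk[OF p])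
    have indep: "inj_on (fam s :: _ \<Rightarrow> 'p uqsl2) (fam_index CARD('p) s)" "U.independent ?B"
      by (rule linear_family_independent; use fam_block_independent[OF p s] in simp)+
    have "coeffU ?B (blk_proj s x) = (\<lambda>b. \<Sum>j\<in>fam_index CARD('p) s. h s j * coeffU ?B (fam s j) b)"
      unfolding proj
      by (subst U.representation_sum[OF indep(2)])
        (auto simp: U.representation_scale[OF indep(2)] U.span_base intro!: U.span_scale)
    then have "coeffU ?B (blk_proj s x) (fam s i) = (\<Sum>j\<in>fam_index CARD('p) s. h s j * coeffU ?B (fam s j) (fam s i))"
      by simp
    also have "\<dots> = (\<Sum>j\<in>fam_index CARD('p) s. if j = i then h s j else 0)"
      using i inj_onD[OF indep(1) _ i]
      by (intro sum.cong refl) (auto simp: U.representation_basis[OF indep(2)])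
    also have "\<dots> = h s i" using i by simp
    finally show ?thesis .
  qed
  with x that show ?thesis by blast
qed

section \<open>Evaluation of tau in the prescribed bases\<close>

lemma sum_bool_set: "(\<Sum>e\<in>R. f e) = (if True \<in> R then f True else 0) + (if False \<in> R then f False else (0 :: complex))"
  for R :: "bool set"
proof -
  have "(\<Sum>e\<in>R. f e) = (\<Sum>e\<in>UNIV. if e \<in> R then f e else 0)"
    by (subst sum.inter_restrict[symmetric]) auto
  then show ?thesis by (simp add: UNIV_bool)
qed

lemma tau_block:
  fixes h :: "nat \<times> nat \<times> bool \<Rightarrow> complex"
  assumes p: "2 \<le> CARD('p::finite)" and s: "s \<le> CARD('p)"
  shows "tau (\<Sum>i\<in>fam_index CARD('p) s. h i *\<^sub>U (fam s i :: 'p uqsl2))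
    = (\<Sum>T = 1..CARD('p). (if 0 < s \<and> s < CARD('p)
          then - del CARD('p) s / (gam CARD('p) s)\<^sup>2 * h (T, ix s T - 1, True) else 0)
        + 1 / gam CARD('p) s * h (T, ix s T - 1, False))"
proof -
  define R :: "bool set" where "R = (if 0 < s \<and> s < CARD('p) then UNIV else {False})"
  define k where "k e = (if e then - del CARD('p) s / (gam CARD('p) s)\<^sup>2 else 1 / gam CARD('p) s)" for e
  have "tau (\<Sum>i\<in>fam_index CARD('p) s. h i *\<^sub>U (fam s i :: 'p uqsl2))
      = (\<Sum>T\<in>{1..CARD('p)}. \<Sum>N<CARD('p). \<Sum>e\<in>R. h (T, N, e) * tau (fam s (T, N, e) :: 'p uqsl2))"
    unfolding tau_sum tau_scale fam_index_def R_def[symmetric] by (simp add: sum.cartesian_product)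
  also have "\<dots> = (\<Sum>T\<in>{1..CARD('p)}. \<Sum>N<CARD('p). if N = ix s T - 1 then \<Sum>e\<in>R. h (T, N, e) * k e else 0)"
    by (intro sum.cong refl) (auto simp: tau_fam[OF p s] k_def)
  also have "\<dots> = (\<Sum>T\<in>{1..CARD('p)}. \<Sum>e\<in>R. h (T, ix s T - 1, e) * k e)"
  proof (intro sum.cong refl)
    fix T assume "T \<in> {1..CARD('p)}"
    then have "ix s T - 1 < CARD('p)" using ix_bounds(1-3)[OF s, of T] by simp
    then show "(\<Sum>N<CARD('p). if N = ix s T - 1 then \<Sum>e\<in>R. h (T, N, e) * k e else 0)
        = (\<Sum>e\<in>R. h (T, ix s T - 1, e) * k e)" by (subst sum.delta) auto
  qed
  also have "\<dots> = (\<Sum>T\<in>{1..CARD('p)}. (if 0 < s \<and> s < CARD('p)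
          then - del CARD('p) s / (gam CARD('p) s)\<^sup>2 * h (T, ix s T - 1, True) else 0)
        + 1 / gam CARD('p) s * h (T, ix s T - 1, False))"
    unfolding sum_bool_set by (intro sum.cong refl) (auto simp: R_def k_def)
  finally show ?thesis .
qed

lemma blk_basis_eq_fam:
  assumes s: "0 < s" "s < CARD('p::finite)"
  shows "blk_basis s = (fam s ` fam_index CARD('p) s :: 'p uqsl2 set)"
proof
  let ?p = "CARD('p)"
  have index: "(T, N, e) \<in> fam_index ?p s \<longleftrightarrow> 1 \<le> T \<and> T \<le> ?p \<and> N < ?p" for T N e
    using s by (auto simp: fam_index_def)
  \<comment> \<open>T0 merely represents a sign: T0 = s stands for \<alpha> = 1 and T0 = s + 1 for
    \<alpha> = -1.\<close>
  have upper: "half_basis s (sg s T0) (rk ?p s T0) \<subseteq> (fam s ` fam_index ?p s :: 'p uqsl2 set)"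
    if T0: "\<And>t. 1 \<le> t \<Longrightarrow> t \<le> rk ?p s T0 \<Longrightarrow> \<exists>T. 1 \<le> T \<and> T \<le> ?p \<and> sg s T = sg s T0 \<and> rk ?p s T = rk ?p s T0 \<and> ix s T = t"
      for T0
  proof -
    have "f \<in> fam s ` fam_index ?p s"
      if t: "1 \<le> t" "t \<le> rk ?p s T0" and f: "\<And>T. sg s T = sg s T0 \<Longrightarrow> rk ?p s T = rk ?p s T0 \<Longrightarrow> ix s T = t \<Longrightarrow> f = fam s (T, N, e)"
        and N: "N < ?p" for f :: "'p uqsl2" and t N e
    proof -
      obtain T where "1 \<le> T" "T \<le> ?p" "sg s T = sg s T0" "rk ?p s T = rk ?p s T0" "ix s T = t"
        using T0[OF t] by blast
      then show ?thesis using f[of T] N by (intro image_eqI[of _ _ "(T, N, e)"]) (auto simp: index)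
    qed
    note mem = this
    have le: "rk ?p s T0 \<le> ?p" using s by (simp add: rk_def)
    have "Bb s (sg s T0) n (rk ?p s T0) t \<in> (fam s ` fam_index ?p s :: 'p uqsl2 set)"
      "Ab s (sg s T0) n (rk ?p s T0) t \<in> (fam s ` fam_index ?p s :: 'p uqsl2 set)"
      if "n < rk ?p s T0" "1 \<le> t" "t \<le> rk ?p s T0" for n t
      using mem[OF that(2,3), of "Bb s (sg s T0) n (rk ?p s T0) t" n True]
        mem[OF that(2,3), of "Ab s (sg s T0) n (rk ?p s T0) t" n False] that le
      by (simp_all add: fam_def)
    moreover have "Xb s (sg s T0) k (rk ?p s T0) t \<in> (fam s ` fam_index ?p s :: 'p uqsl2 set)"
      "Yb s (sg s T0) k (rk ?p s T0) t \<in> (fam s ` fam_index ?p s :: 'p uqsl2 set)"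
      if "k < ?p - rk ?p s T0" "1 \<le> t" "t \<le> rk ?p s T0" for k t
      using mem[OF that(2,3), of "Xb s (sg s T0) k (rk ?p s T0) t" "rk ?p s T0 + k" False]
        mem[OF that(2,3), of "Yb s (sg s T0) k (rk ?p s T0) t" "rk ?p s T0 + k" True] that
      by (simp_all add: fam_def)
    ultimately show ?thesis unfolding half_basis_def by blast
  qed
  have "half_basis s 1 s \<subseteq> (fam s ` fam_index ?p s :: 'p uqsl2 set)"
    using upper[of s] s by (force simp: sg_def rk_def ix_def)
  moreover have "half_basis s (-1) (?p - s) \<subseteq> (fam s ` fam_index ?p s :: 'p uqsl2 set)"
  proof -
    have "\<exists>T. 1 \<le> T \<and> T \<le> ?p \<and> sg s T = -1 \<and> rk ?p s T = ?p - s \<and> ix s T = t"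
      if "1 \<le> t" "t \<le> ?p - s" for t
      using that by (intro exI[of _ "s + t"]) (auto simp: sg_def rk_def ix_def)
    then show ?thesis using upper[of "Suc s"] by (simp add: sg_def[of s "Suc s"] rk_def[of _ s "Suc s"])
  qed
  ultimately show "blk_basis s \<subseteq> (fam s ` fam_index ?p s :: 'p uqsl2 set)"
    by (simp add: blk_basis_def)
  show "(fam s ` fam_index ?p s :: 'p uqsl2 set) \<subseteq> blk_basis s"
  proof
    fix f :: "'p uqsl2" assume "f \<in> fam s ` fam_index ?p s"
    then obtain T N e where f: "f = fam s (T, N, e)" and T: "1 \<le> T" "T \<le> ?p" "N < ?p"
      by (auto simp: index)
    note ixb = ix_bounds[OF less_imp_le[OF s(2)] T(1,2)]
    have "f \<in> half_basis s (sg s T) (rk ?p s T)"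
    proof (cases "N < rk ?p s T")
      case True
      then show ?thesis using ixb unfolding f fam_def half_basis_def by (cases e) auto
    next
      case False
      then have "N - rk ?p s T < ?p - rk ?p s T" using T ixb by linarith
      then have "Xb s (sg s T) (N - rk ?p s T) (rk ?p s T) (ix s T) \<in> (half_basis s (sg s T) (rk ?p s T) :: 'p uqsl2 set)"
        "Yb s (sg s T) (N - rk ?p s T) (rk ?p s T) (ix s T) \<in> (half_basis s (sg s T) (rk ?p s T) :: 'p uqsl2 set)"
        unfolding half_basis_def using ixb(1,2) by blast+
      then show ?thesis using False by (simp add: f fam_def Let_def)
    qed
    then show "f \<in> blk_basis s"
      by (auto simp: blk_basis_def sg_def rk_def split: if_splits)
  qed
qed

text \<open>The normalisation of \<open>Aend\<close> is gamma_s at s = 0 and s = p, one of its two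
  products being empty; so the end blocks fit the same family.\<close>

lemma gam_ends:
  "gam p 0 = 2 * of_nat p * (\<Prod>i = 1..p - 1. - qint p i * qint p (p - i))"
  "gam p p = 2 * of_nat p * (\<Prod>i = 1..p - 1. qint p i * qint p (p - i))"
  by (simp_all add: gam_def)

lemma Aend_eq_fam:
  assumes "N < CARD('p::finite)"
  shows "T \<le> CARD('p) \<Longrightarrow> (Aend 1 N T :: 'p uqsl2) = fam CARD('p) (T, N, False)"
    and "1 \<le> T \<Longrightarrow> (Aend (-1) N T :: 'p uqsl2) = fam 0 (T, N, False)"
  using assms by (simp_all add: fam_def Aend_def Ab_def gam_ends sg_def rk_def ix_def Let_def)

lemma end_basis_eq_fam:
  shows "end_basis 1 = (fam CARD('p) ` fam_index CARD('p) CARD('p) :: 'p::finite uqsl2 set)"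
    and "end_basis (-1) = (fam 0 ` fam_index CARD('p) 0 :: 'p uqsl2 set)"
proof -
  have e: "end_basis \<alpha> = (\<lambda>(T, N, e). Aend \<alpha> N T :: 'p uqsl2) ` ({1..CARD('p)} \<times> {..<CARD('p)} \<times> {False})" for \<alpha>
    unfolding end_basis_def by (auto simp: image_iff) (metis atLeastAtMost_iff lessThan_iff One_nat_def)+
  show "end_basis 1 = (fam CARD('p) ` fam_index CARD('p) CARD('p) :: 'p uqsl2 set)"
    unfolding e fam_index_def by (rule image_cong) (auto simp: Aend_eq_fam)
  show "end_basis (-1) = (fam 0 ` fam_index CARD('p) 0 :: 'p uqsl2 set)"
    unfolding e fam_index_def by (rule image_cong) (auto simp: Aend_eq_fam)
qed

lemma tau_decomposition:
  fixes x :: "'p::finite uqsl2"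
  assumes p: "2 \<le> CARD('p)"
  shows "tau x = 1 / gam CARD('p) 0 * T0 x + 1 / gam CARD('p) CARD('p) * Tp x
    + (\<Sum>s = 1..CARD('p) - 1. - del CARD('p) s / (gam CARD('p) s)\<^sup>2 * Tplus s x
        + - del CARD('p) s / (gam CARD('p) s)\<^sup>2 * Tminus s x + 1 / gam CARD('p) s * Gfun s x)"
proof -
  let ?p = "CARD('p)"
  obtain h where x: "x = (\<Sum>s\<le>?p. \<Sum>i\<in>fam_index ?p s. h s i *\<^sub>U fam s i)"
    and coeff: "\<And>s i. s \<le> ?p \<Longrightarrow> i \<in> fam_index ?p s
       \<Longrightarrow> coeffU (fam s ` fam_index ?p s) (blk_proj s x) (fam s i) = h s i"
    using block_expansion[OF p] by blast
  define \<tau> where "\<tau> s = tau (\<Sum>i\<in>fam_index ?p s. h s i *\<^sub>U (fam s i :: 'p uqsl2))" for s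
  have "tau x = (\<Sum>s\<le>?p. \<tau> s)" unfolding \<tau>_def by (subst x) (rule tau_sum)
  also have "{..?p} = insert 0 (insert ?p {1..?p - 1})" using p by auto
  also have "(\<Sum>s\<in>insert 0 (insert ?p {1..?p - 1}). \<tau> s) = \<tau> 0 + \<tau> ?p + (\<Sum>s = 1..?p - 1. \<tau> s)"
    using p by (subst sum.insert; simp)+
  also have "\<tau> 0 = 1 / gam ?p 0 * T0 x"
  proof -
    have "T0 x = (\<Sum>t = 1..?p. h 0 (t, t - 1, False))"
      unfolding T0_def end_basis_eq_fam
    proof (intro sum.cong refl)
      fix t assume t: "t \<in> {1..?p}"
      then have "Aend (-1) (t - 1) t = (fam 0 (t, t - 1, False) :: 'p uqsl2)"
        by (intro Aend_eq_fam) auto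
      then show "coeffU (fam 0 ` fam_index ?p 0) (blk_proj 0 x) (Aend (-1) (t - 1) t) = h 0 (t, t - 1, False)"
        using coeff[of 0 "(t, t - 1, False)"] t by (auto simp: fam_index_def)
    qed
    moreover have "\<tau> 0 = (\<Sum>T = 1..?p. 1 / gam ?p 0 * h 0 (T, T - 1, False))"
      unfolding \<tau>_def tau_block[OF p le0] by (intro sum.cong refl) (simp add: ix_def)
    ultimately show ?thesis by (simp only: sum_distrib_left)
  qed
  also have "\<tau> ?p = 1 / gam ?p ?p * Tp x"
  proof -
    have "Tp x = (\<Sum>t = 1..?p. h ?p (t, t - 1, False))"
      unfolding Tp_def end_basis_eq_fam
    proof (intro sum.cong refl)
      fix t assume t: "t \<in> {1..?p}"
      then have "Aend 1 (t - 1) t = (fam ?p (t, t - 1, False) :: 'p uqsl2)"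
        by (intro Aend_eq_fam) auto
      then show "coeffU (fam ?p ` fam_index ?p ?p) (blk_proj ?p x) (Aend 1 (t - 1) t) = h ?p (t, t - 1, False)"
        using coeff[of ?p "(t, t - 1, False)"] t by (auto simp: fam_index_def)
    qed
    moreover have "\<tau> ?p = (\<Sum>T = 1..?p. 1 / gam ?p ?p * h ?p (T, T - 1, False))"
      unfolding \<tau>_def tau_block[OF p order_refl] by (intro sum.cong refl) (simp add: ix_def)
    ultimately show ?thesis by (simp only: sum_distrib_left)
  qed
  also have "(\<Sum>s = 1..?p - 1. \<tau> s) = (\<Sum>s = 1..?p - 1. - del ?p s / (gam ?p s)\<^sup>2 * Tplus s x
        + - del ?p s / (gam ?p s)\<^sup>2 * Tminus s x + 1 / gam ?p s * Gfun s x)"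
  proof (intro sum.cong refl)
    fix s assume "s \<in> {1..?p - 1}"
    then have s: "0 < s" "s < ?p" by auto
    define H where "H e T = h s (T, ix s T - 1, e)" for e T
    have c: "coeffU (blk_basis s) (blk_proj s x) (fam s (T, ix s T - 1, e)) = H e T"
      if "1 \<le> T" "T \<le> ?p" for T e
    proof -
      have "ix s T - 1 < ?p" using ix_bounds(1-3)[OF less_imp_le[OF s(2)] that] by simp
      then show ?thesis
        unfolding blk_basis_eq_fam[OF s] H_def
        by (intro coeff) (use s that in \<open>auto simp: fam_index_def\<close>)
    qed
    have "fam s (t, ix s t - 1, e) = (if e then Bb s 1 (t - 1) s t else Ab s 1 (t - 1) s t :: 'p uqsl2)"
      if "t \<in> {1..s}" for t e
    proof -
      have "t - 1 < s" using that by auto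
      then show ?thesis using that by (simp add: fam_def sg_def rk_def ix_def Let_def)
    qed
    then have plus: "coeffU (blk_basis s) (blk_proj s x) (Bb s 1 (t - 1) s t) = H True t"
      "coeffU (blk_basis s) (blk_proj s x) (Ab s 1 (t - 1) s t) = H False t" if "t \<in> {1..s}" for t
      using c[of t True] c[of t False] that s by simp_all
    have fam_minus: "fam s (u + s, ix s (u + s) - 1, e)
        = (if e then Bb s (-1) (u - 1) (?p - s) u else Ab s (-1) (u - 1) (?p - s) u :: 'p uqsl2)"
      if "u \<in> {1..?p - s}" for u e
    proof -
      have "u - 1 < ?p - s" using that by auto
      then show ?thesis using that by (simp add: fam_def sg_def rk_def ix_def Let_def)
    qed
    have minus: "coeffU (blk_basis s) (blk_proj s x) (Bb s (-1) (u - 1) (?p - s) u) = H True (u + s)"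
      "coeffU (blk_basis s) (blk_proj s x) (Ab s (-1) (u - 1) (?p - s) u) = H False (u + s)" if u: "u \<in> {1..?p - s}" for u
    proof -
      have "u + s \<le> ?p" using u s by auto
      then show "coeffU (blk_basis s) (blk_proj s x) (Bb s (-1) (u - 1) (?p - s) u) = H True (u + s)"
        "coeffU (blk_basis s) (blk_proj s x) (Ab s (-1) (u - 1) (?p - s) u) = H False (u + s)"
        using c[of "u + s" True] c[of "u + s" False] u unfolding fam_minus[OF u] by simp_all
    qed
    \<comment> \<open>T = 1..s and T = s + 1..p are the two signs; so G_s is a single sum over T,
      and T_s^+ and T_s^- together make up the other.\<close>
    have split: "(\<Sum>T = 1..?p. H e T) = (\<Sum>t = 1..s. H e t) + (\<Sum>u = 1..?p - s. H e (u + s))" for e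
    proof -
      have "(\<Sum>u = 1..?p - s. H e (u + s)) = (\<Sum>T = s + 1..?p. H e T)"
        using sum.shift_bounds_cl_nat_ivl[of "H e" 1 s "?p - s"] s by (simp add: add.commute)
      moreover have "{1..?p} = {1..s} \<union> {s + 1..?p}" using s by auto
      ultimately show ?thesis by (simp add: sum.union_disjoint)
    qed
    have T: "Tplus s x = (\<Sum>t = 1..s. H True t)" "Tminus s x = (\<Sum>u = 1..?p - s. H True (u + s))"
      "Gfun s x = (\<Sum>T = 1..?p. H False T)"
      unfolding Tplus_def Tminus_def Gfun_def split by (simp_all only: plus minus cong: sum.cong)
    have "\<tau> s = (\<Sum>T = 1..?p. - del ?p s / (gam ?p s)\<^sup>2 * H True T + 1 / gam ?p s * H False T)"
      unfolding \<tau>_def tau_block[OF p less_imp_le[OF s(2)]] H_def using s by simp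
    also have "\<dots> = - del ?p s / (gam ?p s)\<^sup>2 * (\<Sum>T = 1..?p. H True T) + 1 / gam ?p s * (\<Sum>T = 1..?p. H False T)"
      by (simp only: sum.distrib sum_distrib_left)
    finally show "\<tau> s = - del ?p s / (gam ?p s)\<^sup>2 * Tplus s x
        + - del ?p s / (gam ?p s)\<^sup>2 * Tminus s x + 1 / gam ?p s * Gfun s x"
      by (simp only: T split[of True] distrib_left)
  qed
  finally show ?thesis .
qed

theorem mainTheorem6:
  fixes \<alpha>\<^sub>0 \<alpha>\<^sub>p :: complex and \<alpha>plus \<alpha>minus \<beta> :: "nat \<Rightarrow> complex" and p :: nat
  assumes p_def: "p = CARD('p::finite)" and p_ge_2: "p \<ge> 2"
    and \<alpha>\<^sub>0_def: "\<alpha>\<^sub>0 = 1 / (2 * of_nat p * (\<Prod>i = 1..p - 1. - qint p i * qint p (p - i)))"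
    and \<alpha>p_def: "\<alpha>\<^sub>p = 1 / (2 * of_nat p * (\<Prod>i = 1..p - 1. qint p i * qint p (p - i)))"
    and \<beta>_def: "\<And>s. 1 \<le> s \<Longrightarrow> s \<le> p - 1 \<Longrightarrow> \<beta> s = 1 / gam p s"
    and \<alpha>plus_def: "\<And>s. 1 \<le> s \<Longrightarrow> s \<le> p - 1 \<Longrightarrow> \<alpha>plus s = - del p s / (gam p s)\<^sup>2"
    and \<alpha>minus_def: "\<And>s. 1 \<le> s \<Longrightarrow> s \<le> p - 1 \<Longrightarrow> \<alpha>minus s = - del p s / (gam p s)\<^sup>2"
  shows
    "(bal_inv \<rightharpoonup>\<^sub>U lam) = (mu \<leftharpoonup>\<^sub>U (bal :: 'p uqsl2)) \<and>
     (bal_inv \<rightharpoonup>\<^sub>U lam) = (\<lambda>x :: 'p uqsl2. \<alpha>\<^sub>0 * T0 x + \<alpha>\<^sub>p * Tp x +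
        (\<Sum>s = 1..p - 1. \<alpha>plus s * Tplus s x + \<alpha>minus s * Tminus s x + \<beta> s * Gfun s x)) \<and>
     \<alpha>\<^sub>0 = (-1) ^ (p - 1) / (2 * of_nat p ^ 3) * of_real (2 * sin (pi / real p)) ^ (2 * (p - 1)) \<and>
     \<alpha>\<^sub>p = 1 / (2 * of_nat p ^ 3) * of_real (2 * sin (pi / real p)) ^ (2 * (p - 1)) \<and>
     (\<forall>s. 1 \<le> s \<and> s \<le> p - 1 \<longrightarrow>
        \<beta> s = (-1) ^ (p - s - 1) / (2 * of_nat p ^ 3) * (qint p s)\<^sup>2
                * of_real (2 * sin (pi / real p)) ^ (2 * (p - 1)) \<and>
        \<alpha>plus s = \<alpha>minus s \<and>
        \<alpha>plus s = - \<beta> s * ((\<Sum>l = 1..s - 1. 1 / (qint p l * qint p (s - l)))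
                          - (\<Sum>l = 1..p - s - 1. 1 / (qint p l * qint p (p - s - l)))))"
proof (intro conjI allI impI)
  have card: "2 \<le> CARD('p)" using p_def p_ge_2 by simp
  show "(bal_inv \<rightharpoonup>\<^sub>U lam) = (mu \<leftharpoonup>\<^sub>U (bal :: 'p uqsl2))"
    by (simp only: hooks_eq_tau[OF card])
  show "(bal_inv \<rightharpoonup>\<^sub>U lam) = (\<lambda>x :: 'p uqsl2. \<alpha>\<^sub>0 * T0 x + \<alpha>\<^sub>p * Tp x +
        (\<Sum>s = 1..p - 1. \<alpha>plus s * Tplus s x + \<alpha>minus s * Tminus s x + \<beta> s * Gfun s x))"
  proof
    fix x :: "'p uqsl2"
    have "(\<Sum>s = 1..p - 1. \<alpha>plus s * Tplus s x + \<alpha>minus s * Tminus s x + \<beta> s * Gfun s x)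
      = (\<Sum>s = 1..p - 1. - del p s / (gam p s)\<^sup>2 * Tplus s x
        + - del p s / (gam p s)\<^sup>2 * Tminus s x + 1 / gam p s * Gfun s x)"
      by (intro sum.cong refl) (simp add: \<alpha>plus_def \<alpha>minus_def \<beta>_def)
    then show "(bal_inv \<rightharpoonup>\<^sub>U lam) x = \<alpha>\<^sub>0 * T0 x + \<alpha>\<^sub>p * Tp x +
        (\<Sum>s = 1..p - 1. \<alpha>plus s * Tplus s x + \<alpha>minus s * Tminus s x + \<beta> s * Gfun s x)"
      using tau_decomposition[OF card, of x]
      by (simp only: hooks_eq_tau[OF card] \<alpha>\<^sub>0_def \<alpha>p_def gam_ends p_def)
  qed
  define S where "S = (of_real (2 * sin (pi / real p)) :: complex) ^ (2 * (p - 1))"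
  have prod: "(\<Prod>i = 1..p - 1. qint p i * qint p (p - i)) = of_nat p ^ 2 / S"
    unfolding S_def by (rule prod_qint_symm[OF p_ge_2])
  have sign: "(-1) ^ n / (z :: complex) = 1 / ((-1) ^ n * z)" for n z
    by (cases "even n") simp_all
  show "\<alpha>\<^sub>p = 1 / (2 * of_nat p ^ 3) * of_real (2 * sin (pi / real p)) ^ (2 * (p - 1))"
    unfolding \<alpha>p_def prod S_def[symmetric] by (simp add: power2_eq_square power3_eq_cube)
  have "(\<Prod>i = 1..p - 1. - qint p i * qint p (p - i)) = (-1) ^ (p - 1) * (of_nat p ^ 2 / S)"
    unfolding prod[symmetric] by (simp add: prod_uminus)
  then show "\<alpha>\<^sub>0 = (-1) ^ (p - 1) / (2 * of_nat p ^ 3) * of_real (2 * sin (pi / real p)) ^ (2 * (p - 1))"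
    unfolding \<alpha>\<^sub>0_def S_def[symmetric] sign by (simp add: power2_eq_square power3_eq_cube mult_ac)
  fix s assume "1 \<le> s \<and> s \<le> p - 1"
  then have s: "1 \<le> s" "s \<le> p - 1" "s < p" by auto
  show "\<beta> s = (-1) ^ (p - s - 1) / (2 * of_nat p ^ 3) * (qint p s)\<^sup>2
                * of_real (2 * sin (pi / real p)) ^ (2 * (p - 1))"
    unfolding \<beta>_def[OF s(1,2)] by (rule inverse_gam[OF p_ge_2 s(1,3)])
  show "\<alpha>plus s = \<alpha>minus s" by (simp only: \<alpha>plus_def[OF s(1,2)] \<alpha>minus_def[OF s(1,2)])
  show "\<alpha>plus s = - \<beta> s * ((\<Sum>l = 1..s - 1. 1 / (qint p l * qint p (s - l)))
                          - (\<Sum>l = 1..p - s - 1. 1 / (qint p l * qint p (p - s - l))))"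
    using gam_nonzero[OF p_ge_2 less_imp_le[OF s(3)]]
    unfolding \<alpha>plus_def[OF s(1,2)] \<beta>_def[OF s(1,2)] del_over_gam[OF p_ge_2 s(1,3)]
    by (simp add: power2_eq_square)
qed

end
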